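(* Let $k,\ell\in\mathbb{N}$, let $h\in (S V_k\otimes \bigwedge V_{2\ell})^*$ be a $(k,2\ell)$-color edge coloring model, and let $f=p_h$ be its (mixed) partition function, a graph parameter $f:\mathcal{G}\to\mathbb{C}$. For $t\in\mathbb{N}$ let $M_{f,t}$ be the $t$-th edge-connection matrix of $f$. Then $$\mathrm{rk}(M_{f,t})\le (k+2\ell)^t\quad\text{for each } t\in\mathbb{N}.$$
   Context: Conventions. $\mathbb{N}=\mathbb{Z}_{\ge 0}$ and $[n]=\{1,\dots,n\}$. All graphs are finite and may have loops and multiple edges. The circle $\bigcirc$, a single edge with empty vertex set, is regarded as a connected graph, so graphs may have components that are circles. $\mathcal{G}$ denotes the set of all graphs (up to isomorphism). A loop at $v$ is incident with $v$ twice: it counts twice in the degree of $v$ and occurs twice among the edges incident with $v$. Fragments and edge-connection matrices. A $t$-fragment is a graph having $t$ vertices of degree one labeled $1,\dots,t$ (its other vertices are unlabeled); $\mathcal{F}_t$ is the collection of all $t$-fragments. For $F_1,F_2\in\mathcal{F}_t$, the graph $F_1*F_2\in\mathcal{G}$ is obtained from the disjoint union $F_1\cup F_2$ as follows: for each $i\in[t]$, remove the two vertices labeled $i$ and glue together the edge of $F_1$ and the edge of $F_2$ that were incident with them, into a single edge. (Gluing edges both of whose endpoints are labeled may create circles.) For $f:\mathcal{G}\to\mathbb{C}$, the matrix $M_{f,t}$ is the infinite $\mathcal{F}_t\times\mathcal{F}_t$ matrix with $M_{f,t}(F_1,F_2)=f(F_1*F_2)$; $\mathrm{rk}$ denotes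 its rank over $\mathbb{C}$. Algebra. $V_k$ is a complex vector space with basis $e_1,\dots,e_k$, and $V_{2\ell}$ is a complex vector space with basis $f_1,\dots,f_{2\ell}$. $SV_k$ is the symmetric algebra of $V_k$ (product written $\odot$) and $\bigwedge V_{2\ell}$ is the exterior algebra of $V_{2\ell}$ (product $\wedge$); empty products equal $1$. $(\cdot)^*$ is the full linear dual. Define $g_i:=-f_{i+\ell}$ for $i\le \ell$ and $g_i:=f_{i-\ell}$ for $i>\ell$. Eulerian subsets, orientations and pairings. Let $G=(V,E)$ be a graph. A subset $F\subseteq E$ is Eulerian if every vertex has even degree in $G(F):=(V,F)$. An Eulerian orientation $\omega$ of $F$ is an orientation of the edges in $F$ such that at each vertex the number of incoming arcs equals the number of outgoing arcs (a loop is both incoming and outgoing at its vertex). A local pairing $\kappa$ of $G(F)$ is, for each $v\in V$, a decomposition $\kappa_v$ of the edges of $F$ incident with $v$ into ordered pairs; it is compatible with $\omega$ if for each $v\in V$ and each $(a_1,a_2)\in\kappa_v$, $a_1$ is incoming at $v$ and $a_2$ is outgoing at $v$ under $\omega$ (so $\kappa_v$ is a bijection from the arcs of $F$ incoming at $v$ to those outgoing at $v$). Following each arc $a_1$ by the arc $a_2$ with which it is paired at the head of $a_1$ decomposes $F$ into circuits; $c(\kappa)$ is the number of these circuits, where each circle contained in $F$ counts as one circuit. Mixed partition functions. An element $h\in (SV_k\otimes\bigwedge V_{2\ell})^*$ is called a $(k,2\ell)$-color edge coloring model. For $F\subseteq E$ Eulerian, with Eulerian orientation $\omega$ and compatible local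 pairing $\kappa$, set $$s_h(G,F,\omega,\kappa):=(-1)^{c(\kappa)}\sum_{\substack{\phi:F\to[2\ell]\\ \psi:E\setminus F\to[k]}}\ \prod_{v\in V}h\Big(\bigodot_{a\in\delta_{E\setminus F}(v)}e_{\psi(a)}\otimes\bigwedge_{(a_1,a_2)\in\kappa_v} f_{\phi(a_1)}\wedge g_{\phi(a_2)}\Big),$$ where $\delta_{E\setminus F}(v)$ is the collection of edges incident with $v$ not in $F$ (loops occurring twice). This value is known to be independent of the choice of $\omega$ and $\kappa$ and is denoted $s_h(G,F)$. The partition function of $h$ is $$p_h(G):=\sum_{F\subseteq E,\ F\text{ Eulerian}}s_h(G,F).$$ In particular $p_h(\bigcirc)=k-2\ell$. *)

theory Defs
  imports
    Complex_Main
    "HOL-Library.Poly_Mapping"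
    "HOL-Library.Multiset"
    "HOL-Library.FuncSet"
    "HOL-Library.Extended_Nat"
    "HOL-Library.Function_Algebras"
    "HOL-Combinatorics.Orbits"
begin

section \<open>Graphs, fragments and gluing\<close>

text \<open>
  The multiset \<open>ends G e\<close> holds the endpoints of the edge \<open>e\<close>: it is \<open>{#u, v#}\<close> for an edge
  joining \<open>u\<close> and \<open>v\<close>, \<open>{#v, v#}\<close> for a loop at \<open>v\<close>, and \<open>{#}\<close> for a circle.
\<close>

record ('v, 'e) mgraph =
  verts :: "'v set"
  edges :: "'e set"
  ends :: "'e \<Rightarrow> 'v multiset"

definition wf_mgraph :: "('v, 'e) mgraph \<Rightarrow> bool" where
  "wf_mgraph G \<longleftrightarrow> finite (verts G) \<and> finite (edges G) \<and>
     (\<forall>e\<in>edges G. size (ends G e) \<in> {0, 2} \<and> set_mset (ends G e) \<subseteq> verts G)"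

definition incident_edges :: "('v, 'e) mgraph \<Rightarrow> 'e set \<Rightarrow> 'v \<Rightarrow> 'e multiset" where
  "incident_edges G D v = (\<Sum>e\<in>D. replicate_mset (count (ends G e) v) e)"

definition degree_in :: "('v, 'e) mgraph \<Rightarrow> 'e set \<Rightarrow> 'v \<Rightarrow> nat" where
  "degree_in G D v = size (incident_edges G D v)"

text \<open>
  Every finite graph is isomorphic to one whose vertices and edges are natural numbers, so the
  set \<open>fragments t\<close> meets every isomorphism class of \<open>t\<close>-fragments. That a class is met more than
  once only repeats rows and columns of the connection matrix.
\<close>

record fragment =
  graph_of :: "(nat, nat) mgraph"
  label :: "nat \<Rightarrow> nat"

definition fragments :: "nat \<Rightarrow> fragment set" where
  "fragments t = {F. wf_mgraph (graph_of F) \<and> inj_on (label F) {1..t} \<and>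
     (\<forall>i\<in>{1..t}. label F i \<in> verts (graph_of F) \<and>
        degree_in (graph_of F) (edges (graph_of F)) (label F i) = 1)}"

definition disjoint_union ::
    "('v, 'e) mgraph \<Rightarrow> ('w, 'd) mgraph \<Rightarrow> ('v + 'w, 'e + 'd) mgraph" where
  "disjoint_union G H =
     \<lparr> verts = verts G <+> verts H,
       edges = edges G <+> edges H,
       ends = (\<lambda>x. case x of Inl e \<Rightarrow> image_mset Inl (ends G e)
                           | Inr d \<Rightarrow> image_mset Inr (ends H d)) \<rparr>"

definition glued_pairs ::
    "nat \<Rightarrow> fragment \<Rightarrow> fragment \<Rightarrow> ((nat + nat) \<times> (nat + nat)) set" where
  "glued_pairs t F1 F2 =
     {(Inl e, Inr d) | e d. e \<in> edges (graph_of F1) \<and> d \<in> edges (graph_of F2) \<and>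
        (\<exists>i\<in>{1..t}. label F1 i \<in># ends (graph_of F1) e \<and> label F2 i \<in># ends (graph_of F2) d)}"

text \<open>
  An edge of the glued graph is a class of edges of the disjoint union that are glued into one,
  possibly through several labels. Its endpoints are those endpoints of its members that survive
  the removal of the labeled vertices; there are two of them, or none if the class closes up to
  a circle (or consists of a circle).
\<close>

definition glue :: "nat \<Rightarrow> fragment \<Rightarrow> fragment \<Rightarrow> (nat + nat, (nat + nat) set) mgraph" where
  "glue t F1 F2 =
     (let U = disjoint_union (graph_of F1) (graph_of F2);
          R = (glued_pairs t F1 F2 \<union> (glued_pairs t F1 F2)\<inverse>)\<^sup>*;
          W = verts U - (label F1 ` {1..t} <+> label F2 ` {1..t})
      in \<lparr> verts = W,
           edges = edges U // R,
           ends = (\<lambda>C. filter_mset (\<lambda>v. v \<in> W) (\<Sum>e\<in>C. ends U e)) \<rparr>)"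


section \<open>Rank of a matrix with an infinite index set\<close>

global_interpretation fun_space: vector_space "\<lambda>(c :: complex) (r :: 'i \<Rightarrow> complex) j. c * r j"
  by unfold_locales (auto simp: plus_fun_def algebra_simps)

definition matrix_row :: "'i set \<Rightarrow> ('i \<Rightarrow> 'i \<Rightarrow> complex) \<Rightarrow> 'i \<Rightarrow> 'i \<Rightarrow> complex" where
  "matrix_row I M i = (\<lambda>j. if j \<in> I then M i j else 0)"

text \<open>
  The rank is the maximal number of linearly independent rows, and \<open>\<infinity>\<close> if there is no maximum.
\<close>

definition matrix_rank :: "'i set \<Rightarrow> ('i \<Rightarrow> 'i \<Rightarrow> complex) \<Rightarrow> enat" where
  "matrix_rank I M =
     (SUP S \<in> {S. S \<subseteq> matrix_row I M ` I \<and> finite S \<and> fun_space.independent S}. enat (card S))"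

definition connection_matrix ::
    "((nat + nat, (nat + nat) set) mgraph \<Rightarrow> complex) \<Rightarrow> nat \<Rightarrow> fragment \<Rightarrow> fragment \<Rightarrow> complex" where
  "connection_matrix f t F1 F2 = f (glue t F1 F2)"


section \<open>The space in which edge coloring models are functionals\<close>

text \<open>
  The symmetric algebra on the basis \<open>e\<^sub>1, \<dots>, e\<^sub>k\<close> is the polynomial ring in these elements, with
  the product of \<open>_ \<Rightarrow>\<^sub>0 _\<close>. An element of the exterior algebra is given by its coefficients with
  respect to the products, in increasing order of the indices, of the generators indexed by a
  finite set. In the tensor product, the pair \<open>(m, A)\<close> indexes the tensor product of the monomial
  with exponent \<open>m\<close> and the basis element belonging to \<open>A\<close>.
\<close>

type_synonym sym_alg = "(nat \<Rightarrow>\<^sub>0 nat) \<Rightarrow>\<^sub>0 complex"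
type_synonym ext_alg = "nat set \<Rightarrow>\<^sub>0 complex"
type_synonym mixed_alg = "((nat \<Rightarrow>\<^sub>0 nat) \<times> nat set) \<Rightarrow>\<^sub>0 complex"

definition sym_gen :: "nat \<Rightarrow> sym_alg" where
  "sym_gen i = Poly_Mapping.single (Poly_Mapping.single i 1) 1"

definition ext_one :: ext_alg where
  "ext_one = Poly_Mapping.single {} 1"

definition ext_gen :: "nat \<Rightarrow> ext_alg" where
  "ext_gen i = Poly_Mapping.single {i} 1"

definition wedge_sign :: "nat set \<Rightarrow> nat set \<Rightarrow> complex" where
  "wedge_sign A B =
     (if A \<inter> B = {} then (-1) ^ card {(a, b). a \<in> A \<and> b \<in> B \<and> b < a} else 0)"

definition wedge :: "ext_alg \<Rightarrow> ext_alg \<Rightarrow> ext_alg" where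
  "wedge x y = (\<Sum>A\<in>Poly_Mapping.keys x. \<Sum>B\<in>Poly_Mapping.keys y.
     Poly_Mapping.single (A \<union> B)
       (wedge_sign A B * (Poly_Mapping.lookup x A * Poly_Mapping.lookup y B)))"

text \<open>
  The order of the factors is immaterial when, as in every use below, all of them have even degree.
\<close>

definition wedge_prod :: "('a \<Rightarrow> ext_alg) \<Rightarrow> 'a set \<Rightarrow> ext_alg" where
  "wedge_prod P S = Finite_Set.fold (\<lambda>a. wedge (P a)) ext_one S"

definition tensor :: "sym_alg \<Rightarrow> ext_alg \<Rightarrow> mixed_alg" where
  "tensor x y = (\<Sum>m\<in>Poly_Mapping.keys x. \<Sum>A\<in>Poly_Mapping.keys y.
     Poly_Mapping.single (m, A) (Poly_Mapping.lookup x m * Poly_Mapping.lookup y A))"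

definition mixed_space :: "nat \<Rightarrow> nat \<Rightarrow> mixed_alg set" where
  "mixed_space k l =
     {z. Poly_Mapping.keys z \<subseteq> {m. Poly_Mapping.keys m \<subseteq> {1..k}} \<times> Pow {1..2 * l}}"

definition edge_coloring_model :: "nat \<Rightarrow> nat \<Rightarrow> (mixed_alg \<Rightarrow> complex) \<Rightarrow> bool" where
  "edge_coloring_model k l h \<longleftrightarrow>
     (\<forall>x\<in>mixed_space k l. \<forall>y\<in>mixed_space k l. h (x + y) = h x + h y) \<and>
     (\<forall>c. \<forall>x\<in>mixed_space k l. h (Poly_Mapping.map (\<lambda>a. c * a) x) = c * h x)"

definition dual_gen :: "nat \<Rightarrow> nat \<Rightarrow> ext_alg" where
  "dual_gen l i = (if i \<le> l then - ext_gen (i + l) else ext_gen (i - l))"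


section \<open>Mixed partition functions\<close>

definition eulerian :: "('v, 'e) mgraph \<Rightarrow> 'e set \<Rightarrow> bool" where
  "eulerian G F \<longleftrightarrow> F \<subseteq> edges G \<and> (\<forall>v\<in>verts G. even (degree_in G F v))"

text \<open>
  An orientation \<open>w\<close> sends each edge of \<open>F\<close> other than a circle to its pair (tail, head).
\<close>

definition in_arcs :: "('v, 'e) mgraph \<Rightarrow> 'e set \<Rightarrow> ('e \<Rightarrow> 'v \<times> 'v) \<Rightarrow> 'v \<Rightarrow> 'e set" where
  "in_arcs G F w v = {e\<in>F. ends G e \<noteq> {#} \<and> snd (w e) = v}"

definition out_arcs :: "('v, 'e) mgraph \<Rightarrow> 'e set \<Rightarrow> ('e \<Rightarrow> 'v \<times> 'v) \<Rightarrow> 'v \<Rightarrow> 'e set" where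
  "out_arcs G F w v = {e\<in>F. ends G e \<noteq> {#} \<and> fst (w e) = v}"

definition eulerian_orientation ::
    "('v, 'e) mgraph \<Rightarrow> 'e set \<Rightarrow> ('e \<Rightarrow> 'v \<times> 'v) \<Rightarrow> bool" where
  "eulerian_orientation G F w \<longleftrightarrow>
     (\<forall>e\<in>F. ends G e \<noteq> {#} \<longrightarrow> ends G e = {#fst (w e), snd (w e)#}) \<and>
     (\<forall>v\<in>verts G. card (in_arcs G F w v) = card (out_arcs G F w v))"

text \<open>The ordered pairs of the local pairing at \<open>v\<close> are \<open>(a, p v a)\<close> for the arcs \<open>a\<close> entering \<open>v\<close>.\<close>

definition compatible_pairing ::
    "('v, 'e) mgraph \<Rightarrow> 'e set \<Rightarrow> ('e \<Rightarrow> 'v \<times> 'v) \<Rightarrow> ('v \<Rightarrow> 'e \<Rightarrow> 'e) \<Rightarrow> bool" where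
  "compatible_pairing G F w p \<longleftrightarrow>
     (\<forall>v\<in>verts G. bij_betw (p v) (in_arcs G F w v) (out_arcs G F w v))"

definition next_arc ::
    "('v, 'e) mgraph \<Rightarrow> ('e \<Rightarrow> 'v \<times> 'v) \<Rightarrow> ('v \<Rightarrow> 'e \<Rightarrow> 'e) \<Rightarrow> 'e \<Rightarrow> 'e" where
  "next_arc G w p a = (if ends G a = {#} then a else p (snd (w a)) a)"

definition num_circuits ::
    "('v, 'e) mgraph \<Rightarrow> 'e set \<Rightarrow> ('e \<Rightarrow> 'v \<times> 'v) \<Rightarrow> ('v \<Rightarrow> 'e \<Rightarrow> 'e) \<Rightarrow> nat" where
  "num_circuits G F w p = card ((\<lambda>a. orbit (next_arc G w p) a) ` F)"

definition oriented_weight ::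
    "nat \<Rightarrow> nat \<Rightarrow> (mixed_alg \<Rightarrow> complex) \<Rightarrow> ('v, 'e) mgraph \<Rightarrow> 'e set \<Rightarrow>
     ('e \<Rightarrow> 'v \<times> 'v) \<Rightarrow> ('v \<Rightarrow> 'e \<Rightarrow> 'e) \<Rightarrow> complex" where
  "oriented_weight k l h G F w p =
     (-1) ^ num_circuits G F w p *
     (\<Sum>\<phi>\<in>F \<rightarrow>\<^sub>E {1..2 * l}. \<Sum>\<psi>\<in>(edges G - F) \<rightarrow>\<^sub>E {1..k}. \<Prod>v\<in>verts G.
        h (tensor
             (\<Prod>a\<in>#incident_edges G (edges G - F) v. sym_gen (\<psi> a))
             (wedge_prod (\<lambda>a. wedge (ext_gen (\<phi> a)) (dual_gen l (\<phi> (p v a))))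
                (in_arcs G F w v))))"

text \<open>
  The value does not depend on the orientation and the pairing, and these exist for every
  Eulerian \<open>F\<close>; one choice is made here.
\<close>

definition eulerian_weight ::
    "nat \<Rightarrow> nat \<Rightarrow> (mixed_alg \<Rightarrow> complex) \<Rightarrow> ('v, 'e) mgraph \<Rightarrow> 'e set \<Rightarrow> complex" where
  "eulerian_weight k l h G F =
     (SOME s. \<exists>w p. eulerian_orientation G F w \<and> compatible_pairing G F w p \<and>
        s = oriented_weight k l h G F w p)"

definition mixed_partition_function ::
    "nat \<Rightarrow> nat \<Rightarrow> (mixed_alg \<Rightarrow> complex) \<Rightarrow> ('v, 'e) mgraph \<Rightarrow> complex" where
  "mixed_partition_function k l h G = (\<Sum>F | eulerian G F. eulerian_weight k l h G F)"

end

(*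
  Split every edge into two darts. An edge color in [k] is even and one in [2l] is odd. For an Eulerian
  set F the orientation, the local pairing and the sign (-1)^c can be traded for one invariant sign:
  (-1)^c is the sign of the permutation that carries the arrangement of the darts of F by pairs of the
  pairing into their arrangement by oriented edges, tail first. The coefficients of f_i in g_j form an
  antisymmetric matrix and a product of generators changes its sign with every transposition, so the
  signed sum over dart colorings depends on neither arrangement. Hence p_h(G) is (k-2l)^#circles times
  a contraction of the vertex functionals along the edges.

  Cut a glued graph at the labels by contracting the two darts at each label with the inverse of the
  edge form. Contracting one label merges two edges into one (the form composed with its inverse and
  itself is the form) or closes an edge to a circle, which gives the factor k-2l. In each case two
  neighbouring darts are deleted from both arrangements, and the sign does not change. Before any
  contraction the sum over the colors of the 2t label darts separates the two fragments, so every
  row of the connection matrix is a combination of (k+2l)^t fixed rows.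
*)
theory Submission
  imports Defs
begin

section \<open>Signs of arrangements\<close>

text \<open>The colors span a superspace of dimension (k, 2l) with a supersymmetric form, p_h is a
  contraction of even tensors in it, and k - 2l is its superdimension. Signs enter as relative signs
  of two arrangements of the same odd darts, so the linear order used to compute them drops out.
  This also settles the choice hidden in \<open>eulerian_weight\<close>: every orientation and
  pairing gives the same expression, which mentions neither. A circle has no dart and is invisible
  to a dart coloring, so circles are counted by separate powers of k - 2l. As this number may be 0,
  the powers stay as factors on both sides of an equation and are never divided out. That the bound
  has exponent t and not 2t comes from absorbing the inverse form, which couples the two colorings
  of the labels, into the side of the second fragment: only the label colors of the first fragment
  index the spanning rows. For this the data of each fragment must be built without reference to the
  other, hence the fixed coding of darts by natural numbers.\<close>

definition pair_sign :: "'a::linorder \<Rightarrow> 'a \<Rightarrow> complex" where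
  "pair_sign x y = (if x = y then 0 else if x < y then 1 else -1)"

text \<open>The value 0 on equal arguments makes antisymmetry unconditional, so the exchange rules
  below also hold for lists with repetitions. It mirrors that a repeated odd generator gives
  0.\<close>

lemma pair_sign_swap: "pair_sign y x = - pair_sign x y"
  by (auto simp: pair_sign_def)

lemma pair_sign_same [simp]: "pair_sign x x = 0"
  by (simp add: pair_sign_def)

text \<open>The part of the sign that compares two blocks. It is multiplicative in both arguments
  and, unlike \<open>list_sign\<close>, ignores the order within each block.\<close>

definition cross_sign :: "'a::linorder list \<Rightarrow> 'a list \<Rightarrow> complex" where
  "cross_sign xs ys = (\<Prod>x\<leftarrow>xs. \<Prod>y\<leftarrow>ys. pair_sign x y)"

lemma prod_list_map_mult:
  "(\<Prod>x\<leftarrow>xs. f x * g x) = (\<Prod>x\<leftarrow>xs. f x) * (\<Prod>x\<leftarrow>xs. g x :: 'b::comm_monoid_mult)"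
  by (induction xs) (auto simp: ac_simps)

lemma prod_list_map_mset:
  "mset xs = mset ys \<Longrightarrow> (\<Prod>x\<leftarrow>xs. f x) = (\<Prod>x\<leftarrow>ys. f x :: 'b::comm_monoid_mult)"
  by (metis mset_map prod_mset_prod_list)

lemma prod_list_neg_one:
  "(\<Prod>x\<leftarrow>xs. - (f x :: complex)) = (-1) ^ length xs * (\<Prod>x\<leftarrow>xs. f x)"
  by (induction xs) auto

lemma cross_sign_simps [simp]:
  "cross_sign [] ys = 1" "cross_sign xs [] = 1"
  "cross_sign (xs @ xs') ys = cross_sign xs ys * cross_sign xs' ys"
  "cross_sign xs (ys @ ys') = cross_sign xs ys * cross_sign xs ys'"
  by (auto simp: cross_sign_def prod_list_map_mult map_replicate_const)

lemma cross_sign_Cons: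
  "cross_sign (x # xs) ys = cross_sign [x] ys * cross_sign xs ys"
  "cross_sign ys (x # xs) = cross_sign ys [x] * cross_sign ys xs"
  by (simp_all add: cross_sign_def prod_list_map_mult)

lemma cross_sign_Cons_simps:
  "cross_sign [x] (y # ys) = pair_sign x y * cross_sign [x] ys"
  by (simp add: cross_sign_def)

lemma cross_sign_mset:
  assumes "mset xs = mset xs'" "mset ys = mset ys'"
  shows "cross_sign xs ys = cross_sign xs' ys'"
  unfolding cross_sign_def prod_list_map_mset[OF assms(1)]
  by (intro arg_cong[where f = prod_list] map_cong refl prod_list_map_mset assms(2))

lemma cross_sign_swap: "cross_sign ys xs = (-1) ^ (length xs * length ys) * cross_sign xs ys"
proof (induction ys)
  case (Cons y ys)
  have "cross_sign [y] xs = (-1) ^ length xs * cross_sign xs [y]"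
    by (simp add: cross_sign_def prod_list_neg_one[symmetric] pair_sign_swap[symmetric])
  then show ?case using Cons
    by (simp add: cross_sign_Cons(1)[of y ys] cross_sign_Cons(2)[of _ y ys] power_add)
qed auto

lemma cross_sign_cases:
  "set xs \<inter> set ys = {} \<Longrightarrow> cross_sign xs ys = 1 \<or> cross_sign xs ys = -1"
proof (induction xs)
  case (Cons x xs)
  have "x \<notin> set ys \<Longrightarrow> cross_sign [x] ys = 1 \<or> cross_sign [x] ys = -1"
    by (induction ys) (auto simp: cross_sign_Cons_simps pair_sign_def)
  then show ?case using Cons
    by (auto simp: cross_sign_Cons(1)[of x xs])
qed auto

text \<open>The sign of the permutation that sorts the list, and \<open>0\<close> if an element is repeated.\<close>

fun list_sign :: "'a::linorder list \<Rightarrow> complex" where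
  "list_sign [] = 1"
| "list_sign (x # xs) = cross_sign [x] xs * list_sign xs"

lemma list_sign_append:
  "list_sign (xs @ ys) = list_sign xs * list_sign ys * cross_sign xs ys"
proof (induction xs)
  case (Cons x xs)
  then show ?case by (simp add: cross_sign_Cons(1)[of x xs])
qed simp

lemma list_sign_cases: "distinct xs \<Longrightarrow> list_sign xs = 1 \<or> list_sign xs = -1"
proof (induction xs)
  case (Cons x xs)
  have "cross_sign [x] xs = 1 \<or> cross_sign [x] xs = -1"
    using Cons by (intro cross_sign_cases) auto
  then show ?case using Cons by auto
qed auto

lemma list_sign_eq_0: "\<not> distinct xs \<Longrightarrow> list_sign xs = 0"
proof (induction xs)
  case (Cons x xs)
  have "x \<in> set xs \<Longrightarrow> cross_sign [x] xs = 0" for xs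
    by (induction xs) (auto simp: cross_sign_def)
  then show ?case using Cons by auto
qed auto

lemma list_sign_blocks_swap:
  "list_sign (as @ xs @ ys @ bs) =
     (-1) ^ (length xs * length ys) * list_sign (as @ ys @ xs @ bs)"
  by (simp add: list_sign_append cross_sign_swap[of ys xs] algebra_simps)

lemma list_sign_adjacent:
  "list_sign (as @ [x, y] @ bs) = - list_sign (as @ [y, x] @ bs)"
  using list_sign_blocks_swap[of as "[x]" "[y]" bs] by simp

text \<open>Adjacent transpositions generate all permutations. The function is arbitrary because the
  rule is applied to lists of darts, of edges and of pairs of generators alike.\<close>

lemma adjacent_swaps_invariant:
  assumes swap: "\<And>as x y bs. f (as @ [x, y] @ bs) = f (as @ [y, x] @ bs)"
    and "mset xs = mset ys"
  shows "f xs = f ys"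
  using assms
proof (induction xs arbitrary: ys f)
  case (Cons x xs)
  have front: "f (as @ x # bs) = f (x # as @ bs)" for as bs
  proof (induction as arbitrary: bs rule: rev_induct)
    case (snoc a as)
    have "f ((as @ [a]) @ x # bs) = f (as @ [x, a] @ bs)"
      using Cons.prems(1)[of as a x bs] by simp
    then show ?case using snoc[of "a # bs"] by simp
  qed simp
  obtain as bs where ys: "ys = as @ x # bs"
    using Cons.prems(2) by (metis list.set_intros(1) set_mset_mset split_list)
  have "(\<lambda>zs. f (x # zs)) xs = (\<lambda>zs. f (x # zs)) (as @ bs)"
  proof (rule Cons.IH)
    show "f (x # as @ [u, v] @ bs) = f (x # as @ [v, u] @ bs)" for as u v bs
      using Cons.prems(1)[of "x # as" u v bs] by simp
    show "mset xs = mset (as @ bs)" using Cons.prems(2) ys by simp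
  qed
  then show ?case using front ys by simp
qed simp

text \<open>Both factors change sign under an adjacent exchange; if \<open>f\<close> identifies the
  two entries, the second factor is 0 on both sides. This lets the sign of the darts at a vertex
  compensate the sign of their exterior generators.\<close>

lemma list_sign_map_mset:
  assumes "mset xs = mset ys"
  shows "list_sign xs * list_sign (map f xs) = list_sign ys * list_sign (map f ys)"
proof (rule adjacent_swaps_invariant[OF _ assms])
  fix as bs :: "'a list" and x y
  show "list_sign (as @ [x, y] @ bs) * list_sign (map f (as @ [x, y] @ bs)) =
    list_sign (as @ [y, x] @ bs) * list_sign (map f (as @ [y, x] @ bs))"
    using list_sign_adjacent[of as x y bs] list_sign_adjacent[of "map f as" "f x" "f y" "map f bs"]
    by (simp del: list_sign.simps)
qed

text \<open>A block of even length moves past \<open>as\<close> without a sign, so the contribution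
  of the pair depends on the multiset of the other elements and not on its position.\<close>

lemma list_sign_insert_pair:
  assumes "length ps = 2" shows
  "list_sign (as @ ps @ bs) = list_sign ps * cross_sign ps (as @ bs) * list_sign (as @ bs)"
  using list_sign_blocks_swap[of "[]" as ps bs] assms
  by (simp add: list_sign_append)

text \<open>
  Deleting the same two neighbours from two arrangements of the same elements does not change
  their relative sign. Both gluing and the passage from a pairing to its circuits reduce to this.
\<close>

lemma list_sign_delete_pair:
  assumes "mset (as @ bs) = mset (cs @ ds)" "x \<noteq> y" "x \<notin> set (as @ bs)" "y \<notin> set (as @ bs)"
  shows "list_sign (as @ [x, y] @ bs) * list_sign (cs @ [x, y] @ ds) =
    list_sign (as @ bs) * list_sign (cs @ ds)"
proof -
  define u where "u = list_sign [x, y]"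
  define v where "v = cross_sign [x, y] (as @ bs)"
  have "u = 1 \<or> u = -1"
    unfolding u_def using assms by (intro list_sign_cases) auto
  moreover have "v = 1 \<or> v = -1"
    unfolding v_def using assms by (intro cross_sign_cases) auto
  moreover have "cross_sign [x, y] (cs @ ds) = v"
    unfolding v_def using assms by (intro cross_sign_mset) auto
  then have "list_sign (cs @ [x, y] @ ds) = u * v * list_sign (cs @ ds)"
    using list_sign_insert_pair[of "[x, y]" cs ds] by (simp only: u_def) simp
  moreover have "list_sign (as @ [x, y] @ bs) = u * v * list_sign (as @ bs)"
    using list_sign_insert_pair[of "[x, y]" as bs] by (simp only: u_def v_def) simp
  ultimately show ?thesis by auto
qed

section \<open>Contraction of colored darts\<close>

lemma sum_PiE_insert:
  assumes "d \<notin> D"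
  shows "(\<Sum>c\<in>insert d D \<rightarrow>\<^sub>E C. F c) = (\<Sum>c\<in>D \<rightarrow>\<^sub>E C. \<Sum>a\<in>C. F (c(d := a)))"
proof -
  have "(\<Sum>c\<in>insert d D \<rightarrow>\<^sub>E C. F c) = (\<Sum>(a, c)\<in>C \<times> (D \<rightarrow>\<^sub>E C). F (c(d := a)))"
    unfolding PiE_insert_eq using assms
    by (subst sum.reindex[OF inj_combinator]) (auto simp: case_prod_unfold)
  then show ?thesis
    by (simp add: sum.cartesian_product[symmetric] sum.swap[of _ C])
qed

lemma sum_PiE_insert2:
  assumes "d \<notin> D" "d' \<notin> D" "d \<noteq> d'"
  shows "(\<Sum>c\<in>insert d' (insert d D) \<rightarrow>\<^sub>E C. F c) =
    (\<Sum>c\<in>D \<rightarrow>\<^sub>E C. \<Sum>a\<in>C. \<Sum>b\<in>C. F (c(d := a, d' := b)))"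
  using assms by (subst sum_PiE_insert, simp, subst sum_PiE_insert) simp_all

section \<open>Colors and the supersymmetric edge form\<close>

type_synonym color = "nat + nat"

text \<open>The left summand holds the even colors, indices of the e's, and the right one the odd
  colors, indices of the f's. One coloring of darts can thus record an Eulerian set (up to circles)
  together with both edge colorings.\<close>

definition colors :: "nat \<Rightarrow> nat \<Rightarrow> color set" where
  "colors k l = {1..k} <+> {1..2 * l}"

lemma finite_colors [simp]: "finite (colors k l)"
  by (simp add: colors_def)

lemma card_colors: "card (colors k l) = k + 2 * l"
  by (simp add: colors_def card_Plus)

lemma sum_colors:
  "(\<Sum>a\<in>colors k l. g a) = (\<Sum>i\<in>{1..k}. g (Inl i)) + (\<Sum>i\<in>{1..2 * l}. g (Inr i) :: complex)"
  unfolding colors_def by (subst sum.Plus) auto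

text \<open>In this notation g with index i is \<open>dual_sign l i\<close> times f with index
  \<open>dual_index l i\<close>.\<close>

definition dual_index :: "nat \<Rightarrow> nat \<Rightarrow> nat" where
  "dual_index l i = (if i \<le> l then i + l else i - l)"

definition dual_sign :: "nat \<Rightarrow> nat \<Rightarrow> complex" where
  "dual_sign l i = (if i \<le> l then -1 else 1)"

lemma dual_sign_square [simp]: "dual_sign l i * dual_sign l i = 1"
  by (simp add: dual_sign_def)

lemma dual_index_in: "i \<in> {1..2 * l} \<Longrightarrow> dual_index l i \<in> {1..2 * l}"
  by (auto simp: dual_index_def)

lemma dual_index_dual_index: "i \<in> {1..2 * l} \<Longrightarrow> dual_index l (dual_index l i) = i"
  by (auto simp: dual_index_def)

lemma dual_sign_dual_index: "i \<in> {1..2 * l} \<Longrightarrow> dual_sign l (dual_index l i) = - dual_sign l i"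
  by (auto simp: dual_index_def dual_sign_def)

text \<open>
  On odd colors this is the coefficient of \<open>f\<^sub>i\<close> in \<open>g\<^sub>j\<close>.
\<close>

fun edge_form :: "nat \<Rightarrow> color \<Rightarrow> color \<Rightarrow> complex" where
  "edge_form l (Inl i) (Inl j) = of_bool (i = j)"
| "edge_form l (Inr i) (Inr j) = (if i = dual_index l j then dual_sign l j else 0)"
| "edge_form l _ _ = 0"

lemma edge_form_parity: "isl x \<noteq> isl y \<Longrightarrow> edge_form l x y = 0"
  by (cases x; cases y) auto

lemma edge_form_swap:
  assumes "x \<in> colors k l" "y \<in> colors k l"
  shows "edge_form l y x = (if isl x then 1 else -1) * edge_form l x y"
  using assms
  by (cases x; cases y)
     (auto simp: colors_def dual_index_dual_index dual_sign_dual_index)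

text \<open>The matrix of the form is a signed permutation matrix, so its inverse is its transpose.
  This is why a label contracts with the form in exchanged arguments.\<close>

lemma edge_form_orthogonal:
  assumes "x \<in> colors k l" "y \<in> colors k l"
  shows "(\<Sum>a\<in>colors k l. edge_form l x a * edge_form l y a) = of_bool (x = y)"
proof (cases x)
  case (Inl i)
  have "(\<Sum>j\<in>{1..k}. of_bool (i = j) * edge_form l y (Inl j)) = (\<Sum>j\<in>{1..k}. if i = j then edge_form l y (Inl i) else 0)"
    by (intro sum.cong) auto
  moreover have "i \<in> {1..k}" using Inl assms by (auto simp: colors_def)
  ultimately show ?thesis using Inl
    by (cases y) (auto simp: sum_colors)
next
  case (Inr i)
  then have i: "i \<in> {1..2 * l}" using assms by (auto simp: colors_def)
  have "(\<Sum>j\<in>{1..2 * l}. edge_form l x (Inr j) * edge_form l y (Inr j)) =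
     (\<Sum>j\<in>{1..2 * l}. if j = dual_index l i then edge_form l x (Inr j) * edge_form l y (Inr j) else 0)"
    using i Inr by (intro sum.cong) (auto simp: dual_index_dual_index)
  also have "\<dots> = edge_form l x (Inr (dual_index l i)) * edge_form l y (Inr (dual_index l i))"
    using dual_index_in[OF i] by (subst sum.delta) auto
  finally show ?thesis using Inr assms i
    by (cases y) (auto simp: sum_colors dual_index_dual_index)
qed

text \<open>With A the matrix of the form this is A A^T A = A, the algebra behind merging two edges
  at a label.\<close>

lemma edge_form_contract:
  assumes "x \<in> colors k l" "z \<in> colors k l"
  shows "(\<Sum>a\<in>colors k l. \<Sum>b\<in>colors k l. edge_form l x a * edge_form l b z * edge_form l b a) =
    edge_form l x z"
proof -
  have "(\<Sum>a\<in>colors k l. \<Sum>b\<in>colors k l. edge_form l x a * edge_form l b z * edge_form l b a) =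
    (\<Sum>b\<in>colors k l. edge_form l b z * (\<Sum>a\<in>colors k l. edge_form l x a * edge_form l b a))"
    by (subst sum.swap) (simp add: sum_distrib_left algebra_simps)
  also have "\<dots> = (\<Sum>b\<in>colors k l. if b = x then edge_form l b z else 0)"
    using assms by (intro sum.cong refl) (subst edge_form_orthogonal, auto)
  finally show ?thesis using assms by simp
qed

text \<open>Each row of the form has square sum 1. The form vanishes between colors of different
  parity, so the sign may be read off \<open>b\<close> instead of \<open>a\<close>, leaving k rows
  with sign 1 and 2l rows with sign -1.\<close>

lemma edge_form_superdimension:
  "(\<Sum>a\<in>colors k l. \<Sum>b\<in>colors k l.
      (if isl a then 1 else -1) * (edge_form l b a * edge_form l b a)) = of_nat k - 2 * of_nat l"
proof -
  have "(\<Sum>a\<in>colors k l. \<Sum>b\<in>colors k l.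
      (if isl a then 1 else -1) * (edge_form l b a * edge_form l b a)) =
    (\<Sum>b\<in>colors k l. (if isl b then 1 else -1) * (\<Sum>a\<in>colors k l. edge_form l b a * edge_form l b a))"
    by (subst sum.swap) (auto simp: sum_distrib_left edge_form_parity intro!: sum.cong)
  also have "\<dots> = (\<Sum>b\<in>colors k l. (if isl b then 1 else -1))"
    by (intro sum.cong refl) (simp add: edge_form_orthogonal)
  finally show ?thesis by (simp add: sum_colors)
qed

section \<open>Edge weights and their independence of the arrangement\<close>

definition graded_sign :: "('d::linorder \<Rightarrow> color) \<Rightarrow> 'd list \<Rightarrow> complex" where
  "graded_sign c ds = list_sign (filter (\<lambda>d. \<not> isl (c d)) ds)"

definition flat :: "('d \<times> 'd) list \<Rightarrow> 'd list" where
  "flat Es = concat (map (\<lambda>(y, z). [y, z]) Es)"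

lemma flat_simps [simp]:
  "flat [] = []" "flat ((y, z) # Es) = y # z # flat Es" "flat (Es @ Es') = flat Es @ flat Es'"
  by (simp_all add: flat_def)

definition edge_weight ::
    "nat \<Rightarrow> ('d::linorder \<Rightarrow> color) \<Rightarrow> ('d \<times> 'd) list \<Rightarrow> complex" where
  "edge_weight l c Es = graded_sign c (flat Es) * (\<Prod>(y, z)\<leftarrow>Es. edge_form l (c y) (c z))"

text \<open>Where the form is nonzero, the two darts of an edge have the same parity, so an edge is
  a block with an even number of odd darts, and such blocks commute. If one of the exchanged edges
  has ends of different parity, both sides are 0.\<close>

lemma edge_weight_mset:
  assumes "mset Es = mset Es'"
  shows "edge_weight l c Es = edge_weight l c Es'"
proof (rule adjacent_swaps_invariant[OF _ assms])
  fix as bs :: "('a \<times> 'a) list" and p q :: "'a \<times> 'a"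
  obtain y z u v where pq: "p = (y, z)" "q = (u, v)" by fastforce
  show "edge_weight l c (as @ [p, q] @ bs) = edge_weight l c (as @ [q, p] @ bs)"
  proof (cases "isl (c y) = isl (c z) \<and> isl (c u) = isl (c v)")
    case True
    define f where "f = filter (\<lambda>d. \<not> isl (c d))"
    have "even (length (f [y, z]))" using True by (auto simp: f_def)
    then have "list_sign (f (flat as) @ f [y, z] @ f [u, v] @ f (flat bs)) =
       list_sign (f (flat as) @ f [u, v] @ f [y, z] @ f (flat bs))"
      by (subst list_sign_blocks_swap) simp
    moreover have "flat (as @ [p, q] @ bs) = flat as @ [y, z] @ [u, v] @ flat bs"
      "flat (as @ [q, p] @ bs) = flat as @ [u, v] @ [y, z] @ flat bs"
      by (simp_all add: pq)
    ultimately have "graded_sign c (flat (as @ [p, q] @ bs)) = graded_sign c (flat (as @ [q, p] @ bs))"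
      by (simp only: graded_sign_def f_def filter_append)
    then show ?thesis by (simp add: edge_weight_def)
  next
    case False
    then show ?thesis by (auto simp: pq edge_weight_def edge_form_parity)
  qed
qed

text \<open>Reversing an odd edge transposes two odd darts, and the antisymmetry of the form on odd
  colors compensates.\<close>

lemma edge_weight_flip:
  assumes "c y \<in> colors k l" "c z \<in> colors k l"
  shows "edge_weight l c (as @ (y, z) # bs) = edge_weight l c (as @ (z, y) # bs)"
proof (cases "isl (c y) = isl (c z)")
  case True
  have "list_sign (as' @ [y, z] @ bs') = - list_sign (as' @ [z, y] @ bs')" for as' bs'
    by (rule list_sign_adjacent)
  then show ?thesis
    using True edge_form_swap[OF assms]
    by (auto simp: edge_weight_def graded_sign_def)
next
  case False
  then show ?thesis by (simp add: edge_weight_def edge_form_parity)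
qed

text \<open>The list orders and orients the edges whose dart pairs form \<open>P\<close>.
  Distinctness of the flat list makes the members of \<open>P\<close> disjoint two-element
  sets.\<close>

definition realizes :: "('d \<times> 'd) list \<Rightarrow> 'd set set \<Rightarrow> bool" where
  "realizes Es P \<longleftrightarrow> distinct (flat Es) \<and> (\<lambda>(y, z). {y, z}) ` set Es = P"

lemma set_flat: "set (flat Es) = (\<Union>(y, z)\<in>set Es. {y, z})"
  by (auto simp: flat_def)

lemma distinct_flat_inj:
  assumes "distinct (flat Es)"
  shows "distinct Es" "inj_on (\<lambda>(y, z). {y, z}) (set Es)"
proof -
  show "distinct Es" using assms
    by (induction Es) (auto simp: set_flat)
  show "inj_on (\<lambda>(y, z). {y, z}) (set Es)" using assms
    by (induction Es) (auto simp: set_flat doubleton_eq_iff)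
qed

lemma edge_weight_realizes:
  assumes "realizes Es P" "realizes Es' P" "\<And>d. d \<in> \<Union>P \<Longrightarrow> c d \<in> colors k l"
  shows "edge_weight l c Es = edge_weight l c Es'"
proof -
  \<comment> \<open>Orienting each edge from its smaller to its larger dart gives a normal form; as
    a multiset it is determined by \<open>P\<close> alone.\<close>
  define ori where "ori = (\<lambda>(y, z). (min y z, max y z :: 'a))"
  have ori: "edge_weight l c (as @ Es) = edge_weight l c (as @ map ori Es)"
    if "\<And>d. d \<in> set (flat Es) \<Longrightarrow> c d \<in> colors k l" for as Es
    using that
  proof (induction Es arbitrary: as)
    case (Cons p Es)
    obtain y z where p: "p = (y, z)" by fastforce
    have "edge_weight l c (as @ (y, z) # Es) = edge_weight l c (as @ ori (y, z) # Es)"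
      using edge_weight_flip[of c y k l z as Es] Cons.prems p
      by (auto simp: ori_def min_def max_def)
    then show ?case using Cons.IH[of "as @ [ori p]"] Cons.prems p by simp
  qed simp
  have ori_eq: "mset (map ori Es) = image_mset (\<lambda>P. (Min P, Max P)) (mset_set P)"
    if "realizes Es P" for Es
  proof -
    have "mset (map ori Es) = image_mset (\<lambda>P. (Min P, Max P)) (image_mset (\<lambda>(y, z). {y, z}) (mset_set (set Es)))"
      using distinct_flat_inj(1)[of Es] that
      by (auto simp: realizes_def mset_set_set ori_def multiset.map_comp o_def case_prod_unfold)
    also have "image_mset (\<lambda>(y, z). {y, z}) (mset_set (set Es)) = mset_set P"
      using distinct_flat_inj(2)[of Es] that by (subst image_mset_mset_set) (auto simp: realizes_def)
    finally show ?thesis .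
  qed
  have "edge_weight l c Es = edge_weight l c (map ori Es)" if "realizes Es P" for Es
  proof -
    have "set (flat Es) = \<Union>P" using that by (auto simp: realizes_def set_flat)
    then show ?thesis using ori[of Es "[]"] assms(3) by simp
  qed
  then show ?thesis
    using edge_weight_mset[of "map ori Es" "map ori Es'"] ori_eq assms by metis
qed

text \<open>
  The darts of \<open>Es\<close> are colored; the two darts of an edge, and the two darts of a label in \<open>X\<close>, are
  contracted, \<open>\<Phi>\<close> is the contribution of the vertices, and the sign compares the arrangement of
  the odd darts around vertices and labels with the one along edges. The form in the factor of a
  label is transposed, hence inverse to the one of an edge.
\<close>

definition net_sum :: "nat \<Rightarrow> nat \<Rightarrow> 'd::linorder list \<Rightarrow> ('d \<times> 'd) list \<Rightarrow> ('d \<times> 'd) list \<Rightarrow>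
    (('d \<Rightarrow> color) \<Rightarrow> complex) \<Rightarrow> complex" where
  "net_sum k l W X Es \<Phi> = (\<Sum>c\<in>set (flat Es) \<rightarrow>\<^sub>E colors k l.
     graded_sign c (W @ flat X) * edge_weight l c Es *
     (\<Prod>(d, d')\<leftarrow>X. edge_form l (c d') (c d)) * \<Phi> c)"

section \<open>Contracting the two darts of one label\<close>

lemma graded_sign_delete_pair:
  assumes "mset (as @ bs) = mset (cs @ ds)" "x \<noteq> y" "x \<notin> set (as @ bs)" "y \<notin> set (as @ bs)"
    and "isl (c x) = isl (c y)"
  shows "graded_sign c (as @ [x, y] @ bs) * graded_sign c (cs @ [x, y] @ ds) =
    graded_sign c (as @ bs) * graded_sign c (cs @ ds)"
proof -
  let ?f = "filter (\<lambda>d. \<not> isl (c d))"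
  have "mset (?f as @ ?f bs) = mset (?f cs @ ?f ds)"
    using arg_cong[OF assms(1), of "filter_mset (\<lambda>d. \<not> isl (c d))"] by simp
  then show ?thesis
    using list_sign_delete_pair[of "?f as" "?f bs" "?f cs" "?f ds" x y] assms
    by (auto simp: graded_sign_def)
qed

lemma graded_sign_cong:
  "(\<And>d. d \<in> set ds \<Longrightarrow> c d = c' d) \<Longrightarrow> graded_sign c ds = graded_sign c' ds"
  unfolding graded_sign_def by (metis (mono_tags, lifting) filter_cong)

lemma flat_memD: "(y, z) \<in> set Es \<Longrightarrow> y \<in> set (flat Es) \<and> z \<in> set (flat Es)"
  by (auto simp: set_flat)

lemma prod_list_pairs_cong:
  "(\<And>y z. (y, z) \<in> set Es \<Longrightarrow> f y z = g y z) \<Longrightarrow>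
   (\<Prod>(y, z)\<leftarrow>Es. f y z) = (\<Prod>(y, z)\<leftarrow>Es. g y z)"
  by (intro arg_cong[where f = prod_list] map_cong refl) auto

lemma sum_mult_left2:
  "(\<Sum>a\<in>A. \<Sum>b\<in>B. (s::complex) * f a b) = s * (\<Sum>a\<in>A. \<Sum>b\<in>B. f a b)"
  by (simp add: sum_distrib_left)

lemma net_sum_realizes:
  assumes "realizes Es P" "realizes Es' P"
  shows "net_sum k l W X Es \<Phi> = net_sum k l W X Es' \<Phi>"
proof -
  have "set (flat Es) = \<Union>P" "set (flat Es') = \<Union>P"
    using assms by (auto simp: realizes_def set_flat)
  moreover have "edge_weight l c Es = edge_weight l c Es'" if "c \<in> \<Union>P \<rightarrow>\<^sub>E colors k l" for c
    using edge_weight_realizes[OF assms, of c k l] that by (auto simp: PiE_mem)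
  ultimately show ?thesis unfolding net_sum_def by (intro sum.cong) auto
qed

text \<open>In the edge arrangement y, d, d', z the label darts d and d' are neighbours, as they are
  in the label arrangement, so both can be deleted without a sign. Summing over their colors is then
  \<open>edge_form_contract\<close>.\<close>

lemma net_sum_join:
  assumes dist: "distinct (y # d # d' # z # flat Es)"
    and W: "mset (W @ flat X) = mset (y # z # flat Es)"
    and \<Phi>: "\<And>c a b. \<Phi> (c(d := a, d' := b)) = \<Phi> c"
  shows "net_sum k l W ((d, d') # X) ((y, d) # (d', z) # Es) \<Phi> = net_sum k l W X ((y, z) # Es) \<Phi>"
proof -
  let ?C = "colors k l"
  let ?D = "set (flat ((y, z) # Es))"
  let ?t = "\<lambda>c. graded_sign c (W @ flat ((d, d') # X)) * edge_weight l c ((y, d) # (d', z) # Es) *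
     (\<Prod>(d, d')\<leftarrow>(d, d') # X. edge_form l (c d') (c d)) * \<Phi> c"
  have D: "set (flat ((y, d) # (d', z) # Es)) = insert d' (insert d ?D)" by auto
  have "net_sum k l W ((d, d') # X) ((y, d) # (d', z) # Es) \<Phi> =
     (\<Sum>c\<in>?D \<rightarrow>\<^sub>E ?C. \<Sum>a\<in>?C. \<Sum>b\<in>?C. ?t (c(d := a, d' := b)))"
    unfolding net_sum_def D by (rule sum_PiE_insert2) (use dist in auto)
  also have "\<dots> = (\<Sum>c\<in>?D \<rightarrow>\<^sub>E ?C. graded_sign c (W @ flat X) * edge_weight l c ((y, z) # Es) *
     (\<Prod>(d, d')\<leftarrow>X. edge_form l (c d') (c d)) * \<Phi> c)"
  proof (intro sum.cong refl)
    fix c assume c: "c \<in> ?D \<rightarrow>\<^sub>E ?C"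
    have inX: "set (flat X) \<subseteq> ?D" "set W \<subseteq> ?D"
      using mset_eq_setD[OF W] by auto
    then have dX: "d \<notin> set (flat X)" "d' \<notin> set (flat X)" "d \<notin> set W" "d' \<notin> set W"
      using dist by auto
    \<comment> \<open>The part of the term that does not depend on the colors a and b of the label
      darts.\<close>
    define rest where "rest = graded_sign c (W @ flat X) * graded_sign c (y # z # flat Es) *
      (\<Prod>(y, z)\<leftarrow>Es. edge_form l (c y) (c z)) * (\<Prod>(d, d')\<leftarrow>X. edge_form l (c d') (c d)) * \<Phi> c"
    have "?t (c(d := a, d' := b)) = rest * (edge_form l (c y) a * edge_form l b (c z) * edge_form l b a)"
      for a b
    proof -
      let ?c = "c(d := a, d' := b)"
      have vals: "?c y = c y" "?c z = c z" "?c d = a" "?c d' = b"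
        using dist by auto
      have prodX: "(\<Prod>(d, d')\<leftarrow>X. edge_form l (?c d') (?c d)) = (\<Prod>(d, d')\<leftarrow>X. edge_form l (c d') (c d))"
        using dX by (intro prod_list_pairs_cong) (auto dest!: flat_memD)
      have prodE: "(\<Prod>(y, z)\<leftarrow>Es. edge_form l (?c y) (?c z)) = (\<Prod>(y, z)\<leftarrow>Es. edge_form l (c y) (c z))"
        using dist by (intro prod_list_pairs_cong) (auto dest!: flat_memD)
      define s where "s = graded_sign ?c (W @ d # d' # flat X) * graded_sign ?c (y # d # d' # z # flat Es)"
      have t: "?t ?c = s * (edge_form l (c y) a * edge_form l b (c z) * edge_form l b a) *
        ((\<Prod>(y, z)\<leftarrow>Es. edge_form l (c y) (c z)) * (\<Prod>(d, d')\<leftarrow>X. edge_form l (c d') (c d)) * \<Phi> c)"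
        unfolding s_def edge_weight_def flat_simps list.map prod_list.Cons prod.case prodX prodE \<Phi> vals
        by (simp only: mult_ac)
      show ?thesis
      proof (cases "isl a = isl b")
        case False
        then show ?thesis unfolding t by (simp add: edge_form_parity)
      next
        case True
        \<comment> \<open>With equal parities, d and d' are both kept or both dropped when the odd
          darts are selected, so they can be deleted as a pair. For different parities the form at
          the label is 0.\<close>
        have "graded_sign ?c (W @ [d, d'] @ flat X) * graded_sign ?c ([y] @ [d, d'] @ z # flat Es) =
           graded_sign ?c (W @ flat X) * graded_sign ?c ([y] @ z # flat Es)"
          by (rule graded_sign_delete_pair) (use W dist dX True in auto)
        also have "\<dots> = graded_sign c (W @ flat X) * graded_sign c ([y] @ z # flat Es)"
          using dX dist by (intro arg_cong2[where f = "(*)"] graded_sign_cong) auto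
        finally have "s = graded_sign c (W @ flat X) * graded_sign c (y # z # flat Es)"
          by (simp add: s_def)
        then show ?thesis unfolding t rest_def by (simp only: mult_ac)
      qed
    qed
    then have "(\<Sum>a\<in>?C. \<Sum>b\<in>?C. ?t (c(d := a, d' := b))) = rest * edge_form l (c y) (c z)"
      using edge_form_contract[of "c y" k l "c z"] c
      by (simp only: sum_mult_left2) (auto simp: PiE_mem)
    then show "(\<Sum>a\<in>?C. \<Sum>b\<in>?C. ?t (c(d := a, d' := b))) =
      graded_sign c (W @ flat X) * edge_weight l c ((y, z) # Es) *
        (\<Prod>(d, d')\<leftarrow>X. edge_form l (c d') (c d)) * \<Phi> c"
      by (simp add: rest_def edge_weight_def algebra_simps)
  qed
  finally show ?thesis by (simp add: net_sum_def)
qed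

text \<open>The closing edge is listed as d', d, so its form has the same arguments as the form of
  the label and the two multiply to a square. Bringing it into the order d, d' of the label costs -1
  on odd colors, which turns the trace into the superdimension.\<close>

lemma net_sum_loop:
  assumes dist: "distinct (d # d' # flat Es)"
    and W: "mset (W @ flat X) = mset (flat Es)"
    and \<Phi>: "\<And>c a b. \<Phi> (c(d := a, d' := b)) = \<Phi> c"
  shows "net_sum k l W ((d, d') # X) ((d', d) # Es) \<Phi> =
    (of_nat k - 2 * of_nat l) * net_sum k l W X Es \<Phi>"
proof -
  let ?C = "colors k l"
  let ?D = "set (flat Es)"
  let ?t = "\<lambda>c. graded_sign c (W @ flat ((d, d') # X)) * edge_weight l c ((d', d) # Es) *
     (\<Prod>(d, d')\<leftarrow>(d, d') # X. edge_form l (c d') (c d)) * \<Phi> c"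
  let ?r = "\<lambda>c. graded_sign c (W @ flat X) * edge_weight l c Es *
     (\<Prod>(d, d')\<leftarrow>X. edge_form l (c d') (c d)) * \<Phi> c"
  have D: "set (flat ((d', d) # Es)) = insert d' (insert d ?D)" by auto
  have "net_sum k l W ((d, d') # X) ((d', d) # Es) \<Phi> =
     (\<Sum>c\<in>?D \<rightarrow>\<^sub>E ?C. \<Sum>a\<in>?C. \<Sum>b\<in>?C. ?t (c(d := a, d' := b)))"
    unfolding net_sum_def D by (rule sum_PiE_insert2) (use dist in auto)
  also have "\<dots> = (\<Sum>c\<in>?D \<rightarrow>\<^sub>E ?C. (of_nat k - 2 * of_nat l) * ?r c)"
  proof (intro sum.cong refl)
    fix c assume c: "c \<in> ?D \<rightarrow>\<^sub>E ?C"
    have inX: "set (flat X) \<subseteq> ?D" "set W \<subseteq> ?D"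
      using mset_eq_setD[OF W] by auto
    then have dX: "d \<notin> set (flat X)" "d' \<notin> set (flat X)" "d \<notin> set W" "d' \<notin> set W"
      using dist by auto
    have "?t (c(d := a, d' := b)) =
      ?r c * ((if isl a then 1 else -1) * (edge_form l b a * edge_form l b a))" for a b
    proof -
      let ?c = "c(d := a, d' := b)"
      have vals: "?c d = a" "?c d' = b"
        using dist by auto
      have prodX: "(\<Prod>(d, d')\<leftarrow>X. edge_form l (?c d') (?c d)) = (\<Prod>(d, d')\<leftarrow>X. edge_form l (c d') (c d))"
        using dX by (intro prod_list_pairs_cong) (auto dest!: flat_memD)
      have prodE: "(\<Prod>(y, z)\<leftarrow>Es. edge_form l (?c y) (?c z)) = (\<Prod>(y, z)\<leftarrow>Es. edge_form l (c y) (c z))"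
        using dist by (intro prod_list_pairs_cong) (auto dest!: flat_memD)
      define s where "s = graded_sign ?c (W @ d # d' # flat X) * graded_sign ?c (d' # d # flat Es)"
      have t: "?t ?c = s * (edge_form l b a * edge_form l b a) *
        ((\<Prod>(y, z)\<leftarrow>Es. edge_form l (c y) (c z)) * (\<Prod>(d, d')\<leftarrow>X. edge_form l (c d') (c d)) * \<Phi> c)"
        unfolding s_def edge_weight_def flat_simps list.map prod_list.Cons prod.case prodX prodE \<Phi> vals
        by (simp only: mult_ac)
      show ?thesis
      proof (cases "isl a = isl b")
        case False
        then show ?thesis unfolding t by (simp add: edge_form_parity)
      next
        case True
        have flip: "graded_sign ?c ([] @ [d', d] @ flat Es) =
          (if isl a then 1 else -1) * graded_sign ?c ([] @ [d, d'] @ flat Es)"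
        proof (cases "isl a")
          case False
          then show ?thesis using True dist
            list_sign_adjacent[of "[]" d' d "filter (\<lambda>x. \<not> isl (?c x)) (flat Es)"]
            by (simp add: graded_sign_def del: list_sign.simps)
        qed (use True dist in \<open>simp add: graded_sign_def\<close>)
        have "graded_sign ?c (W @ [d, d'] @ flat X) * graded_sign ?c ([] @ [d, d'] @ flat Es) =
           graded_sign ?c (W @ flat X) * graded_sign ?c ([] @ flat Es)"
          by (rule graded_sign_delete_pair) (use W dist dX True in auto)
        moreover have "graded_sign ?c (W @ flat X) * graded_sign ?c ([] @ flat Es) =
          graded_sign c (W @ flat X) * graded_sign c ([] @ flat Es)"
          using dX dist by (intro arg_cong2[where f = "(*)"] graded_sign_cong) auto
        ultimately have del: "graded_sign ?c (W @ [d, d'] @ flat X) * graded_sign ?c ([] @ [d, d'] @ flat Es) =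
          graded_sign c (W @ flat X) * graded_sign c ([] @ flat Es)"
          by (rule trans)
        have "s = (if isl a then 1 else -1) *
          (graded_sign ?c (W @ [d, d'] @ flat X) * graded_sign ?c ([] @ [d, d'] @ flat Es))"
          using flip unfolding s_def append_Nil append_Cons by (simp only: mult_ac)
        then have "s = (if isl a then 1 else -1) * (graded_sign c (W @ flat X) * graded_sign c (flat Es))"
          unfolding del by simp
        then show ?thesis unfolding t unfolding edge_weight_def by (simp only: mult_ac)
      qed
    qed
    then show "(\<Sum>a\<in>?C. \<Sum>b\<in>?C. ?t (c(d := a, d' := b))) = (of_nat k - 2 * of_nat l) * ?r c"
      by (simp only: sum_mult_left2 edge_form_superdimension) (simp only: mult_ac)
  qed
  finally show ?thesis by (simp add: net_sum_def sum_distrib_left)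
qed

section \<open>Cutting a network at its labels\<close>

lemma list_sign_flat_zip:
  assumes "length us = length vs"
  shows "list_sign (as @ flat (zip us vs) @ bs) =
    (-1) ^ (length us choose 2) * list_sign (as @ us @ vs @ bs)"
  using assms
proof (induction us vs arbitrary: as rule: list_induct2)
  case (Cons u us v vs)
  have "list_sign (as @ flat (zip (u # us) (v # vs)) @ bs) =
    (-1) ^ (length us choose 2) * list_sign ((as @ [u]) @ [v] @ us @ (vs @ bs))"
    using Cons.IH[of "as @ [u, v]"] by (simp del: list_sign.simps)
  \<comment> \<open>The first entry of the second list passes all later entries of the first list;
    over the induction this adds up to 0 + 1 + ... + (n - 1), the binomial coefficient.\<close>
  also have "list_sign ((as @ [u]) @ [v] @ us @ (vs @ bs)) =
    (-1) ^ length us * list_sign ((as @ [u]) @ us @ [v] @ (vs @ bs))"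
    by (subst list_sign_blocks_swap) simp
  finally show ?case by (simp add: numeral_2_eq_2 power_add del: list_sign.simps)
qed (simp add: numeral_2_eq_2)

lemma filter_flat_zip:
  assumes "length us = length vs" "map P us = map P vs"
  shows "filter P (flat (zip us vs)) = flat (zip (filter P us) (filter P vs))"
  using assms by (induction us vs rule: list_induct2) auto

lemma filter_length_map_cong:
  assumes "map P us = map P vs"
  shows "length (filter P us) = length (filter P vs)"
  using map_eq_imp_length_eq[OF assms] assms by (induction us vs rule: list_induct2) auto

lemma sum_PiE_Un:
  assumes "D1 \<inter> D2 = {}"
  shows "(\<Sum>c\<in>D1 \<union> D2 \<rightarrow>\<^sub>E C. F c) =
    (\<Sum>c1\<in>D1 \<rightarrow>\<^sub>E C. \<Sum>c2\<in>D2 \<rightarrow>\<^sub>E C. F (\<lambda>d. if d \<in> D1 then c1 d else c2 d))"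
  unfolding sum.cartesian_product
  by (rule sum.reindex_bij_witness[where
        i = "\<lambda>(c1, c2) d. if d \<in> D1 then c1 d else c2 d" and
        j = "\<lambda>c. (restrict c D1, restrict c D2)"])
     (use assms in \<open>auto simp: PiE_def Pi_def extensional_def fun_eq_iff restrict_def
        intro!: arg_cong[where f = F] split: if_splits\<close>)

text \<open>As a function of \<open>\<chi>\<close> this is the tensor of an open network with free
  legs \<open>ds\<close>.\<close>

definition half_sum :: "nat \<Rightarrow> nat \<Rightarrow> 'd::linorder list \<Rightarrow> 'd list \<Rightarrow> ('d \<times> 'd) list \<Rightarrow>
    (('d \<Rightarrow> color) \<Rightarrow> complex) \<Rightarrow> color list \<Rightarrow> complex" where
  "half_sum k l W ds Es \<Phi> \<chi> = (\<Sum>c\<in>set (flat Es) \<rightarrow>\<^sub>E colors k l.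
     if map c ds = \<chi> then graded_sign c (W @ ds) * edge_weight l c Es * \<Phi> c else 0)"

text \<open>The sign separates the interleaved odd labels of the two sides.\<close>

definition pairing_coeff :: "nat \<Rightarrow> color list \<Rightarrow> color list \<Rightarrow> complex" where
  "pairing_coeff l \<chi> \<chi>' = (-1) ^ (length (filter (\<lambda>a. \<not> isl a) \<chi>) choose 2) *
     (\<Prod>(a, b)\<leftarrow>zip \<chi> \<chi>'. edge_form l b a)"

lemma pairing_coeff_parity:
  assumes "length \<chi> = length \<chi>'" "pairing_coeff l \<chi> \<chi>' \<noteq> 0"
  shows "map isl \<chi> = map isl \<chi>'"
proof -
  have "(\<Prod>(a, b)\<leftarrow>zip \<chi> \<chi>'. edge_form l b a) \<noteq> 0"
    using assms by (auto simp: pairing_coeff_def)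
  with assms(1) show ?thesis
    by (induction \<chi> \<chi>' rule: list_induct2) (auto, (metis edge_form_parity)+)
qed

text \<open>Unzipping the labels costs the binomial sign. The block \<open>W2\<close> then moves
  past \<open>ds\<close> for free, since an even number of its darts are odd. The cross sign between
  the two sides occurs in this arrangement and in the one along edges, and squares to 1.\<close>

lemma graded_sign_cut:
  assumes "length ds = length ds'" "map (\<lambda>d. isl (c d)) ds = map (\<lambda>d. isl (c d)) ds'"
    and W: "mset (W1 @ ds) = mset D1" "mset (W2 @ ds') = mset D2"
    and disj: "set D1 \<inter> set D2 = {}"
    and ev: "even (length (filter (\<lambda>d. \<not> isl (c d)) W2))"
  shows "graded_sign c (W1 @ W2 @ flat (zip ds ds')) * graded_sign c (D1 @ D2) =
    (-1) ^ (length (filter (\<lambda>d. \<not> isl (c d)) ds) choose 2) *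
    (graded_sign c (W1 @ ds) * graded_sign c D1) * (graded_sign c (W2 @ ds') * graded_sign c D2)"
proof -
  define f where "f = filter (\<lambda>d. \<not> isl (c d))"
  have par: "map (\<lambda>d. \<not> isl (c d)) ds = map (\<lambda>d. \<not> isl (c d)) ds'"
    using assms(2) by (metis (mono_tags, lifting) map_eq_conv map_map comp_def)
  have "f (flat (zip ds ds')) = flat (zip (f ds) (f ds'))"
    unfolding f_def by (rule filter_flat_zip[OF assms(1) par])
  moreover have len: "length (f ds) = length (f ds')"
    unfolding f_def by (rule filter_length_map_cong[OF par])
  ultimately have "graded_sign c (W1 @ W2 @ flat (zip ds ds')) =
    list_sign ((f W1 @ f W2) @ flat (zip (f ds) (f ds')) @ [])"
    by (simp add: graded_sign_def f_def)
  also have "\<dots> = (-1) ^ (length (f ds) choose 2) * list_sign (f W1 @ f W2 @ f ds @ f ds')"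
    by (subst list_sign_flat_zip[OF len]) simp
  also have "list_sign (f W1 @ f W2 @ f ds @ f ds') = list_sign (f W1 @ f ds @ f W2 @ f ds')"
    using ev by (subst list_sign_blocks_swap) (simp add: f_def)
  also have "\<dots> = list_sign (f (W1 @ ds)) * list_sign (f (W2 @ ds')) *
      cross_sign (f (W1 @ ds)) (f (W2 @ ds'))"
    using list_sign_append[of "f W1 @ f ds" "f W2 @ f ds'"] by (simp add: f_def)
  also have "cross_sign (f (W1 @ ds)) (f (W2 @ ds')) = cross_sign (f D1) (f D2)"
    using W by (intro cross_sign_mset) (simp_all only: f_def mset_filter)
  finally have 1: "graded_sign c (W1 @ W2 @ flat (zip ds ds')) = (-1) ^ (length (f ds) choose 2) *
     (list_sign (f (W1 @ ds)) * list_sign (f (W2 @ ds')) * cross_sign (f D1) (f D2))" .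
  have 2: "graded_sign c (D1 @ D2) = list_sign (f D1) * list_sign (f D2) * cross_sign (f D1) (f D2)"
    by (simp add: graded_sign_def f_def list_sign_append)
  have "cross_sign (f D1) (f D2) = 1 \<or> cross_sign (f D1) (f D2) = -1"
    using disj by (intro cross_sign_cases) (auto simp: f_def)
  then show ?thesis
    unfolding 1 2 by (auto simp: graded_sign_def f_def)
qed

text \<open>A coloring of the whole is a pair of colorings of the two sides; once the signs are
  separated, the sides meet only in the coefficient of their label colors. That coefficient is
  grouped with the second side, so the outer sum runs over the label colorings of one side
  only.\<close>

lemma net_sum_cut:
  assumes len: "length ds = length ds'"
    and W: "mset (W1 @ ds) = mset (flat Es1)" "mset (W2 @ ds') = mset (flat Es2)"
    and disj: "set (flat Es1) \<inter> set (flat Es2) = {}"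
    and \<Phi>1: "\<And>c c'. (\<And>d. d \<in> set W1 \<Longrightarrow> c d = c' d) \<Longrightarrow> \<Phi>1 c = \<Phi>1 c'"
    and \<Phi>2: "\<And>c c'. (\<And>d. d \<in> set W2 \<Longrightarrow> c d = c' d) \<Longrightarrow> \<Phi>2 c = \<Phi>2 c'"
    and ev: "\<And>c. \<Phi>2 c \<noteq> 0 \<Longrightarrow> even (length (filter (\<lambda>d. \<not> isl (c d)) W2))"
  shows "net_sum k l (W1 @ W2) (zip ds ds') (Es1 @ Es2) (\<lambda>c. \<Phi>1 c * \<Phi>2 c) =
    (\<Sum>\<chi> | set \<chi> \<subseteq> colors k l \<and> length \<chi> = length ds. half_sum k l W1 ds Es1 \<Phi>1 \<chi> *
       (\<Sum>\<chi>' | set \<chi>' \<subseteq> colors k l \<and> length \<chi>' = length ds.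
          pairing_coeff l \<chi> \<chi>' * half_sum k l W2 ds' Es2 \<Phi>2 \<chi>'))"
    (is "_ = (\<Sum>\<chi>\<in>?X. _)")
proof -
  let ?C = "colors k l"
  let ?D1 = "set (flat Es1)" and ?D2 = "set (flat Es2)"
  define A where "A c = graded_sign c (W1 @ ds) * edge_weight l c Es1 * \<Phi>1 c" for c
  define B where "B c = graded_sign c (W2 @ ds') * edge_weight l c Es2 * \<Phi>2 c" for c
  have fin: "finite ?X" by (rule finite_lists_length_eq) simp
  have sub1: "set ds \<subseteq> ?D1" "set W1 \<subseteq> ?D1" using mset_eq_setD[OF W(1)] by auto
  have sub2: "set ds' \<subseteq> ?D2" "set W2 \<subseteq> ?D2" using mset_eq_setD[OF W(2)] by auto
  have "net_sum k l (W1 @ W2) (zip ds ds') (Es1 @ Es2) (\<lambda>c. \<Phi>1 c * \<Phi>2 c) =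
    (\<Sum>c1\<in>?D1 \<rightarrow>\<^sub>E ?C. \<Sum>c2\<in>?D2 \<rightarrow>\<^sub>E ?C. A c1 * (pairing_coeff l (map c1 ds) (map c2 ds') * B c2))"
    unfolding net_sum_def flat_simps set_append
  proof (subst sum_PiE_Un[OF disj], intro sum.cong refl)
    fix c1 c2 :: "'a \<Rightarrow> color"
    let ?c = "\<lambda>d. if d \<in> ?D1 then c1 d else c2 d"
    let ?s = "graded_sign ?c (W1 @ W2 @ flat (zip ds ds')) * graded_sign ?c (flat Es1 @ flat Es2)"
    let ?e = "\<lambda>c Es. (\<Prod>(y, z)\<leftarrow>Es. edge_form l (c y) (c z))"
    let ?K = "\<Prod>(d, d')\<leftarrow>zip ds ds'. edge_form l (?c d') (?c d)"
    have c1: "?c d = c1 d" if "d \<in> ?D1" for d using that by simp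
    have c2: "?c d = c2 d" if "d \<in> ?D2" for d using that disj by auto
    have maps: "map ?c ds = map c1 ds" "map ?c ds' = map c2 ds'"
      by (rule map_cong[OF refl], rule c1, use sub1 in blast)
         (rule map_cong[OF refl], rule c2, use sub2 in blast)
    have \<Phi>: "\<Phi>1 ?c = \<Phi>1 c1" "\<Phi>2 ?c = \<Phi>2 c2"
      by (rule \<Phi>1, rule c1, use sub1 in blast) (rule \<Phi>2, rule c2, use sub2 in blast)
    have gs: "graded_sign ?c (W1 @ ds) = graded_sign c1 (W1 @ ds)"
      "graded_sign ?c (W2 @ ds') = graded_sign c2 (W2 @ ds')"
      "graded_sign ?c (flat Es1) = graded_sign c1 (flat Es1)"
      "graded_sign ?c (flat Es2) = graded_sign c2 (flat Es2)"
      by (rule graded_sign_cong, rule c1, use sub1 in auto)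
         (rule graded_sign_cong, rule c2, use sub2 in auto,
          rule graded_sign_cong, rule c1, simp, rule graded_sign_cong, rule c2, simp)
    have es: "?e ?c Es1 = ?e c1 Es1" "?e ?c Es2 = ?e c2 Es2"
      using disj by (intro prod_list_pairs_cong; auto dest!: flat_memD)+
    have K: "?K = (\<Prod>(a, b)\<leftarrow>zip (map c1 ds) (map c2 ds'). edge_form l b a)"
      by (simp add: maps[symmetric] zip_map_map case_prod_unfold o_def del: map_eq_conv)
    have odd: "length (filter (\<lambda>a. \<not> isl a) (map c1 ds)) = length (filter (\<lambda>d. \<not> isl (?c d)) ds)"
      by (simp add: maps(1)[symmetric] filter_map o_def del: map_eq_conv)
    have "?s * (?e ?c Es1 * ?e ?c Es2) * ?K * (\<Phi>1 ?c * \<Phi>2 ?c) =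
      A c1 * (pairing_coeff l (map c1 ds) (map c2 ds') * B c2)"
    \<comment> \<open>Outside the case where both sides are 0, the parities at corresponding labels
      agree and \<open>W2\<close> has an even number of odd darts, as \<open>graded_sign_cut\<close>
      asks.\<close>
    proof (cases "\<Phi>2 c2 = 0 \<or> pairing_coeff l (map c1 ds) (map c2 ds') = 0")
      case True
      then show ?thesis by (auto simp: \<Phi> B_def K pairing_coeff_def)
    next
      case False
      then have "map isl (map c1 ds) = map isl (map c2 ds')"
        using pairing_coeff_parity[of "map c1 ds" "map c2 ds'" l] len by auto
      then have par: "map (\<lambda>d. isl (?c d)) ds = map (\<lambda>d. isl (?c d)) ds'"
        unfolding maps[symmetric] by (simp add: o_def)
      have "even (length (filter (\<lambda>d. \<not> isl (?c d)) W2))"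
        using False \<Phi> by (intro ev) auto
      then have s: "?s = (-1) ^ (length (filter (\<lambda>d. \<not> isl (?c d)) ds) choose 2) *
         (graded_sign c1 (W1 @ ds) * graded_sign c1 (flat Es1)) *
         (graded_sign c2 (W2 @ ds') * graded_sign c2 (flat Es2))"
        using graded_sign_cut[OF len par W disj] gs by simp
      show ?thesis
        unfolding s es K \<Phi> A_def B_def pairing_coeff_def odd edge_weight_def
        by (simp only: mult_ac)
    qed
    then show "graded_sign ?c ((W1 @ W2) @ flat (zip ds ds')) * edge_weight l ?c (Es1 @ Es2) *
         ?K * (\<Phi>1 ?c * \<Phi>2 ?c) = A c1 * (pairing_coeff l (map c1 ds) (map c2 ds') * B c2)"
      unfolding edge_weight_def flat_simps map_append prod_list.append append_assoc
      by (simp only: mult_ac)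
  qed
  also have "\<dots> = (\<Sum>\<chi>\<in>?X. half_sum k l W1 ds Es1 \<Phi>1 \<chi> *
      (\<Sum>\<chi>'\<in>?X. pairing_coeff l \<chi> \<chi>' * half_sum k l W2 ds' Es2 \<Phi>2 \<chi>'))"
  proof -
    have in1: "map c ds \<in> ?X" if "c \<in> ?D1 \<rightarrow>\<^sub>E ?C" for c
      using that sub1 by (auto simp: PiE_mem)
    have in2: "map c ds' \<in> ?X" if "c \<in> ?D2 \<rightarrow>\<^sub>E ?C" for c
      using that sub2 len by (auto simp: PiE_mem)
    have inner: "(\<Sum>\<chi>'\<in>?X. pairing_coeff l \<chi> \<chi>' * half_sum k l W2 ds' Es2 \<Phi>2 \<chi>') =
       (\<Sum>c2\<in>?D2 \<rightarrow>\<^sub>E ?C. pairing_coeff l \<chi> (map c2 ds') * B c2)" for \<chi>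
    proof -
      have "(\<Sum>\<chi>'\<in>?X. pairing_coeff l \<chi> \<chi>' * half_sum k l W2 ds' Es2 \<Phi>2 \<chi>') =
        (\<Sum>c2\<in>?D2 \<rightarrow>\<^sub>E ?C. \<Sum>\<chi>'\<in>?X. if map c2 ds' = \<chi>' then pairing_coeff l \<chi> \<chi>' * B c2 else 0)"
        unfolding half_sum_def B_def[symmetric] sum_distrib_left
        by (subst sum.swap) (intro sum.cong refl, simp)
      also have "\<dots> = (\<Sum>c2\<in>?D2 \<rightarrow>\<^sub>E ?C. pairing_coeff l \<chi> (map c2 ds') * B c2)"
        using in2 fin by (intro sum.cong refl) (subst sum.delta', auto)
      finally show ?thesis .
    qed
    have "(\<Sum>\<chi>\<in>?X. half_sum k l W1 ds Es1 \<Phi>1 \<chi> * G \<chi>) = (\<Sum>c1\<in>?D1 \<rightarrow>\<^sub>E ?C. A c1 * G (map c1 ds))" for G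
    proof -
      have "(\<Sum>\<chi>\<in>?X. half_sum k l W1 ds Es1 \<Phi>1 \<chi> * G \<chi>) =
        (\<Sum>c1\<in>?D1 \<rightarrow>\<^sub>E ?C. \<Sum>\<chi>\<in>?X. if map c1 ds = \<chi> then A c1 * G \<chi> else 0)"
        unfolding half_sum_def A_def[symmetric] sum_distrib_right
        by (subst sum.swap) (intro sum.cong refl, simp)
      also have "\<dots> = (\<Sum>c1\<in>?D1 \<rightarrow>\<^sub>E ?C. A c1 * G (map c1 ds))"
        using in1 fin by (intro sum.cong refl) (subst sum.delta', auto)
      finally show ?thesis .
    qed
    then show ?thesis unfolding inner by (simp only: sum_distrib_left[of "A c" for c])
  qed
  finally show ?thesis .
qed

section \<open>The edge coloring model at a vertex\<close>

lemma prod_sym_gen: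
  "(\<Prod>a\<in>#M. sym_gen (\<psi> a)) =
     Poly_Mapping.single (\<Sum>i\<in>#image_mset \<psi> M. Poly_Mapping.single i 1) 1"
  by (induction M) (auto simp: sym_gen_def mult_single simp flip: single_one)

lemma tensor_single:
  "tensor (Poly_Mapping.single m x) (Poly_Mapping.single A y) = Poly_Mapping.single (m, A) (x * y)"
  by (auto simp: tensor_def)

lemma wedge_single:
  "wedge (Poly_Mapping.single A x) (Poly_Mapping.single B y) =
     Poly_Mapping.single (A \<union> B) (wedge_sign A B * (x * y))"
  by (auto simp: wedge_def)

lemma cross_sign_eq_0: "set xs \<inter> set ys \<noteq> {} \<Longrightarrow> cross_sign xs ys = 0"
proof (induction xs)
  case (Cons x xs)
  have "x \<in> set ys \<Longrightarrow> cross_sign [x] ys = 0"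
    by (induction ys) (auto simp: cross_sign_Cons_simps)
  then show ?case using Cons by (auto simp: cross_sign_Cons(1)[of x xs])
qed auto

lemma cross_sign_singleton:
  "x \<notin> set ys \<Longrightarrow> distinct ys \<Longrightarrow> cross_sign [x] ys = (-1) ^ card {y \<in> set ys. y < x}"
proof (induction ys)
  case (Cons y ys)
  have "{z \<in> set (y # ys). z < x} = (if y < x then insert y {z \<in> set ys. z < x} else {z \<in> set ys. z < x})"
    by auto
  then show ?case using Cons by (auto simp: cross_sign_Cons_simps pair_sign_def)
qed simp

text \<open>For disjoint blocks both signs count the inversions between them; otherwise both are
  0.\<close>

lemma wedge_sign_lists:
  assumes "distinct xs" "distinct ys"
  shows "wedge_sign (set xs) (set ys) = cross_sign xs ys"
proof (cases "set xs \<inter> set ys = {}")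
  case False
  then show ?thesis by (simp add: wedge_sign_def cross_sign_eq_0)
next
  case True
  then have "(-1) ^ card {(a, b). a \<in> set xs \<and> b \<in> set ys \<and> b < a} = cross_sign xs ys"
    using assms(1)
  proof (induction xs)
    case (Cons x xs)
    let ?T = "{(a, b). a \<in> set xs \<and> b \<in> set ys \<and> b < a}"
    have "{(a, b). a \<in> set (x # xs) \<and> b \<in> set ys \<and> b < a} = ?T \<union> Pair x ` {b \<in> set ys. b < x}"
      by auto
    moreover have "finite ?T" by (rule finite_subset[of _ "set xs \<times> set ys"]) auto
    moreover have "?T \<inter> Pair x ` {b \<in> set ys. b < x} = {}" using Cons.prems by auto
    ultimately have "card {(a, b). a \<in> set (x # xs) \<and> b \<in> set ys \<and> b < a} =
      card ?T + card {b \<in> set ys. b < x}"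
      by (simp add: card_Un_disjoint card_image inj_on_def)
    then show ?case
      using Cons cross_sign_singleton[of x ys] assms(2)
      by (simp add: power_add cross_sign_Cons(1)[of x xs])
  qed simp
  then show ?thesis using True by (simp add: wedge_sign_def)
qed

text \<open>The product of the generators listed in \<open>xs\<close>, scaled by \<open>u\<close>.\<close>

definition ext_word :: "complex \<Rightarrow> nat list \<Rightarrow> ext_alg" where
  "ext_word u xs = Poly_Mapping.single (set xs) (u * list_sign xs)"

text \<open>The sign of a concatenation consists of the signs of the parts and their cross sign, and
  the latter is the sign of the wedge product. A repetition makes both sides 0, so products of
  generators can be handled as lists without distinctness hypotheses.\<close>

lemma wedge_ext_word: "wedge (ext_word u xs) (ext_word v ys) = ext_word (u * v) (xs @ ys)"
proof (cases "distinct xs \<and> distinct ys")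
  case True
  then show ?thesis
    by (simp add: ext_word_def wedge_single wedge_sign_lists list_sign_append algebra_simps)
next
  case False
  then show ?thesis
    by (auto simp: ext_word_def wedge_single list_sign_append list_sign_eq_0)
qed

lemma ext_gen_word: "ext_gen i = ext_word 1 [i]"
  by (simp add: ext_gen_def ext_word_def)

lemma dual_gen_word: "dual_gen l i = ext_word (dual_sign l i) [dual_index l i]"
  by (simp add: dual_gen_def ext_gen_def ext_word_def dual_sign_def dual_index_def single_uminus)

lemma list_sign_flat_mset:
  assumes "mset ps = mset qs"
  shows "list_sign (flat ps) = list_sign (flat qs)"
proof (rule adjacent_swaps_invariant[OF _ assms])
  fix as bs :: "('a \<times> 'a) list" and p q :: "'a \<times> 'a"
  obtain y z u v where pq: "p = (y, z)" "q = (u, v)" by fastforce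
  show "list_sign (flat (as @ [p, q] @ bs)) = list_sign (flat (as @ [q, p] @ bs))"
    using list_sign_blocks_swap[of "flat as" "[y, z]" "[u, v]" "flat bs"]
    by (simp add: pq)
qed

text \<open>Every result that \<open>fold_graph\<close> allows is the word of some enumeration of
  the set, and a word made of pairs does not depend on the order of the pairs. This gives the
  uniqueness on which the value of the fold rests.\<close>

lemma wedge_prod_word:
  assumes "distinct as"
  shows "wedge_prod (\<lambda>a. wedge (ext_gen (\<phi> a)) (dual_gen l (\<phi> (q a)))) (set as) =
    ext_word (\<Prod>a\<in>set as. dual_sign l (\<phi> (q a))) (flat (map (\<lambda>a. (\<phi> a, dual_index l (\<phi> (q a)))) as))"
    (is "wedge_prod ?P _ = ext_word _ (?L as)")
proof -
  let ?f = "\<lambda>a. wedge (?P a)"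
  let ?u = "\<lambda>S. \<Prod>a\<in>S. dual_sign l (\<phi> (q a))"
  have P: "?P a = ext_word (dual_sign l (\<phi> (q a))) [\<phi> a, dual_index l (\<phi> (q a))]" for a
    by (simp add: ext_gen_word dual_gen_word wedge_ext_word)
  have graph: "\<exists>as. distinct as \<and> set as = S \<and> y = ext_word (?u S) (?L as)"
    if "fold_graph ?f ext_one S y" for S y
    using that
  proof (induction rule: fold_graph.induct)
    case emptyI
    then show ?case by (intro exI[of _ "[]"]) (simp add: ext_one_def ext_word_def)
  next
    case (insertI x A y)
    then obtain as where as: "distinct as" "set as = A" "y = ext_word (?u A) (?L as)" by blast
    then have "?f x y = ext_word (?u (insert x A)) (?L (x # as))"
      using insertI(1) unfolding P by (auto simp: wedge_ext_word)
    then show ?case using as insertI(1) by (intro exI[of _ "x # as"]) auto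
  qed
  have unique: "y = ext_word (?u (set as)) (?L as)" if "fold_graph ?f ext_one (set as) y" for y
  proof -
    note g = graph[OF that]
    obtain bs where "distinct bs" "set bs = set as" "y = ext_word (?u (set as)) (?L bs)"
      using g by blast
    moreover from this have "mset as = mset bs" using assms by (metis set_eq_iff_mset_eq_distinct)
    then have "list_sign (?L as) = list_sign (?L bs)" "set (?L as) = set (?L bs)"
      by (intro list_sign_flat_mset, simp, metis (no_types) mset_eq_setD mset_map set_flat)
    ultimately show ?thesis by (simp add: ext_word_def)
  qed
  obtain y where "fold_graph ?f ext_one (set as) y"
    using finite_imp_fold_graph[of "set as" ?f ext_one] by auto
  then show ?thesis
    unfolding wedge_prod_def Finite_Set.fold_def using unique
    by (auto intro!: the_equality)
qed

section \<open>The model evaluated on the colors around a vertex\<close>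

definition model_coeff :: "(mixed_alg \<Rightarrow> complex) \<Rightarrow> nat multiset \<Rightarrow> nat set \<Rightarrow> complex" where
  "model_coeff h M A = h (Poly_Mapping.single (\<Sum>i\<in>#M. Poly_Mapping.single i 1, A) 1)"

lemma keys_sum_single: "Poly_Mapping.keys (\<Sum>i\<in>#M. Poly_Mapping.single i (1::nat)) \<subseteq> set_mset M"
proof (induction M)
  case (add x M)
  then show ?case
    using Poly_Mapping.keys_add[of "Poly_Mapping.single x (1::nat)" "\<Sum>i\<in>#M. Poly_Mapping.single i 1"]
    by auto
qed simp

text \<open>The argument is a multiple of one basis element, which the bounds on the indices keep in
  \<open>mixed_space\<close>; linearity there extracts the scalar.\<close>

lemma model_on_word:
  assumes h: "edge_coloring_model k l h"
    and "set_mset (image_mset \<psi> M) \<subseteq> {1..k}" "set xs \<subseteq> {1..2 * l}"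
  shows "h (tensor (\<Prod>a\<in>#M. sym_gen (\<psi> a)) (ext_word u xs)) =
    u * list_sign xs * model_coeff h (image_mset \<psi> M) (set xs)"
proof -
  let ?m = "\<Sum>i\<in>#image_mset \<psi> M. Poly_Mapping.single i (1::nat)"
  let ?s = "Poly_Mapping.single (?m, set xs) (1::complex)"
  have "Poly_Mapping.keys ?m \<subseteq> {1..k}"
    using keys_sum_single[of "image_mset \<psi> M"] assms(2) by blast
  then have "?s \<in> mixed_space k l" using assms(3) by (auto simp: mixed_space_def)
  then have "h (Poly_Mapping.map (\<lambda>a. (u * list_sign xs) * a) ?s) = (u * list_sign xs) * h ?s"
    using h unfolding edge_coloring_model_def by blast
  moreover have "Poly_Mapping.map (\<lambda>a. c * a) ?s = Poly_Mapping.single (?m, set xs) c" for c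
    by (rule poly_mapping_eqI) (simp add: Poly_Mapping.map.rep_eq lookup_single when_def)
  ultimately show ?thesis
    by (simp add: prod_sym_gen ext_word_def tensor_single model_coeff_def del: image_mset.comp)
qed

definition odd_colors :: "color list \<Rightarrow> nat list" where
  "odd_colors cs = map projr (filter (\<lambda>a. \<not> isl a) cs)"

definition even_colors :: "color list \<Rightarrow> nat list" where
  "even_colors cs = map projl (filter isl cs)"

text \<open>Pairs of generators never produce an odd number of odd colors. The default 0 for that
  case removes, from a sum over all dart colorings, those with an odd number of odd darts at some
  vertex.\<close>

definition vertex_value :: "(mixed_alg \<Rightarrow> complex) \<Rightarrow> color list \<Rightarrow> complex" where
  "vertex_value h cs = (if even (length (odd_colors cs))
     then list_sign (odd_colors cs) * model_coeff h (mset (even_colors cs)) (set (odd_colors cs)) else 0)"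

text \<open>
  The vertex functional depends on the order of the darts only through the sign that
  \<open>graded_sign\<close> compensates.
\<close>

lemma graded_vertex_mset:
  assumes "mset ds = mset ds'"
  shows "graded_sign c ds * vertex_value h (map c ds) = graded_sign c ds' * vertex_value h (map c ds')"
proof -
  let ?f = "filter (\<lambda>d. \<not> isl (c d))"
  let ?g = "filter (\<lambda>d. isl (c d))"
  have f: "mset (?f ds) = mset (?f ds')" and g: "mset (?g ds) = mset (?g ds')"
    using assms by simp_all
  have o: "odd_colors (map c ds) = map (\<lambda>d. projr (c d)) (?f ds)" for ds
    by (simp add: odd_colors_def filter_map o_def)
  have e: "even_colors (map c ds) = map (\<lambda>d. projl (c d)) (?g ds)" for ds
    by (simp add: even_colors_def filter_map o_def)
  have evens: "mset (even_colors (map c ds)) = mset (even_colors (map c ds'))"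
    unfolding e mset_map g ..
  have odds: "mset (odd_colors (map c ds)) = mset (odd_colors (map c ds'))"
    unfolding o mset_map f ..
  have sign: "graded_sign c ds * list_sign (odd_colors (map c ds)) =
     graded_sign c ds' * list_sign (odd_colors (map c ds'))"
    unfolding graded_sign_def o by (rule list_sign_map_mset[OF f])
  show ?thesis
    unfolding vertex_value_def evens mset_eq_length[OF odds] mset_eq_setD[OF odds]
    by (simp add: mult.assoc[symmetric] sign)
qed

lemma graded_sign_append:
  "graded_sign c (xs @ ys) = graded_sign c xs * graded_sign c ys *
     cross_sign (filter (\<lambda>d. \<not> isl (c d)) xs) (filter (\<lambda>d. \<not> isl (c d)) ys)"
  by (simp add: graded_sign_def list_sign_append)

text \<open>The cross signs between the blocks of different vertices see only multisets, so the
  reordering can be done at each vertex separately.\<close>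

lemma graded_vertices_cong:
  assumes "\<And>v. v \<in> set vs \<Longrightarrow> mset (L v) = mset (L' v)"
  shows "graded_sign c (concat (map L vs)) * (\<Prod>v\<leftarrow>vs. vertex_value h (map c (L v))) =
    graded_sign c (concat (map L' vs)) * (\<Prod>v\<leftarrow>vs. vertex_value h (map c (L' v)))"
  using assms
proof (induction vs)
  case (Cons v vs)
  let ?f = "filter (\<lambda>d. \<not> isl (c d))"
  have eq: "mset (concat (map L vs)) = mset (concat (map L' vs))"
    using Cons.prems by (induction vs) auto
  have cross: "cross_sign (?f (L v)) (?f (concat (map L vs))) =
      cross_sign (?f (L' v)) (?f (concat (map L' vs)))"
    using eq Cons.prems by (intro cross_sign_mset) simp_all
  have v: "graded_sign c (L v) * vertex_value h (map c (L v)) =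
    graded_sign c (L' v) * vertex_value h (map c (L' v))"
    using Cons.prems by (intro graded_vertex_mset) simp
  have IH: "graded_sign c (concat (map L vs)) * (\<Prod>v\<leftarrow>vs. vertex_value h (map c (L v))) =
    graded_sign c (concat (map L' vs)) * (\<Prod>v\<leftarrow>vs. vertex_value h (map c (L' v)))"
    using Cons by simp
  have "(a * b * x) * (p * q) = (a * p) * (b * q) * x" for a b x p q :: complex
    by (simp only: mult_ac)
  then show ?case
    unfolding list.map concat.simps prod_list.Cons graded_sign_append by (simp only: v IH cross)
qed simp

section \<open>Signs and circuits\<close>

text \<open>Each involution is a perfect matching, and the union of two matchings consists of even
  cycles (a doubled edge counts as one), hence is bipartite. It serves to build Eulerian
  orientations: one involution pairs darts at a vertex, the other the two darts of an edge.\<close>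

lemma involutions_two_coloring:
  assumes "finite X"
    and "\<And>x. x \<in> X \<Longrightarrow> \<sigma> x \<in> X \<and> \<sigma> x \<noteq> x \<and> \<sigma> (\<sigma> x) = x"
    and "\<And>x. x \<in> X \<Longrightarrow> \<tau> x \<in> X \<and> \<tau> x \<noteq> x \<and> \<tau> (\<tau> x) = x"
  shows "\<exists>b :: 'a \<Rightarrow> bool. \<forall>x\<in>X. b (\<sigma> x) \<noteq> b x \<and> b (\<tau> x) \<noteq> b x"
  using assms
proof (induction "card X" arbitrary: X \<sigma> rule: less_induct)
  case less
  show ?case
  proof (cases "X = {}")
    case False
    then obtain x where x: "x \<in> X" by blast
    define y where "y = \<tau> x"
    have y: "y \<in> X" "y \<noteq> x" "\<tau> y = x" using less.prems(3)[OF x] by (auto simp: y_def)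
    let ?X = "X - {x, y}"
    have card: "card ?X < card X" using x less.prems(1) by (intro psubset_card_mono) auto
    have \<tau>: "\<tau> z \<in> ?X \<and> \<tau> z \<noteq> z \<and> \<tau> (\<tau> z) = z" if "z \<in> ?X" for z
      using less.prems(3)[of z] less.prems(3)[OF x] that y by (auto simp: y_def)
    show ?thesis
    proof (cases "\<sigma> x = y")
      case True
      then have \<sigma>y: "\<sigma> y = x" using less.prems(2)[OF x] by auto
      have "\<sigma> z \<in> ?X \<and> \<sigma> z \<noteq> z \<and> \<sigma> (\<sigma> z) = z" if "z \<in> ?X" for z
        using less.prems(2)[of z] less.prems(2)[OF x] that True \<sigma>y by (auto; metis)
      then obtain b :: "'a \<Rightarrow> bool" where b: "\<forall>z\<in>?X. b (\<sigma> z) \<noteq> b z \<and> b (\<tau> z) \<noteq> b z"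
        using less.hyps[OF card, of \<sigma>] less.prems(1) \<tau> by auto
      let ?b = "b(x := True, y := False)"
      have "?b (\<sigma> z) \<noteq> ?b z \<and> ?b (\<tau> z) \<noteq> ?b z" if "z \<in> X" for z
      proof (cases "z \<in> ?X")
        case True
        then show ?thesis
          using b \<tau>[OF True] \<open>\<And>z. z \<in> ?X \<Longrightarrow> \<sigma> z \<in> ?X \<and> \<sigma> z \<noteq> z \<and> \<sigma> (\<sigma> z) = z\<close>[OF True] by auto
      next
        case False
        then show ?thesis using that y True \<sigma>y by (auto simp: y_def)
      qed
      then show ?thesis by blast
    next
      case False
      define x' where "x' = \<sigma> x"
      define y' where "y' = \<sigma> y"
      have x': "x' \<in> ?X" "\<sigma> x' = x" using less.prems(2)[OF x] False by (auto simp: x'_def)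
      have y': "y' \<in> ?X" "\<sigma> y' = y" using less.prems(2)[OF y(1)] False less.prems(2)[OF x]
        by (auto simp: y'_def)
      have ne: "x' \<noteq> y'" using x' y' y by auto
      \<comment> \<open>The path x', x, y, y' is shortened to a direct match of x' and y'. These get
        opposite values, so the values can be alternated along the path when x and y are put
        back.\<close>
      let ?\<sigma> = "\<sigma>(x' := y', y' := x')"
      have \<sigma>': "\<sigma> z \<in> ?X \<and> \<sigma> z \<noteq> x' \<and> \<sigma> z \<noteq> y' \<and> \<sigma> z \<noteq> z \<and> \<sigma> (\<sigma> z) = z"
        if "z \<in> ?X" "z \<noteq> x'" "z \<noteq> y'" for z
        using less.prems(2)[of z] that x' y' by (auto simp: x'_def y'_def)
      have "?\<sigma> z \<in> ?X \<and> ?\<sigma> z \<noteq> z \<and> ?\<sigma> (?\<sigma> z) = z" if "z \<in> ?X" for z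
        using \<sigma>'[OF that] ne x' y' by (cases "z = x'"; cases "z = y'") auto
      then obtain b :: "'a \<Rightarrow> bool" where b: "\<forall>z\<in>?X. b (?\<sigma> z) \<noteq> b z \<and> b (\<tau> z) \<noteq> b z"
        using less.hyps[OF card, of ?\<sigma>] less.prems(1) \<tau> by auto
      have bxy: "b x' \<noteq> b y'" using b x' y' ne by (auto split: if_splits)
      let ?b = "b(x := \<not> b x', y := \<not> b y')"
      have "?b (\<sigma> z) \<noteq> ?b z \<and> ?b (\<tau> z) \<noteq> ?b z" if z: "z \<in> X" for z
      proof -
        consider "z = x" | "z = y" | "z = x'" | "z = y'" | "z \<in> ?X" "z \<noteq> x'" "z \<noteq> y'"
          using z by blast
        then show ?thesis
        proof cases
          case 1
          then show ?thesis using x' y bxy by (auto simp: x'_def[symmetric] y_def[symmetric])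
        next
          case 2
          then show ?thesis using y' y bxy by (auto simp: y'_def[symmetric])
        next
          case 3
          then show ?thesis using x' y b \<tau>[OF x'(1)] by auto
        next
          case 4
          then show ?thesis using y' y b \<tau>[OF y'(1)] by auto
        next
          case 5
          then have "b (?\<sigma> z) \<noteq> b z" "b (\<tau> z) \<noteq> b z" using b by blast+
          then show ?thesis using 5 \<sigma>'[OF 5] \<tau>[OF 5(1)] by auto
        qed
      qed
      then show ?thesis by blast
    qed
  qed simp
qed

section \<open>Orbits of a permutation of a finite set\<close>

lemma orbit_bij_betw:
  assumes "finite S" "bij_betw n S S" "x \<in> S"
  shows "x \<in> orbit n x" "orbit n x \<subseteq> S"
proof -
  let ?m = "\<lambda>x. if x \<in> S then n x else x"
  have "bij_betw ?m S S" using assms(2) by (subst bij_betw_cong[of S ?m n]) auto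
  then have m: "?m permutes S" by (intro bij_imp_permutes) auto
  have "x \<in> orbit ?m x"
    by (rule permutation_self_in_orbit[OF permutes_imp_permutation[OF assms(1) m]])
  moreover have "orbit n x = orbit ?m x"
    using assms(2,3) by (intro orbit_cong0[of x S]) (auto dest: bij_betwE)
  ultimately show "x \<in> orbit n x" by simp
  show "orbit n x \<subseteq> S"
  proof
    fix y assume "y \<in> orbit n x"
    then show "y \<in> S" using assms(2,3) by induction (auto dest: bij_betwE)
  qed
qed

lemma bij_betw_subset_self:
  "inj_on n S \<Longrightarrow> (\<And>x. x \<in> S \<Longrightarrow> n x \<in> S) \<Longrightarrow> finite S \<Longrightarrow> bij_betw n S S"
  by (simp add: bij_betw_def endo_inj_surj image_subset_iff)

lemma orbit_eq:
  assumes "finite S" "bij_betw n S S" "x \<in> S" "y \<in> orbit n x"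
  shows "orbit n y = orbit n x"
proof -
  have "x \<in> orbit n y" using orbit_bij_betw(1)[OF assms(1-3)] assms(4) by (rule orbit_swap)
  then show ?thesis using assms(4) orbit_trans by fast
qed

lemma mset_flat_map:
  "mset (flat (map (\<lambda>a. (f a, g a)) as)) = image_mset f (mset as) + image_mset g (mset as)"
  by (induction as) auto

text \<open>The point \<open>a\<close> is bypassed by sending its predecessor \<open>b\<close> to
  its successor. Since \<open>a\<close> is not fixed, its orbit loses \<open>a\<close> but stays
  nonempty, and the other orbits are unchanged.\<close>

lemma card_orbits_shortcut:
  assumes fin: "finite S" and n: "bij_betw n S S" and a: "a \<in> S" "n a \<noteq> a"
    and b: "b \<in> S" "n b = a"
  shows "card (orbit n ` S) = card (orbit (n(b := n a)) ` (S - {a}))"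
proof -
  define m where "m = n(b := n a)"
  have m: "m b = n a" "\<And>y. y \<noteq> b \<Longrightarrow> m y = n y" by (auto simp: m_def)
  let ?S = "S - {a}"
  have ba: "b \<noteq> a" using a b by auto
  have inj: "y = b" if "n y = a" "y \<in> S" for y
    using n b that by (auto simp: bij_betw_def inj_on_def)
  have orb: "orbit m x = orbit n x - {a}" if x: "x \<in> ?S" for x
  proof (intro equalityI subsetI)
    fix y assume "y \<in> orbit m x"
    then show "y \<in> orbit n x - {a}"
    proof induction
      case base
      have "n a \<in> orbit n b" using orbit.step[OF orbit.base, of n b] b(2) by simp
      moreover have "n x \<noteq> a" if "x \<noteq> b" using inj[of x] x that by blast
      ultimately show ?case using a(2) orbit.base[of n x] by (cases "x = b") (simp_all add: m)
    next
      case (step y)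
      then have "y \<in> S" using orbit_bij_betw(2)[OF fin n, of x] x by auto
      have 1: "n y \<in> orbit n x" "n (n y) \<in> orbit n x"
        using step by (auto intro: orbit.step)
      have 2: "n y \<noteq> a" if "y \<noteq> b" using inj[of y] \<open>y \<in> S\<close> that by blast
      show ?case using 1 2 a(2) b(2) by (cases "y = b") (simp_all add: m)
    qed
  next
    fix y assume y: "y \<in> orbit n x - {a}"
    \<comment> \<open>Induction along the old orbit needs a substitute when it passes the deleted
      point \<open>a\<close>: there the new orbit already contains the successor
      \<open>n a\<close>.\<close>
    have "(y \<noteq> a \<longrightarrow> y \<in> orbit m x) \<and> (y = a \<longrightarrow> n a \<in> orbit m x)" if "y \<in> orbit n x"
      using that
    proof induction
      case base
      have "m x \<in> orbit m x" by (rule orbit.base)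
      moreover have "n x \<noteq> a" if "x \<noteq> b" using inj[of x] x that by blast
      ultimately show ?case using b(2) by (cases "x = b") (simp_all add: m)
    next
      case (step y)
      then have "y \<in> S" using orbit_bij_betw(2)[OF fin n, of x] x by auto
      have in_orbit: "m y \<in> orbit m x" if "y \<noteq> a" using step(2) that by (intro orbit.step) simp
      have ne: "n y \<noteq> a" if "y \<noteq> b" using inj[of y] \<open>y \<in> S\<close> that by blast
      consider "y = a" | "y = b" "y \<noteq> a" | "y \<noteq> a" "y \<noteq> b" by blast
      then show ?case
      proof cases
        case 1
        then show ?thesis using step(2) a(2) in_orbit by (simp add: m)
      next
        case 2
        then show ?thesis using in_orbit b(2) by (simp add: m)
      next
        case 3
        then show ?thesis using in_orbit ne by (simp add: m)
      qed
    qed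
    then show "y \<in> orbit m x" using y by auto
  qed
  have "orbit n a = orbit n b"
    using orbit_eq[OF fin n b(1), of a] orbit.base[of n b] b by auto
  then have "orbit n ` S = orbit n ` ?S" using ba a b by (auto simp: image_iff)
  moreover have "orbit m ` ?S = (\<lambda>Q. Q - {a}) ` (orbit n ` ?S)"
    using orb by (auto simp: image_image intro!: image_cong)
  moreover have "inj_on (\<lambda>Q. Q - {a}) (orbit n ` ?S)"
  proof (intro inj_onI)
    fix P Q assume "P \<in> orbit n ` ?S" "Q \<in> orbit n ` ?S" "P - {a} = Q - {a}"
    then obtain x y where xy: "x \<in> ?S" "P = orbit n x" "y \<in> ?S" "Q = orbit n y" by blast
    then have "x \<in> P - {a}" using orbit_bij_betw(1)[OF fin n, of x] by auto
    then have "x \<in> orbit n y" using \<open>P - {a} = Q - {a}\<close> xy by auto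
    then show "P = Q" using orbit_eq[OF fin n, of y x] xy by auto
  qed
  ultimately show ?thesis by (simp add: card_image m_def)
qed

text \<open>
  The sign \<open>(-1)\<^bsup>c(\<kappa>)\<^esup>\<close> is the relative sign of two arrangements of the ends of the arcs:
  by pairs of the local pairing, and by arcs.
\<close>

lemma list_sign_orbits:
  assumes "bij_betw n (set as) (set as)" "distinct as"
    and "inj_on tail (set as)" "inj_on head (set as)" "tail ` set as \<inter> head ` set as = {}"
  shows "list_sign (flat (map (\<lambda>a. (head a, tail (n a))) as)) *
      list_sign (flat (map (\<lambda>a. (tail a, head a)) as)) = (-1) ^ card (orbit n ` set as)"
  using assms
proof (induction "length as" arbitrary: as n rule: less_induct)
  case less
  note n = less.prems(1) and dist = less.prems(2)
  let ?V = "\<lambda>n as. flat (map (\<lambda>a. (head a, tail (n a))) as)"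
  let ?E = "\<lambda>as. flat (map (\<lambda>a. (tail a, head a)) as)"
  have reorder: "list_sign (?V n as) = list_sign (?V n as')" "list_sign (?E as) = list_sign (?E as')"
    if "mset as = mset as'" for as' using that by (auto intro!: list_sign_flat_mset)
  have mset_eq: "mset (?V n as) = mset (?E as)" if "bij_betw n (set as) (set as)" "distinct as" for n as
  proof -
    have "image_mset n (mset as) = mset as"
      using that by (metis bij_betw_def image_mset_mset_set mset_set_set)
    then have "image_mset (\<lambda>a. tail (n a)) (mset as) = image_mset tail (mset as)"
      by (metis multiset.map_comp comp_def image_mset_cong)
    then show ?thesis by (simp add: mset_flat_map)
  qed
  show ?case
  proof (cases as)
    case Nil
    then show ?thesis by simp
  next
    case (Cons a bs)
    have sub: "inj_on tail (set cs)" "inj_on head (set cs)" "tail ` set cs \<inter> head ` set cs = {}"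
      if "set cs \<subseteq> set as" for cs
      using inj_on_subset[OF less.prems(3) that] inj_on_subset[OF less.prems(4) that]
        less.prems(5) that by blast+
    have notin: "tail x \<notin> set (?E cs)" "head x \<notin> set (?E cs)" "tail x \<noteq> head x"
      if "set cs \<subseteq> set as" "x \<in> set as" "x \<notin> set cs" for cs x
    proof -
      have E: "set (?E cs) = tail ` set cs \<union> head ` set cs" by (auto simp: set_flat)
      have "tail x \<notin> tail ` set cs" "head x \<notin> head ` set cs"
        using inj_on_image_mem_iff[OF less.prems(3) that(2,1)]
          inj_on_image_mem_iff[OF less.prems(4) that(2,1)] that(3) by simp_all
      moreover have "tail x \<notin> head ` set as" "head x \<notin> tail ` set as"
        using less.prems(5) that(2) by blast+
      ultimately show "tail x \<notin> set (?E cs)" "head x \<notin> set (?E cs)" "tail x \<noteq> head x"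
        unfolding E using that(1,2) by blast+
    qed
    show ?thesis
    proof (cases "n a = a")
      case True
      have bs: "bij_betw n (set bs) (set bs)"
      proof (rule bij_betw_subset_self)
        show "inj_on n (set bs)" using n Cons by (auto simp: bij_betw_def)
        fix x assume x: "x \<in> set bs"
        then have "n x \<in> set as" using bij_betwE[OF n] Cons by auto
        moreover have "n x \<noteq> a"
          using inj_onD[OF bij_betw_imp_inj_on[OF n], of x a] x dist Cons True by auto
        ultimately show "n x \<in> set bs" using Cons by simp
      qed simp
      \<comment> \<open>A fixed point is a circuit of one arc. Its two ends form a pair in both
        arrangements but in opposite order; the exchange below gives the factor -1.\<close>
      have "list_sign ([] @ [tail a, head a] @ ?V n bs) * list_sign ([] @ [tail a, head a] @ ?E bs) =
         list_sign ([] @ ?V n bs) * list_sign ([] @ ?E bs)"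
        using mset_eq[OF bs] dist Cons notin[of bs a] mset_eq_setD[OF mset_eq[OF bs]]
        by (intro list_sign_delete_pair) auto
      also have "\<dots> = (-1) ^ card (orbit n ` set bs)"
        using less.hyps[of bs n] bs dist Cons sub[of bs] by auto
      finally have "list_sign (?V n as) * list_sign (?E as) = - ((-1) ^ card (orbit n ` set bs))"
        using list_sign_adjacent[of "[]" "head a" "tail a" "?V n bs"] Cons True
        by (simp del: list_sign.simps)
      moreover have "orbit n ` set as = insert {a} (orbit n ` set bs)"
        using Cons True orbit_eq_singleton_iff[of n a] by auto
      moreover have "{a} \<notin> orbit n ` set bs"
        using orbit_bij_betw(2)[OF _ bs] dist Cons by fastforce
      ultimately show ?thesis by simp
    next
      case False
      have a: "a \<in> set as" using Cons by simp
      then obtain b where b: "b \<in> set as" "n b = a" using n by (metis bij_betw_def imageE)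
      have ba: "b \<noteq> a" using b False by auto
      \<comment> \<open>With b and a in front, the pairs read head b, tail a, head a, tail (n a) and
        the arcs tail b, head b, tail a, head a. Deleting the neighbours tail a, head a from both
        bypasses a in its circuit and keeps the number of circuits.\<close>
      define ds where "ds = remove1 b bs"
      have ds: "mset as = mset (b # a # ds)" "b \<notin> set ds" "a \<notin> set ds" "distinct ds"
        using b dist Cons ba by (auto simp: ds_def)
      then have set: "set as = insert b (insert a (set ds))" by (metis list.set(2) mset_eq_setD)
      let ?n = "n(b := n a)"
      have bij: "bij_betw ?n (set (b # ds)) (set (b # ds))"
      proof -
        have S: "set (b # ds) = set as - {a}" using set ds ba by auto
        have n_ne: "n x \<noteq> a" if "x \<in> set as" "x \<noteq> b" for x
          using inj_onD[OF bij_betw_imp_inj_on[OF n], of x b] that b by auto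
        have n_inj: "x = y" if "n x = n y" "x \<in> set as" "y \<in> set as" for x y
          using inj_onD[OF bij_betw_imp_inj_on[OF n] that] .
        show ?thesis
        proof (rule bij_betw_subset_self)
          show "inj_on ?n (set (b # ds))"
          proof (rule inj_onI)
            fix x y assume "x \<in> set (b # ds)" "y \<in> set (b # ds)" and eq: "?n x = ?n y"
            then have xy: "x \<in> set as" "x \<noteq> a" "y \<in> set as" "y \<noteq> a" using S by auto
            show "x = y"
              using eq xy n_inj[of x y] n_inj[of a y] n_inj[of x a] a
              by (cases "x = b"; cases "y = b") auto
          qed
          fix x assume "x \<in> set (b # ds)"
          then have x: "x \<in> set as" unfolding S by simp
          show "?n x \<in> set (b # ds)"
            using bij_betwE[OF n] a x n_ne[OF x] False unfolding S by auto
        qed simp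
      qed
      have Vds: "?V ?n ds = ?V n ds"
        using ds(2) by (intro arg_cong[where f = flat] map_cong) auto
      have "mset ([head b] @ (tail (n a) # ?V n ds)) = mset ([tail b, head b] @ ?E ds)"
        using mset_eq[OF bij] ds Vds by simp
      moreover have "a \<notin> set (b # ds)" "set (b # ds) \<subseteq> set as" using ds ba set by auto
      note nt = notin[OF this(2) a this(1)]
      moreover have "set (head b # tail (n a) # ?V n ds) = set (?E (b # ds))"
        using mset_eq_setD[OF mset_eq[OF bij]] ds Vds by simp
      ultimately have "list_sign ([head b] @ [tail a, head a] @ (tail (n a) # ?V n ds)) *
          list_sign ([tail b, head b] @ [tail a, head a] @ ?E ds) =
        list_sign ([head b] @ (tail (n a) # ?V n ds)) * list_sign ([tail b, head b] @ ?E ds)"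
        using ds by (intro list_sign_delete_pair) auto
      also have "\<dots> = list_sign (?V ?n (b # ds)) * list_sign (?E (b # ds))"
        using Vds by simp
      also have "\<dots> = (-1) ^ card (orbit ?n ` set (b # ds))"
      proof (rule less.hyps[OF _ bij])
        show "length (b # ds) < length as" using mset_eq_length[OF ds(1)] by simp
        show "distinct (b # ds)" using ds by simp
      qed (rule sub, use set in fastforce)+
      also have "card (orbit ?n ` set (b # ds)) = card (orbit n ` set as)"
        using card_orbits_shortcut[OF _ n a False b] set ds ba by (simp add: insert_Diff_if)
      finally show ?thesis using reorder[OF ds(1)] b by simp
    qed
  qed
qed

section \<open>Graphs with darts\<close>

lemma even_card_involution:
  assumes "finite A" "even (card A)"
  shows "\<exists>\<sigma>. \<forall>x\<in>A. \<sigma> x \<in> A \<and> \<sigma> x \<noteq> x \<and> \<sigma> (\<sigma> x) = x"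
  using assms
proof (induction "card A" arbitrary: A rule: less_induct)
  case less
  show ?case
  proof (cases "A = {}")
    case False
    then obtain x where x: "x \<in> A" by blast
    have "A \<noteq> {x}" using less.prems by auto
    then obtain y where y: "y \<in> A" "y \<noteq> x" using x by blast
    let ?B = "A - {x, y}"
    have "card ?B = card A - 2" using x y less.prems(1) by (subst card_Diff_subset) auto
    moreover have "card A \<ge> 2" using less.prems x y by (metis card_0_eq dvd_imp_le empty_iff gr0I)
    ultimately have "card ?B < card A" "even (card ?B)" using less.prems(2) by auto
    then obtain \<sigma> where \<sigma>: "\<forall>z\<in>?B. \<sigma> z \<in> ?B \<and> \<sigma> z \<noteq> z \<and> \<sigma> (\<sigma> z) = z"
      using less.hyps[of ?B] less.prems(1) by auto
    let ?\<sigma> = "\<sigma>(x := y, y := x)"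
    have "?\<sigma> z \<in> A \<and> ?\<sigma> z \<noteq> z \<and> ?\<sigma> (?\<sigma> z) = z" if "z \<in> A" for z
    proof (cases "z \<in> ?B")
      case True
      then have "\<sigma> z \<in> ?B" "\<sigma> z \<noteq> z" "\<sigma> (\<sigma> z) = z" using \<sigma> by blast+
      then show ?thesis using True by auto
    next
      case False
      then show ?thesis using that x y by auto
    qed
    then show ?thesis by blast
  qed simp
qed

lemma sum_PiE_irrelevant:
  assumes "A \<inter> B = {}" "finite A" "finite B" "finite C"
    and "\<And>f f'. (\<And>x. x \<in> A \<Longrightarrow> f x = f' x) \<Longrightarrow> g f = g f'"
  shows "(\<Sum>f\<in>A \<union> B \<rightarrow>\<^sub>E C. g f) = of_nat (card C) ^ card B * (\<Sum>f\<in>A \<rightarrow>\<^sub>E C. g f :: complex)"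
proof -
  have "(\<Sum>f\<in>A \<union> B \<rightarrow>\<^sub>E C. g f) = (\<Sum>f1\<in>A \<rightarrow>\<^sub>E C. \<Sum>f2\<in>B \<rightarrow>\<^sub>E C. g f1)"
    unfolding sum_PiE_Un[OF assms(1)] by (intro sum.cong refl assms(5)) auto
  then show ?thesis
    using assms(3) by (simp add: card_PiE sum_distrib_left)
qed

text \<open>With darts in place of incidences, the two ends of a loop can be colored and ordered
  separately, and a circle has none. The darts of an edge are a parameter, so that in a glued graph
  they can be the surviving ends of a class of edges.\<close>

locale dart_graph =
  fixes G :: "('v, 'e) mgraph" and darts :: "'e \<Rightarrow> 'd::linorder set" and pos :: "'d \<Rightarrow> 'v"
    and vs :: "'v list" and L :: "'v \<Rightarrow> 'd list"
  assumes fin_edges: "finite (edges G)"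
    and darts_card: "\<And>e. e \<in> edges G \<Longrightarrow> darts e = {} \<or> card (darts e) = 2"
    and darts_disj: "\<And>e e'. e \<in> edges G \<Longrightarrow> e' \<in> edges G \<Longrightarrow> e \<noteq> e' \<Longrightarrow> darts e \<inter> darts e' = {}"
    and ends_darts: "\<And>e. e \<in> edges G \<Longrightarrow> ends G e = image_mset pos (mset_set (darts e))"
    and pos_verts: "\<And>e d. e \<in> edges G \<Longrightarrow> d \<in> darts e \<Longrightarrow> pos d \<in> verts G"
    and vs: "distinct vs" "set vs = verts G"
    and L: "\<And>v. v \<in> verts G \<Longrightarrow> distinct (L v)"
      "\<And>v. v \<in> verts G \<Longrightarrow> set (L v) = {d \<in> \<Union> (darts ` edges G). pos d = v}"
begin

definition D where "D = \<Union> (darts ` edges G)"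
definition proper where "proper = {e \<in> edges G. darts e \<noteq> {}}"
definition circles where "circles = {e \<in> edges G. darts e = {}}"
definition edge_of where "edge_of d = (THE e. e \<in> edges G \<and> d \<in> darts e)"

lemma fin_darts: "e \<in> edges G \<Longrightarrow> finite (darts e)"
  using darts_card[of e] by (auto intro: card_ge_0_finite)

lemma fin_D: "finite D"
  using fin_edges fin_darts by (auto simp: D_def)

lemma edges_split: "edges G = proper \<union> circles" "proper \<inter> circles = {}"
  by (auto simp: proper_def circles_def)

lemma fin_sets: "finite proper" "finite circles" "finite (verts G)"
  using fin_edges vs by (auto simp: proper_def circles_def simp flip: vs(2))

lemma edge_of_eq: "e \<in> edges G \<Longrightarrow> d \<in> darts e \<Longrightarrow> edge_of d = e"
  unfolding edge_of_def using darts_disj by (intro the_equality) blast+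

lemma edge_of_D: "d \<in> D \<Longrightarrow> edge_of d \<in> proper \<and> d \<in> darts (edge_of d)"
  using edge_of_eq by (fastforce simp: D_def proper_def)

lemma in_D: "e \<in> edges G \<Longrightarrow> d \<in> darts e \<Longrightarrow> d \<in> D"
  by (auto simp: D_def)

lemma ends_empty: "e \<in> edges G \<Longrightarrow> ends G e = {#} \<longleftrightarrow> e \<in> circles"
  using ends_darts[of e] fin_darts[of e] by (auto simp: circles_def mset_set_empty_iff)

lemma incident_edges_darts:
  assumes "F \<subseteq> edges G"
  shows "incident_edges G F v = image_mset edge_of (mset_set {d \<in> D. pos d = v \<and> edge_of d \<in> F})"
proof -
  have "finite F" using assms fin_edges finite_subset by blast
  then show ?thesis using assms
  proof (induction F rule: finite_induct)
    case empty
    then show ?case by (simp add: incident_edges_def)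
  next
    case (insert e F)
    let ?d = "{d \<in> darts e. pos d = v}"
    have e: "e \<in> edges G" using insert by simp
    have "count (ends G e) v = card ?d"
      using fin_darts[OF e] by (simp add: ends_darts[OF e] count_image_mset Int_def vimage_def conj_commute)
    moreover have "image_mset edge_of (mset_set ?d) = replicate_mset (card ?d) e"
    proof -
      have "image_mset edge_of (mset_set ?d) = image_mset (\<lambda>_. e) (mset_set ?d)"
        using edge_of_eq[OF e] fin_darts[OF e] by (intro image_mset_cong) auto
      then show ?thesis by (simp add: image_mset_const_eq)
    qed
    moreover have "{d \<in> D. pos d = v \<and> edge_of d \<in> insert e F} = ?d \<union> {d \<in> D. pos d = v \<and> edge_of d \<in> F}"
      using edge_of_eq[OF e] in_D[OF e] edge_of_D by auto
    moreover have "?d \<inter> {d \<in> D. pos d = v \<and> edge_of d \<in> F} = {}"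
      using edge_of_eq[OF e] insert by auto
    ultimately show ?case
      using insert fin_darts[OF e] fin_D
      by (simp add: incident_edges_def mset_set_Union)
  qed
qed

lemma degree_in_darts:
  "F \<subseteq> edges G \<Longrightarrow> degree_in G F v = card {d \<in> D. pos d = v \<and> edge_of d \<in> F}"
  by (simp add: degree_in_def incident_edges_darts)

lemma eulerian_darts:
  "F \<subseteq> edges G \<Longrightarrow> eulerian G F \<longleftrightarrow>
     (\<forall>v\<in>verts G. even (card {d \<in> D. pos d = v \<and> edge_of d \<in> F}))"
  by (simp add: eulerian_def degree_in_darts)

text \<open>Existence gives the choice in \<open>eulerian_weight\<close> a witness. The darts of
  \<open>F\<close> are matched at each vertex by \<open>\<sigma>\<close> and along each edge by
  \<open>\<tau>\<close>; a 2-coloring that alternates along both marks the heads.\<close>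

lemma eulerian_orientation_exists:
  assumes "eulerian G F"
  shows "\<exists>w p. eulerian_orientation G F w \<and> compatible_pairing G F w p"
proof -
  have F: "F \<subseteq> edges G" using assms by (simp add: eulerian_def)
  let ?X = "{d \<in> D. edge_of d \<in> F}"
  let ?Xv = "\<lambda>v. {d \<in> D. pos d = v \<and> edge_of d \<in> F}"
  have "\<forall>v\<in>verts G. \<exists>\<sigma>. \<forall>x\<in>?Xv v. \<sigma> x \<in> ?Xv v \<and> \<sigma> x \<noteq> x \<and> \<sigma> (\<sigma> x) = x"
    using assms fin_D by (intro ballI even_card_involution) (auto simp: eulerian_darts[OF F])
  from bchoice[OF this] obtain \<sigma>0 where \<sigma>0: "\<forall>v\<in>verts G. \<forall>x\<in>?Xv v. \<sigma>0 v x \<in> ?Xv v \<and> \<sigma>0 v x \<noteq> x \<and> \<sigma>0 v (\<sigma>0 v x) = x"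
    by blast
  define \<sigma> where "\<sigma> x = \<sigma>0 (pos x) x" for x
  have pos_D: "pos x \<in> verts G" if "x \<in> D" for x
    using that pos_verts by (auto simp: D_def)
  have \<sigma>: "\<sigma> x \<in> ?X \<and> \<sigma> x \<noteq> x \<and> \<sigma> (\<sigma> x) = x" and \<sigma>_pos: "pos (\<sigma> x) = pos x" if x: "x \<in> ?X" for x
  proof -
    have "x \<in> ?Xv (pos x)" using x by simp
    then have "\<sigma>0 (pos x) x \<in> ?Xv (pos x) \<and> \<sigma>0 (pos x) x \<noteq> x \<and> \<sigma>0 (pos x) (\<sigma>0 (pos x) x) = x"
      using \<sigma>0 pos_D x by blast
    then show "\<sigma> x \<in> ?X \<and> \<sigma> x \<noteq> x \<and> \<sigma> (\<sigma> x) = x" "pos (\<sigma> x) = pos x"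
      by (auto simp: \<sigma>_def)
  qed
  have "\<forall>e\<in>proper. \<exists>y z. darts e = {y, z} \<and> y \<noteq> z"
    using darts_card by (auto simp: proper_def card_2_iff)
  then obtain y0 z0 where yz: "\<forall>e\<in>proper. darts e = {y0 e, z0 e} \<and> y0 e \<noteq> z0 e" by metis
  define \<tau> where "\<tau> d = (if d = y0 (edge_of d) then z0 (edge_of d) else y0 (edge_of d))" for d
  have \<tau>: "\<tau> x \<in> ?X \<and> \<tau> x \<noteq> x \<and> \<tau> (\<tau> x) = x" and \<tau>_edge: "edge_of (\<tau> x) = edge_of x"
    and \<tau>_darts: "darts (edge_of x) = {x, \<tau> x}" if x: "x \<in> ?X" for x
  proof -
    define e where "e = edge_of x"
    have e: "e \<in> proper" "x \<in> darts e" "e \<in> F" using edge_of_D x by (auto simp: e_def)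
    then have e': "e \<in> edges G" by (simp add: proper_def)
    define y z where "y = y0 e" and "z = z0 e"
    have d: "darts e = {y, z}" "y \<noteq> z" using yz e by (auto simp: y_def z_def)
    have eo: "edge_of y = e" "edge_of z = e" using edge_of_eq[OF e'] d by auto
    have D: "y \<in> D" "z \<in> D" using in_D[OF e'] d by auto
    have \<tau>_yz: "\<tau> y = z" "\<tau> z = y"
      using d(2) unfolding \<tau>_def eo by (auto simp: y_def z_def)
    have "x = y \<or> x = z" using e d by auto
    then show "\<tau> x \<in> ?X \<and> \<tau> x \<noteq> x \<and> \<tau> (\<tau> x) = x" "edge_of (\<tau> x) = edge_of x"
      "darts (edge_of x) = {x, \<tau> x}"
      unfolding e_def[symmetric] using e d D eo \<tau>_yz by auto
  qed
  obtain b where b: "\<forall>x\<in>?X. b (\<sigma> x) \<noteq> b x \<and> b (\<tau> x) \<noteq> (b x :: bool)"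
    using involutions_two_coloring[of ?X \<sigma> \<tau>] \<sigma> \<tau> fin_D by auto
  define head where "head e = (SOME d. d \<in> darts e \<and> b d)" for e
  define w where "w e = (pos (\<tau> (head e)), pos (head e))" for e
  define p where "p v a = edge_of (\<sigma> (head a))" for v :: 'v and a
  let ?F = "F \<inter> proper"
  have head: "head e \<in> ?X \<and> b (head e) \<and> edge_of (head e) = e \<and> darts e = {\<tau> (head e), head e}"
    and head_unique: "d \<in> darts e \<Longrightarrow> b d \<Longrightarrow> d = head e" if e: "e \<in> ?F" for e d
  proof -
    obtain x where x: "x \<in> darts e" using e by (auto simp: proper_def)
    have e': "e \<in> edges G" using e by (simp add: proper_def)
    have X: "x \<in> ?X" "edge_of x = e" using in_D[OF e' x] edge_of_eq[OF e' x] e by auto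
    have "\<exists>d. d \<in> darts e \<and> b d"
      using \<tau>_darts[OF X(1)] b X x by (cases "b x") auto
    then have h: "head e \<in> darts e" "b (head e)" unfolding head_def by (metis (mono_tags, lifting) someI_ex)+
    then have h': "head e \<in> ?X" "edge_of (head e) = e"
      using in_D[OF e'] edge_of_eq[OF e'] e by auto
    show "head e \<in> ?X \<and> b (head e) \<and> edge_of (head e) = e \<and> darts e = {\<tau> (head e), head e}"
      using h h' \<tau>_darts[OF h'(1)] by auto
    show "d = head e" if "d \<in> darts e" "b d"
      using that h h' \<tau>_darts[OF h'(1)] b by auto
  qed
  have Fends: "e \<in> ?F" if "e \<in> F" "ends G e \<noteq> {#}" for e
    using that F ends_empty[of e] edges_split(1) by blast
  have Fends': "ends G e \<noteq> {#}" if "e \<in> ?F" for e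
    using that F ends_empty[of e] edges_split(2) by blast
  have in_arcs: "in_arcs G F w v = {e \<in> ?F. pos (head e) = v}"
    and out_arcs: "out_arcs G F w v = {e \<in> ?F. pos (\<tau> (head e)) = v}" for v
    using Fends Fends' by (auto simp: in_arcs_def out_arcs_def w_def)
  \<comment> \<open>An arc continues with the edge whose dart is matched to its head; that dart is a
    tail at the same vertex. The inverse starts from the tail of an outgoing arc and finds a
    head.\<close>
  have bij: "bij_betw (p v) (in_arcs G F w v) (out_arcs G F w v)" for v
  proof (rule bij_betw_byWitness[where f' = "\<lambda>a. edge_of (\<sigma> (\<tau> (head a)))"])
    have fwd: "head (p v a) = \<tau> (\<sigma> (head a)) \<and> p v a \<in> ?F" if "a \<in> ?F" for a
    proof -
      have x: "\<sigma> (head a) \<in> ?X" "\<not> b (\<sigma> (head a))" using head[OF that] \<sigma> b by auto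
      have "p v a \<in> ?F" using x edge_of_D by (auto simp: p_def)
      moreover have "\<tau> (\<sigma> (head a)) \<in> darts (p v a)" "b (\<tau> (\<sigma> (head a)))"
        using \<tau>_darts[OF x(1)] b x by (auto simp: p_def)
      ultimately show ?thesis using head_unique by metis
    qed
    have bwd: "head (edge_of (\<sigma> (\<tau> (head a)))) = \<sigma> (\<tau> (head a)) \<and> edge_of (\<sigma> (\<tau> (head a))) \<in> ?F"
      if "a \<in> ?F" for a
    proof -
      have y: "\<tau> (head a) \<in> ?X" "\<not> b (\<tau> (head a))" using head[OF that] \<tau> b by auto
      then have x: "\<sigma> (\<tau> (head a)) \<in> ?X" "b (\<sigma> (\<tau> (head a)))" using \<sigma> b by auto
      have "edge_of (\<sigma> (\<tau> (head a))) \<in> ?F" using x edge_of_D by auto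
      moreover have "\<sigma> (\<tau> (head a)) \<in> darts (edge_of (\<sigma> (\<tau> (head a))))"
        using edge_of_D x by auto
      ultimately show ?thesis using head_unique x by metis
    qed
    show "\<forall>a\<in>in_arcs G F w v. edge_of (\<sigma> (\<tau> (head (p v a)))) = a"
      using fwd head \<sigma> \<tau> unfolding in_arcs by auto
    show "\<forall>a\<in>out_arcs G F w v. p v (edge_of (\<sigma> (\<tau> (head a)))) = a"
      using bwd head \<sigma> \<tau> \<tau>_edge unfolding out_arcs p_def by auto
    show "p v ` in_arcs G F w v \<subseteq> out_arcs G F w v"
      using fwd head \<sigma> \<tau> \<sigma>_pos unfolding in_arcs out_arcs by auto
    show "(\<lambda>a. edge_of (\<sigma> (\<tau> (head a)))) ` out_arcs G F w v \<subseteq> in_arcs G F w v"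
      using bwd head \<sigma> \<tau> \<sigma>_pos unfolding in_arcs out_arcs by auto
  qed
  have "ends G e = {#fst (w e), snd (w e)#}" if "e \<in> F" "ends G e \<noteq> {#}" for e
  proof -
    have e: "e \<in> ?F" using Fends that .
    have "darts e = {\<tau> (head e), head e}" "\<tau> (head e) \<noteq> head e"
      using head[OF e] \<tau>[of "head e"] by blast+
    then have "mset_set (darts e) = {#\<tau> (head e), head e#}" by simp
    then show ?thesis using ends_darts[of e] e F by (auto simp: w_def)
  qed
  then have "eulerian_orientation G F w"
    using bij_betw_same_card[OF bij] by (simp add: eulerian_orientation_def)
  then show ?thesis using bij by (auto simp: compatible_pairing_def)
qed

end

section \<open>Trading orientation and pairing for a coloring of the darts\<close>

lemma concat_map_flat:
  assumes "\<And>x. x \<in> set xs \<Longrightarrow> filter P (M x) = flat (map g (ins x))"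
  shows "filter P (concat (map M xs)) = flat (map g (concat (map ins xs)))"
  using assms by (induction xs) auto

lemma odd_colors_simps [simp]:
  "odd_colors [] = []" "odd_colors (Inl i # cs) = odd_colors cs" "odd_colors (Inr j # cs) = j # odd_colors cs"
  "odd_colors (cs @ cs') = odd_colors cs @ odd_colors cs'"
  by (auto simp: odd_colors_def)

lemma even_colors_simps [simp]:
  "even_colors [] = []" "even_colors (Inl i # cs) = i # even_colors cs" "even_colors (Inr j # cs) = even_colors cs"
  "even_colors (cs @ cs') = even_colors cs @ even_colors cs'"
  by (auto simp: even_colors_def)

lemma prod_list_distinct_set:
  "distinct xs \<Longrightarrow> (\<Prod>x\<leftarrow>xs. f x) = (\<Prod>x\<in>set xs. f x :: complex)"
  by (simp add: prod.distinct_set_conv_list)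

context dart_graph
begin

text \<open>An orientation \<open>w\<close> names vertices and cannot tell the two darts of a loop
  apart; \<open>ta\<close> and \<open>he\<close> fix such a choice. On edges outside
  \<open>F\<close> either order of the darts is allowed.\<close>

definition circuit_ends where
  "circuit_ends F w ta he \<longleftrightarrow> (\<forall>e\<in>proper. darts e = {ta e, he e} \<and> ta e \<noteq> he e \<and>
     (e \<in> F \<longrightarrow> pos (ta e) = fst (w e) \<and> pos (he e) = snd (w e)))"

lemma circuit_ends_exist:
  assumes F: "F \<subseteq> edges G" and w: "eulerian_orientation G F w"
  shows "\<exists>ta he. circuit_ends F w ta he"
proof -
  let ?Q = "\<lambda>e q. darts e = {fst q, snd q} \<and> fst q \<noteq> snd q \<and>
     (e \<in> F \<longrightarrow> pos (fst q) = fst (w e) \<and> pos (snd q) = snd (w e))"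
  have "\<exists>q. ?Q e q" if e: "e \<in> proper" for e
  proof -
    have e': "e \<in> edges G" using e by (simp add: proper_def)
    obtain y z where yz: "darts e = {y, z}" "y \<noteq> z"
      using darts_card[OF e'] e by (auto simp: proper_def card_2_iff)
    then have "ends G e = {#pos y, pos z#}" using ends_darts[OF e'] by simp
    moreover have "e \<in> F \<Longrightarrow> ends G e = {#fst (w e), snd (w e)#}"
      using w ends_empty[OF e'] e edges_split(2) by (auto simp: eulerian_orientation_def)
    ultimately have "e \<in> F \<Longrightarrow> (pos y = fst (w e) \<and> pos z = snd (w e)) \<or> (pos z = fst (w e) \<and> pos y = snd (w e))"
      by (auto simp: add_eq_conv_ex)
    then consider "e \<in> F \<longrightarrow> pos y = fst (w e) \<and> pos z = snd (w e)" | "e \<in> F \<longrightarrow> pos z = fst (w e) \<and> pos y = snd (w e)"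
      by blast
    then show ?thesis
    proof cases
      case 1
      then show ?thesis using yz by (intro exI[of _ "(y, z)"]) auto
    next
      case 2
      then show ?thesis using yz by (intro exI[of _ "(z, y)"]) auto
    qed
  qed
  then have "\<forall>e\<in>proper. \<exists>q. ?Q e q" by blast
  from bchoice[OF this] obtain q where "\<forall>e\<in>proper. ?Q e (q e)" by blast
  then show ?thesis unfolding circuit_ends_def
    by (intro exI[of _ "\<lambda>e. fst (q e)"] exI[of _ "\<lambda>e. snd (q e)"])
qed

lemma circuit_endsD:
  assumes "circuit_ends F w ta he" "e \<in> proper"
  shows "darts e = {ta e, he e}" "ta e \<noteq> he e" "ta e \<in> D" "he e \<in> D"
    "edge_of (ta e) = e" "edge_of (he e) = e"
proof -
  show e: "darts e = {ta e, he e}" "ta e \<noteq> he e"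
    using assms by (auto simp: circuit_ends_def)
  have "e \<in> edges G" using assms(2) by (simp add: proper_def)
  then show "ta e \<in> D" "he e \<in> D" "edge_of (ta e) = e" "edge_of (he e) = e"
    using in_D edge_of_eq e by auto
qed

text \<open>A pair of arcs contributes f with the color of the incoming arc and g with the color of
  the outgoing one. So the head of an arc carries its color, and the tail the dual color, the index
  of the generator that g equals up to sign.\<close>

definition dart_coloring ::
    "nat \<Rightarrow> 'e set \<Rightarrow> ('e \<Rightarrow> 'd) \<Rightarrow> ('e \<Rightarrow> nat) \<Rightarrow> ('e \<Rightarrow> nat) \<Rightarrow> 'd \<Rightarrow> color" where
  "dart_coloring l F he \<phi> \<psi> d = (if d \<in> D then
     (if edge_of d \<in> F then Inr (if d = he (edge_of d) then \<phi> (edge_of d) else dual_index l (\<phi> (edge_of d)))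
      else Inl (\<psi> (edge_of d))) else undefined)"

definition word where "word = concat (map L vs)"
definition vertex_prod where "vertex_prod h c = (\<Prod>v\<leftarrow>vs. vertex_value h (map c (L v)))"

lemma mset_L: "v \<in> verts G \<Longrightarrow> mset (L v) = mset_set {d \<in> D. pos d = v}"
  using L[of v] by (metis D_def mset_set_set)

text \<open>The darts are rearranged around each vertex by the pairs of the pairing, and the edges
  of \<open>F\<close> are listed tail first. The two arrangements then differ by the sign of
  \<open>list_sign_orbits\<close>, and the signs of the g's at the vertices become the values of the
  form along the edges.\<close>

lemma oriented_term:
  assumes h: "edge_coloring_model k l h" and F: "F \<subseteq> edges G"
    and w: "eulerian_orientation G F w" and p: "compatible_pairing G F w p"
    and th: "circuit_ends F w ta he"
    and \<phi>: "\<And>e. e \<in> F \<Longrightarrow> \<phi> e \<in> {1..2 * l}" and \<psi>: "\<And>e. e \<in> edges G - F \<Longrightarrow> \<psi> e \<in> {1..k}"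
    and Es: "realizes Es (darts ` proper)"
  defines "c \<equiv> dart_coloring l F he \<phi> \<psi>"
  shows "(-1) ^ card (orbit (next_arc G w p) ` (F \<inter> proper)) * (\<Prod>v\<in>verts G.
        h (tensor
             (\<Prod>a\<in>#incident_edges G (edges G - F) v. sym_gen (\<psi> a))
             (wedge_prod (\<lambda>a. wedge (ext_gen (\<phi> a)) (dual_gen l (\<phi> (p v a))))
                (in_arcs G F w v)))) =
    graded_sign c word * edge_weight l c Es * vertex_prod h c"
proof -
  let ?F = "F \<inter> proper"
  define n where "n = next_arc G w p"
  let ?HT = "\<lambda>xs. flat (map (\<lambda>a. (he a, ta (n a))) xs)"
  let ?TH = "\<lambda>xs. flat (map (\<lambda>a. (ta a, he a)) xs)"
  let ?\<phi>\<phi> = "\<lambda>a. (\<phi> a, dual_index l (\<phi> (n a)))"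
  let ?wp = "\<lambda>v. wedge_prod (\<lambda>a. wedge (ext_gen (\<phi> a)) (dual_gen l (\<phi> (p v a)))) (in_arcs G F w v)"
  let ?ds = "\<lambda>v. \<Prod>a\<in>in_arcs G F w v. dual_sign l (\<phi> (n a))"
  have finF: "finite ?F" using fin_sets by blast
  note ends_th = circuit_endsD(1,2)[OF th] and th_D = circuit_endsD(3-6)[OF th]
  have pos_th: "pos (ta e) = fst (w e)" "pos (he e) = snd (w e)" if "e \<in> ?F" for e
    using th that by (auto simp: circuit_ends_def)
  have proper_edges: "e \<in> edges G" if "e \<in> proper" for e using that by (simp add: proper_def)
  have inj: "inj_on ta proper" "inj_on he proper"
    using th_D by (metis inj_onI)+
  have disj: "ta ` proper \<inter> he ` proper = {}"
    using th_D ends_th(2) by (auto, metis)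
  have nonempty: "e \<in> F \<Longrightarrow> ends G e \<noteq> {#} \<longleftrightarrow> e \<in> proper" for e
    using F ends_empty[of e] edges_split by blast
  have ins: "in_arcs G F w v = {e \<in> ?F. pos (he e) = v}"
    and outs: "out_arcs G F w v = {e \<in> ?F. pos (ta e) = v}" for v
    using nonempty pos_th by (auto simp: in_arcs_def out_arcs_def)
  have fin_arcs: "finite (in_arcs G F w v)" "finite (out_arcs G F w v)" for v
    unfolding ins outs by (rule finite_subset[OF _ finF], blast)+
  have pos_V: "pos d \<in> verts G" if "d \<in> D" for d using that pos_verts by (auto simp: D_def)
  have n_eq: "n a = p (pos (he a)) a" if "a \<in> ?F" for a
    using nonempty[of a] that pos_th[OF that] by (auto simp: n_def next_arc_def)
  have bij_p: "bij_betw (p v) (in_arcs G F w v) (out_arcs G F w v)" if "v \<in> verts G" for v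
    using p that by (simp add: compatible_pairing_def)
  have n_out: "n a \<in> ?F \<and> pos (ta (n a)) = pos (he a)" if "a \<in> ?F" for a
  proof -
    have "a \<in> in_arcs G F w (pos (he a))" using that by (simp add: ins)
    moreover have "pos (he a) \<in> verts G" using pos_V th_D that by blast
    ultimately have "n a \<in> out_arcs G F w (pos (he a))"
      using bij_betwE[OF bij_p] n_eq[OF that] by simp
    then show ?thesis by (simp add: outs)
  qed
  have bij_n: "bij_betw n ?F ?F"
  proof (rule bij_betw_subset_self)
    show "inj_on n ?F"
    proof (rule inj_onI)
      fix a b assume ab: "a \<in> ?F" "b \<in> ?F" "n a = n b"
      then have eq: "pos (he a) = pos (he b)" using n_out by metis
      have v: "pos (he b) \<in> verts G" using pos_V th_D ab by blast
      show "a = b"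
        using inj_onD[OF bij_betw_imp_inj_on[OF bij_p[OF v]], of a b] ab eq n_eq
        by (auto simp: ins)
    qed
  qed (use n_out finF in auto)
  have "\<forall>v. \<exists>xs. set xs = in_arcs G F w v \<and> distinct xs"
    using fin_arcs by (intro allI finite_distinct_list)
  from choice[OF this] obtain il where il: "\<And>v. set (il v) = in_arcs G F w v" "\<And>v. distinct (il v)"
    by blast
  have il_mset: "mset (il v) = mset_set (in_arcs G F w v)" for v
    using il by (metis mset_set_set)
  \<comment> \<open>The arcs of \<open>F\<close> grouped by the vertex they enter; the same list
    serves both arrangements.\<close>
  define asl where "asl = concat (map il vs)"
  have set_asl: "set asl = ?F"
    using il(1) vs(2) pos_V th_D by (auto simp: asl_def ins)
  have dist_asl: "distinct asl"
  proof -
    have "distinct (concat (map il xs))" if "distinct xs" for xs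
      using that by (induction xs) (auto simp: il ins)
    then show ?thesis using vs(1) by (simp add: asl_def)
  qed
  have c_he: "c (he e) = Inr (\<phi> e)" and c_ta: "c (ta e) = Inr (dual_index l (\<phi> e))" if "e \<in> ?F" for e
    using that th_D[of e] ends_th(2)[of e] by (auto simp: c_def dart_coloring_def)
  have c_even: "c d = Inl (\<psi> (edge_of d))" if "d \<in> D" "edge_of d \<notin> F" for d
    using that by (simp add: c_def dart_coloring_def)
  define evl where "evl v = filter (\<lambda>d. edge_of d \<notin> F) (L v)" for v
  \<comment> \<open>First the pairs of the pairing, then the even darts, whose place has no effect
    on the sign.\<close>
  define L' where "L' v = ?HT (il v) @ evl v" for v
  have evl_D: "d \<in> D" "edge_of d \<notin> F" if "d \<in> set (evl v)" "v \<in> verts G" for d v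
    using that L(2)[of v] by (auto simp: evl_def D_def)
  have mset_L': "mset (L v) = mset (L' v)" if v: "v \<in> verts G" for v
  proof -
    let ?Lv = "{d \<in> D. pos d = v}"
    have "image_mset he (mset (il v)) = mset_set (he ` in_arcs G F w v)"
      unfolding il_mset using inj(2) by (intro image_mset_mset_set) (auto simp: ins intro: inj_on_subset)
    moreover have "image_mset (\<lambda>a. ta (n a)) (mset (il v)) = mset_set (ta ` out_arcs G F w v)"
    proof -
      have "image_mset (\<lambda>a. ta (n a)) (mset (il v)) = image_mset ta (image_mset (p v) (mset_set (in_arcs G F w v)))"
        unfolding il_mset[symmetric] multiset.map_comp using n_eq
        by (intro image_mset_cong) (auto simp: il ins)
      also have "image_mset (p v) (mset_set (in_arcs G F w v)) = mset_set (out_arcs G F w v)"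
        using bij_p[OF v] by (simp add: bij_betw_def image_mset_mset_set)
      also have "image_mset ta (mset_set (out_arcs G F w v)) = mset_set (ta ` out_arcs G F w v)"
        using inj(1) by (intro image_mset_mset_set) (auto simp: outs intro: inj_on_subset)
      finally show ?thesis .
    qed
    moreover have "mset (evl v) = mset_set {d \<in> ?Lv. edge_of d \<notin> F}"
      using mset_L[OF v] fin_D by (simp add: evl_def filter_mset_mset_set)
    ultimately have "mset (L' v) = mset_set (he ` in_arcs G F w v) + mset_set (ta ` out_arcs G F w v) +
       mset_set {d \<in> ?Lv. edge_of d \<notin> F}"
      by (simp add: L'_def mset_flat_map)
    also have "\<dots> = mset_set (he ` in_arcs G F w v \<union> ta ` out_arcs G F w v \<union> {d \<in> ?Lv. edge_of d \<notin> F})"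
    proof -
      have "he ` in_arcs G F w v \<inter> ta ` out_arcs G F w v = {}"
        using disj by (auto simp: ins outs)
      moreover have "(he ` in_arcs G F w v \<union> ta ` out_arcs G F w v) \<inter> {d \<in> ?Lv. edge_of d \<notin> F} = {}"
        using th_D by (auto simp: ins outs)
      ultimately show ?thesis using fin_D fin_arcs by (simp add: mset_set_Union)
    qed
    also have "he ` in_arcs G F w v \<union> ta ` out_arcs G F w v \<union> {d \<in> ?Lv. edge_of d \<notin> F} = ?Lv"
    proof (intro equalityI subsetI)
      fix d assume "d \<in> ?Lv"
      then have d: "d \<in> D" "pos d = v" by auto
      then have e: "edge_of d \<in> proper" "d \<in> darts (edge_of d)" using edge_of_D by blast+
      then have "d = ta (edge_of d) \<or> d = he (edge_of d)" using ends_th(1) by blast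
      then show "d \<in> he ` in_arcs G F w v \<union> ta ` out_arcs G F w v \<union> {d \<in> ?Lv. edge_of d \<notin> F}"
        using d e by (cases "edge_of d \<in> F") (auto simp: ins outs)
    next
      fix d assume "d \<in> he ` in_arcs G F w v \<union> ta ` out_arcs G F w v \<union> {d \<in> ?Lv. edge_of d \<notin> F}"
      then show "d \<in> ?Lv" using th_D by (auto simp: ins outs)
    qed
    finally show ?thesis using mset_L[OF v] by simp
  qed
  have oddf: "filter (\<lambda>d. \<not> isl (c d)) (L' v) = ?HT (il v)"
    if v: "v \<in> verts G" for v
  proof -
    have "filter (\<lambda>d. \<not> isl (c d)) (evl v) = []"
      using evl_D[OF _ v] c_even by (auto simp: filter_empty_conv)
    moreover have "filter (\<lambda>d. \<not> isl (c d)) (?HT xs) =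
       ?HT xs" if "set xs \<subseteq> ?F" for xs
      using that c_he c_ta n_out by (induction xs) auto
    moreover have "set (il v) \<subseteq> ?F" using il(1) ins by auto
    ultimately show ?thesis by (simp add: L'_def)
  qed
  have gs: "graded_sign c (concat (map L' vs)) = list_sign (?HT asl)"
    unfolding graded_sign_def asl_def
    by (subst concat_map_flat[of vs _ L' "\<lambda>a. (he a, ta (n a))" il]) (use oddf vs(2) in auto)
  obtain bsl where bsl: "set bsl = proper - F" "distinct bsl"
    using finite_distinct_list[of "proper - F"] fin_sets by auto
  define Es0 where "Es0 = map (\<lambda>a. (ta a, he a)) (asl @ bsl)"
  have Es0: "realizes Es0 (darts ` proper)"
  proof -
    have "distinct (?TH xs)" if "distinct xs" "set xs \<subseteq> proper" for xs
      using that
    proof (induction xs)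
      case (Cons x xs)
      then have "ta x \<notin> ta ` set xs" "he x \<notin> he ` set xs"
        using inj_on_image_mem_iff[OF inj(1), of x "set xs"] inj_on_image_mem_iff[OF inj(2), of x "set xs"]
        by auto
      moreover have "ta x \<notin> he ` proper" "he x \<notin> ta ` proper" using disj Cons.prems by auto
      ultimately show ?case using Cons by (auto simp: set_flat)
    qed simp
    moreover have "(\<lambda>(y, z). {y, z}) ` set Es0 = darts ` proper"
    proof -
      have "set (asl @ bsl) = proper" using set_asl bsl by auto
      then show ?thesis
        unfolding Es0_def set_map image_image using ends_th(1) by (intro image_cong) auto
    qed
    moreover have "distinct (asl @ bsl)" "set (asl @ bsl) \<subseteq> proper"
      using dist_asl bsl set_asl by auto
    ultimately show ?thesis unfolding realizes_def Es0_def by blast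
  qed
  have "c d \<in> colors k l" if "d \<in> \<Union> (darts ` proper)" for d
  proof -
    have d: "d \<in> D" using that in_D proper_edges by blast
    then have e: "edge_of d \<in> edges G" using edge_of_D proper_edges by blast
    then show ?thesis
      using d \<phi>[of "edge_of d"] \<psi>[of "edge_of d"] dual_index_in[of "\<phi> (edge_of d)" l]
      by (auto simp: c_def dart_coloring_def colors_def)
  qed
  then have "edge_weight l c Es = edge_weight l c Es0"
    by (rule edge_weight_realizes[OF Es Es0])
  also have "edge_weight l c Es0 = list_sign (?TH asl) * (\<Prod>a\<in>?F. dual_sign l (\<phi> a))"
  proof -
    have bs: "c (ta a) = Inl (\<psi> a)" "c (he a) = Inl (\<psi> a)" if "a \<in> set bsl" for a
      using that bsl c_even th_D[of a] by auto
    have "filter (\<lambda>d. \<not> isl (c d)) (?TH xs) = ?TH xs"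
      if "set xs \<subseteq> ?F" for xs
      using that c_he c_ta by (induction xs) auto
    moreover have "filter (\<lambda>d. \<not> isl (c d)) (?TH xs) = []"
      if "set xs \<subseteq> set bsl" for xs
      using that bs by (induction xs) auto
    moreover have "(\<Prod>(y, z)\<leftarrow>map (\<lambda>a. (ta a, he a)) bsl. edge_form l (c y) (c z)) = 1"
    proof -
      have "(\<Prod>(y, z)\<leftarrow>map (\<lambda>a. (ta a, he a)) bsl. edge_form l (c y) (c z)) = (\<Prod>a\<leftarrow>bsl. 1)"
        unfolding map_map using bs by (intro arg_cong[where f = prod_list] map_cong) auto
      then show ?thesis by (simp add: map_replicate_const)
    qed
    moreover have "(\<Prod>(y, z)\<leftarrow>map (\<lambda>a. (ta a, he a)) asl. edge_form l (c y) (c z)) = (\<Prod>a\<in>?F. dual_sign l (\<phi> a))"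
    proof -
      have "(\<Prod>(y, z)\<leftarrow>map (\<lambda>a. (ta a, he a)) asl. edge_form l (c y) (c z)) = (\<Prod>a\<leftarrow>asl. dual_sign l (\<phi> a))"
        unfolding map_map using set_asl c_he c_ta
        by (intro arg_cong[where f = prod_list] map_cong) auto
      then show ?thesis using prod_list_distinct_set[OF dist_asl] set_asl by simp
    qed
    ultimately show ?thesis
      using set_asl by (simp add: edge_weight_def graded_sign_def Es0_def)
  qed
  finally have ew: "edge_weight l c Es = list_sign (?TH asl) *
     (\<Prod>a\<in>?F. dual_sign l (\<phi> a))" .
  have vv: "h (tensor (\<Prod>a\<in>#incident_edges G (edges G - F) v. sym_gen (\<psi> a))
             (?wp v)) =
      (?ds v) * vertex_value h (map c (L' v))"
    if v: "v \<in> verts G" for v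
  proof -
    let ?M = "incident_edges G (edges G - F) v"
    let ?xs = "flat (map ?\<phi>\<phi> (il v))"
    have il_F: "set (il v) \<subseteq> ?F" using il(1) ins by auto
    have pn: "p v a = n a" if "a \<in> set (il v)" for a
      using that n_eq by (auto simp: il ins)
    have "?wp v =
      ext_word (\<Prod>a\<in>set (il v). dual_sign l (\<phi> (p v a))) (flat (map (\<lambda>a. (\<phi> a, dual_index l (\<phi> (p v a)))) (il v)))"
      unfolding il(1)[symmetric] by (rule wedge_prod_word[OF il(2)])
    also have "(\<Prod>a\<in>set (il v). dual_sign l (\<phi> (p v a))) = (?ds v)"
      unfolding il(1)[symmetric] using pn by (intro prod.cong) auto
    also have "map (\<lambda>a. (\<phi> a, dual_index l (\<phi> (p v a)))) (il v) = map ?\<phi>\<phi> (il v)"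
      using pn by (intro map_cong) auto
    finally have wp: "?wp v =
      ext_word (?ds v) ?xs" .
    have M: "?M = image_mset edge_of (mset_set {d \<in> D. pos d = v \<and> edge_of d \<in> edges G - F})"
      by (rule incident_edges_darts) auto
    have "{d \<in> D. pos d = v \<and> edge_of d \<in> edges G - F} = {d \<in> {d \<in> D. pos d = v}. edge_of d \<notin> F}"
      using edge_of_D proper_edges by auto
    then have M': "?M = image_mset edge_of (mset (evl v))"
      using M mset_L[OF v] fin_D by (simp add: evl_def filter_mset_mset_set)
    have "set_mset (image_mset \<psi> ?M) \<subseteq> {1..k}"
      using \<psi> edge_of_D proper_edges evl_D[OF _ v] unfolding M' by fastforce
    moreover have "set ?xs \<subseteq> {1..2 * l}"
      using il_F n_out \<phi> dual_index_in by (fastforce simp: set_flat)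
    ultimately have "h (tensor (\<Prod>a\<in>#?M. sym_gen (\<psi> a)) (ext_word (?ds v) ?xs)) =
       (?ds v) * list_sign ?xs * model_coeff h (image_mset \<psi> ?M) (set ?xs)"
      by (rule model_on_word[OF h])
    moreover have "odd_colors (map c (L' v)) = ?xs"
    proof -
      have "odd_colors (map c (?HT xs)) = flat (map ?\<phi>\<phi> xs)"
        if "set xs \<subseteq> ?F" for xs
        using that n_out by (induction xs) (auto simp: c_he c_ta)
      moreover have "odd_colors (map c ds) = []" if "set ds \<subseteq> set (evl v)" for ds
        using that evl_D[OF _ v] by (induction ds) (auto simp: c_even)
      ultimately show ?thesis using il_F by (simp add: L'_def)
    qed
    moreover have "even_colors (map c (L' v)) = map (\<lambda>d. \<psi> (edge_of d)) (evl v)"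
    proof -
      have "even_colors (map c (?HT xs)) = []"
        if "set xs \<subseteq> ?F" for xs
        using that n_out by (induction xs) (auto simp: c_he c_ta)
      moreover have "even_colors (map c ds) = map (\<lambda>d. \<psi> (edge_of d)) ds" if "set ds \<subseteq> set (evl v)" for ds
        using that evl_D[OF _ v] by (induction ds) (auto simp: c_even)
      ultimately show ?thesis using il_F by (simp add: L'_def)
    qed
    moreover have "even (length ?xs)"
    proof -
      have "even (length (flat (map f xs)))" for f :: "'e \<Rightarrow> nat \<times> nat" and xs
      proof (induction xs)
        case (Cons x xs)
        then show ?case by (cases "f x") simp
      qed simp
      then show ?thesis .
    qed
    ultimately show ?thesis
      unfolding wp vertex_value_def by (simp add: M' multiset.map_comp o_def)
  qed
  \<comment> \<open>The sign of the g of \<open>n a\<close> is collected at the head of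
    \<open>a\<close>; since \<open>n\<close> permutes the arcs of \<open>F\<close>, every arc is met
    once.\<close>
  have "(\<Prod>v\<in>verts G. \<Prod>a\<in>in_arcs G F w v. dual_sign l (\<phi> (n a))) = (\<Prod>a\<in>?F. dual_sign l (\<phi> (n a)))"
    unfolding ins using finF fin_sets pos_V th_D
    by (intro prod.group) auto
  also have "\<dots> = (\<Prod>a\<in>?F. dual_sign l (\<phi> a))"
    using prod.reindex_bij_betw[OF bij_n, of "\<lambda>a. dual_sign l (\<phi> a)"] .
  finally have ds: "(\<Prod>v\<in>verts G. \<Prod>a\<in>in_arcs G F w v. dual_sign l (\<phi> (n a))) = (\<Prod>a\<in>?F. dual_sign l (\<phi> a))" .
  have orb: "list_sign (?HT asl) *
      list_sign (?TH asl) = (-1) ^ card (orbit n ` ?F)"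
    unfolding set_asl[symmetric]
    by (rule list_sign_orbits)
       (use bij_n dist_asl inj disj in \<open>auto simp: set_asl intro: inj_on_subset\<close>)
  have "graded_sign c word * vertex_prod h c = graded_sign c (concat (map L' vs)) * (\<Prod>v\<leftarrow>vs. vertex_value h (map c (L' v)))"
    unfolding word_def vertex_prod_def using mset_L' vs(2) by (intro graded_vertices_cong) auto
  also have "(\<Prod>v\<leftarrow>vs. vertex_value h (map c (L' v))) = (\<Prod>v\<in>verts G. vertex_value h (map c (L' v)))"
    using prod_list_distinct_set[OF vs(1)] vs(2) by simp
  finally have wv: "graded_sign c word * vertex_prod h c =
    list_sign (?HT asl) * (\<Prod>v\<in>verts G. vertex_value h (map c (L' v)))"
    unfolding gs .
  have "graded_sign c word * edge_weight l c Es * vertex_prod h c =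
    (graded_sign c word * vertex_prod h c) * edge_weight l c Es" by (simp only: mult_ac)
  also have "\<dots> = (list_sign (?HT asl) *
      list_sign (?TH asl)) *
    ((\<Prod>a\<in>?F. dual_sign l (\<phi> a)) * (\<Prod>v\<in>verts G. vertex_value h (map c (L' v))))"
    unfolding wv ew by (simp only: mult_ac)
  also have "(\<Prod>a\<in>?F. dual_sign l (\<phi> a)) * (\<Prod>v\<in>verts G. vertex_value h (map c (L' v))) =
    (\<Prod>v\<in>verts G. h (tensor (\<Prod>a\<in>#incident_edges G (edges G - F) v. sym_gen (\<psi> a))
             (?wp v)))"
    unfolding ds[symmetric] prod.distrib[symmetric] using vv by (intro prod.cong) auto
  finally show ?thesis unfolding orb by (simp add: n_def)
qed

end

section \<open>Summing over the Eulerian subsets\<close>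

context dart_graph
begin

definition odd_edges where "odd_edges c = {e \<in> proper. \<exists>d\<in>darts e. \<not> isl (c d)}"

definition coloring_term where
  "coloring_term l h Es c = graded_sign c word * edge_weight l c Es * vertex_prod h c"

text \<open>Circles carry no darts, so a coloring sees only the part of \<open>F\<close> in
  \<open>proper\<close>.\<close>

definition sector where
  "sector k l h Es F = (\<Sum>c | c \<in> D \<rightarrow>\<^sub>E colors k l \<and> odd_edges c = F \<inter> proper. coloring_term l h Es c)"

lemma realizes_set: "realizes Es (darts ` proper) \<Longrightarrow> set (flat Es) = D"
  unfolding realizes_def set_flat D_def proper_def by (auto simp: image_iff)

lemma edge_weight_nonzero:
  assumes Es: "realizes Es (darts ` proper)" and "edge_weight l c Es \<noteq> 0"
    and e: "e \<in> proper" "darts e = {y, z}"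
  shows "edge_form l (c y) (c z) \<noteq> 0 \<or> edge_form l (c z) (c y) \<noteq> 0"
proof -
  have "darts e \<in> (\<lambda>(y, z). {y, z}) ` set Es"
    using Es e by (auto simp: realizes_def)
  then obtain u v where uv: "(u, v) \<in> set Es" "{u, v} = {y, z}" using e by auto
  then have "edge_form l (c u) (c v) \<noteq> 0"
    using assms(2) by (force simp: edge_weight_def prod_list_zero_iff)
  then show ?thesis using uv(2) by (auto simp: doubleton_eq_iff)
qed

lemma num_circuits_split:
  assumes F: "F \<subseteq> edges G"
    and "\<And>a. a \<in> F \<inter> proper \<Longrightarrow> orbit (next_arc G w p) a \<subseteq> F \<inter> proper"
  shows "num_circuits G F w p = card (orbit (next_arc G w p) ` (F \<inter> proper)) + card (F \<inter> circles)"
proof -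
  let ?n = "next_arc G w p"
  have circ: "orbit ?n a = {a}" if "a \<in> F \<inter> circles" for a
    using that F ends_empty[of a] orbit_eq_singleton_iff[of ?n a] by (auto simp: next_arc_def)
  have fin: "finite F" using F fin_edges finite_subset by blast
  have "F = (F \<inter> proper) \<union> (F \<inter> circles)" using F edges_split by blast
  then have "orbit ?n ` F = orbit ?n ` (F \<inter> proper) \<union> orbit ?n ` (F \<inter> circles)"
    by (metis image_Un)
  moreover have "orbit ?n ` (F \<inter> proper) \<inter> orbit ?n ` (F \<inter> circles) = {}"
    using assms(2) circ edges_split(2) by fastforce
  moreover have "orbit ?n ` (F \<inter> circles) = (\<lambda>a. {a}) ` (F \<inter> circles)"
    using circ by (intro image_cong) auto
  moreover have "card ((\<lambda>a. {a}) ` (F \<inter> circles)) = card (F \<inter> circles)"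
    by (simp add: card_image)
  ultimately show ?thesis
    using fin by (simp add: num_circuits_def card_Un_disjoint)
qed

lemma orbit_next_arc_subset:
  assumes F: "F \<subseteq> edges G"
    and w: "eulerian_orientation G F w" and p: "compatible_pairing G F w p"
    and a: "a \<in> F \<inter> proper"
  shows "orbit (next_arc G w p) a \<subseteq> F \<inter> proper"
proof -
  have step: "next_arc G w p a \<in> F \<inter> proper" if a: "a \<in> F \<inter> proper" for a
  proof -
    have e: "a \<in> edges G" using a F by blast
    have ne: "ends G a \<noteq> {#}" using ends_empty[OF e] a edges_split(2) by blast
    then have "ends G a = {#fst (w a), snd (w a)#}" using w a by (auto simp: eulerian_orientation_def)
    then have "snd (w a) \<in># image_mset pos (mset_set (darts a))" using ends_darts[OF e] by simp
    then have v: "snd (w a) \<in> verts G" using pos_verts[OF e] fin_darts[OF e] by auto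
    have "a \<in> in_arcs G F w (snd (w a))" using a ne by (simp add: in_arcs_def)
    then have "p (snd (w a)) a \<in> out_arcs G F w (snd (w a))"
      using p v bij_betwE by (fastforce simp: compatible_pairing_def)
    then have "p (snd (w a)) a \<in> F" "ends G (p (snd (w a)) a) \<noteq> {#}" by (auto simp: out_arcs_def)
    then show ?thesis
      using ne F ends_empty edges_split(1) by (auto simp: next_arc_def)
  qed
  show ?thesis
  proof
    fix b assume "b \<in> orbit (next_arc G w p) a"
    then show "b \<in> F \<inter> proper" by induction (use step a in auto)
  qed
qed

lemma dart_coloring_cong:
  assumes "\<And>e. e \<in> F \<inter> proper \<Longrightarrow> \<phi> e = \<phi>' e" "\<And>e. e \<in> proper - F \<Longrightarrow> \<psi> e = \<psi>' e"
  shows "dart_coloring l F he \<phi> \<psi> = dart_coloring l F he \<phi>' \<psi>'"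
  using assms edge_of_D by (fastforce simp: dart_coloring_def fun_eq_iff)

text \<open>Pairs of edge colorings inject into dart colorings, the color of an edge being read off
  its head. A dart coloring outside the image meets a zero of the form on some edge.\<close>

lemma sum_dart_colorings:
  assumes F: "F \<subseteq> edges G" and th: "circuit_ends F w ta he"
    and Es: "realizes Es (darts ` proper)"
  shows "(\<Sum>\<phi>\<in>F \<inter> proper \<rightarrow>\<^sub>E {1..2 * l}. \<Sum>\<psi>\<in>proper - F \<rightarrow>\<^sub>E {1..k}.
      coloring_term l h Es (dart_coloring l F he \<phi> \<psi>)) = sector k l h Es F"
proof -
  let ?F = "F \<inter> proper"
  let ?P = "(?F \<rightarrow>\<^sub>E {1..2 * l}) \<times> (proper - F \<rightarrow>\<^sub>E {1..k})"
  let ?S = "{c. c \<in> D \<rightarrow>\<^sub>E colors k l \<and> odd_edges c = ?F}"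
  let ?j = "\<lambda>(\<phi>, \<psi>). dart_coloring l F he \<phi> \<psi>"
  let ?i = "\<lambda>c. (restrict (\<lambda>e. projr (c (he e))) ?F, restrict (\<lambda>e. projl (c (he e))) (proper - F))"
  note ends_th = circuit_endsD(1,2)[OF th] and th_D = circuit_endsD(3-6)[OF th]
  have c_he: "dart_coloring l F he \<phi> \<psi> (he e) = Inr (\<phi> e)"
    and c_ta: "dart_coloring l F he \<phi> \<psi> (ta e) = Inr (dual_index l (\<phi> e))" if "e \<in> ?F" for e \<phi> \<psi>
    using that th_D[of e] ends_th(2)[of e] by (auto simp: dart_coloring_def)
  have c_ev: "dart_coloring l F he \<phi> \<psi> (he e) = Inl (\<psi> e)" "dart_coloring l F he \<phi> \<psi> (ta e) = Inl (\<psi> e)"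
    if "e \<in> proper - F" for e \<phi> \<psi>
    using that th_D[of e] by (auto simp: dart_coloring_def)
  have finS: "finite ?S" using fin_D by (intro finite_subset[OF _ finite_PiE[of D "\<lambda>_. colors k l"]]) auto
  have jin: "?j q \<in> ?S" if "q \<in> ?P" for q
  proof -
    obtain \<phi> \<psi> where q: "q = (\<phi>, \<psi>)" by fastforce
    then have \<phi>: "\<And>e. e \<in> ?F \<Longrightarrow> \<phi> e \<in> {1..2 * l}" and \<psi>: "\<And>e. e \<in> proper - F \<Longrightarrow> \<psi> e \<in> {1..k}"
      using that by (auto simp: PiE_mem)
    have "dart_coloring l F he \<phi> \<psi> d \<in> colors k l" if "d \<in> D" for d
      using that edge_of_D[OF that] \<phi>[of "edge_of d"] \<psi>[of "edge_of d"] dual_index_in[of "\<phi> (edge_of d)" l]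
      by (auto simp: dart_coloring_def colors_def)
    then have "dart_coloring l F he \<phi> \<psi> \<in> D \<rightarrow>\<^sub>E colors k l"
      by (auto simp: PiE_iff extensional_def dart_coloring_def)
    moreover have "odd_edges (dart_coloring l F he \<phi> \<psi>) = ?F"
    proof -
      have "e \<in> F \<longleftrightarrow> (\<exists>d\<in>darts e. \<not> isl (dart_coloring l F he \<phi> \<psi> d))" if "e \<in> proper" for e
        using c_he[of e \<phi> \<psi>] c_ev[of e \<phi> \<psi>] ends_th[OF that] that by (cases "e \<in> F") auto
      then show ?thesis by (auto simp: odd_edges_def)
    qed
    ultimately show ?thesis using q by simp
  qed
  have ij: "?i (?j q) = q" if "q \<in> ?P" for q
  proof -
    obtain \<phi> \<psi> where q: "q = (\<phi>, \<psi>)" by fastforce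
    then have "\<phi> \<in> ?F \<rightarrow>\<^sub>E {1..2 * l}" "\<psi> \<in> proper - F \<rightarrow>\<^sub>E {1..k}" using that by auto
    then have "\<phi> \<in> extensional ?F" "\<psi> \<in> extensional (proper - F)" by (auto simp: PiE_def)
    moreover have "projr (dart_coloring l F he \<phi> \<psi> (he e)) = \<phi> e" if "e \<in> ?F" for e
      using c_he[OF that] by simp
    moreover have "projl (dart_coloring l F he \<phi> \<psi> (he e)) = \<psi> e" if "e \<in> proper - F" for e
      using c_ev(1)[OF that] by simp
    ultimately have "restrict (\<lambda>e. projr (dart_coloring l F he \<phi> \<psi> (he e))) ?F = \<phi>"
      "restrict (\<lambda>e. projl (dart_coloring l F he \<phi> \<psi> (he e))) (proper - F) = \<psi>"
      by (metis (no_types, lifting) extensional_restrict restrict_ext)+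
    then show ?thesis using q by simp
  qed
  define bad where "bad = {c \<in> ?S. coloring_term l h Es c = 0}"
  have good: "c (he e) \<in> colors k l \<and> c (ta e) \<in> colors k l \<and>
      (if e \<in> F then \<exists>j\<in>{1..2 * l}. c (he e) = Inr j \<and> c (ta e) = Inr (dual_index l j)
       else \<exists>i\<in>{1..k}. c (he e) = Inl i \<and> c (ta e) = Inl i)"
    if c: "c \<in> ?S - bad" and e: "e \<in> proper" for c e
  proof -
    have C: "c (he e) \<in> colors k l" "c (ta e) \<in> colors k l"
      using c th_D[OF e] by (auto simp: PiE_mem)
    have "edge_weight l c Es \<noteq> 0" using c by (auto simp: bad_def coloring_term_def)
    \<comment> \<open>The order in which \<open>Es\<close> lists the two darts is unknown; by
      supersymmetry it does not affect whether the form is nonzero.\<close>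
    then have "edge_form l (c (ta e)) (c (he e)) \<noteq> 0 \<or> edge_form l (c (he e)) (c (ta e)) \<noteq> 0"
      using edge_weight_nonzero[OF Es _ e ends_th(1)[OF e]] by blast
    then have nz: "edge_form l (c (ta e)) (c (he e)) \<noteq> 0"
      using edge_form_swap[OF C(2,1)] by auto
    have "e \<in> F \<longleftrightarrow> e \<in> odd_edges c" using c e by blast
    then have eF: "e \<in> F \<longleftrightarrow> \<not> isl (c (ta e)) \<or> \<not> isl (c (he e))"
      using e ends_th(1)[OF e] by (auto simp: odd_edges_def)
    show ?thesis
      using C nz eF by (cases "c (he e)"; cases "c (ta e)") (auto simp: colors_def split: if_splits)
  qed
  have iin: "?i c \<in> ?P" if "c \<in> ?S - bad" for c
    using good[OF that] by (auto simp: PiE_iff; fastforce)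
  have ji: "?j (?i c) = c" if c: "c \<in> ?S - bad" for c
  proof
    fix d
    show "?j (?i c) d = c d"
    proof (cases "d \<in> D")
      case False
      then show ?thesis using c by (auto simp: dart_coloring_def PiE_iff extensional_def)
    next
      case True
      then have e: "edge_of d \<in> proper" "d \<in> darts (edge_of d)" using edge_of_D by blast+
      then have "d = ta (edge_of d) \<or> d = he (edge_of d)" using ends_th(1) by blast
      then show ?thesis
        using good[OF c e(1)] True e(1) ends_th(2)[OF e(1)]
        by (cases "edge_of d \<in> F") (auto simp: dart_coloring_def split: if_splits)
    qed
  qed
  have "(\<Sum>\<phi>\<in>?F \<rightarrow>\<^sub>E {1..2 * l}. \<Sum>\<psi>\<in>proper - F \<rightarrow>\<^sub>E {1..k}.
      coloring_term l h Es (dart_coloring l F he \<phi> \<psi>)) = (\<Sum>q\<in>?P. coloring_term l h Es (?j q))"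
    by (simp add: sum.cartesian_product case_prod_unfold)
  also have "\<dots> = (\<Sum>c\<in>?j ` ?P. coloring_term l h Es c)"
    using ij by (subst sum.reindex) (auto intro!: inj_on_inverseI[where g = ?i])
  also have "\<dots> = (\<Sum>c\<in>?S. coloring_term l h Es c)"
  proof (rule sum.mono_neutral_left[OF finS])
    show "?j ` ?P \<subseteq> ?S" using jin by blast
    show "\<forall>c\<in>?S - ?j ` ?P. coloring_term l h Es c = 0"
    proof
      fix c assume c: "c \<in> ?S - ?j ` ?P"
      show "coloring_term l h Es c = 0"
      proof (rule ccontr)
        assume "coloring_term l h Es c \<noteq> 0"
        then have good: "c \<in> ?S - bad" using c by (auto simp: bad_def)
        have "c \<in> ?j ` ?P" by (rule image_eqI[of _ ?j "?i c", OF ji[OF good, symmetric] iin[OF good]])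
        then show False using c by blast
      qed
    qed
  qed
  finally show ?thesis by (simp add: sector_def)
qed

text \<open>A circle in \<open>F\<close> is one circuit, giving -1, and has 2l colors; a circle
  outside \<open>F\<close> has k colors. Circles meet no vertex, so they contribute constant
  factors.\<close>

lemma oriented_weight_eq:
  assumes h: "edge_coloring_model k l h" and F: "F \<subseteq> edges G"
    and w: "eulerian_orientation G F w" and p: "compatible_pairing G F w p"
    and Es: "realizes Es (darts ` proper)"
  shows "oriented_weight k l h G F w p =
    (- of_nat (2 * l)) ^ card (F \<inter> circles) * of_nat k ^ card (circles - F) * sector k l h Es F"
proof -
  let ?F = "F \<inter> proper"
  obtain ta he where th: "circuit_ends F w ta he" using circuit_ends_exist[OF F w] by blast
  let ?T = "\<lambda>\<phi> \<psi>. \<Prod>v\<in>verts G. h (tensor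
             (\<Prod>a\<in>#incident_edges G (edges G - F) v. sym_gen (\<psi> a))
             (wedge_prod (\<lambda>a. wedge (ext_gen (\<phi> a)) (dual_gen l (\<phi> (p v a)))) (in_arcs G F w v)))"
  let ?t = "\<lambda>\<phi> \<psi>. coloring_term l h Es (dart_coloring l F he \<phi> \<psi>)"
  have "(-1) ^ num_circuits G F w p * ?T \<phi> \<psi> = (-1) ^ card (F \<inter> circles) * ?t \<phi> \<psi>"
    if "\<phi> \<in> F \<rightarrow>\<^sub>E {1..2 * l}" "\<psi> \<in> (edges G - F) \<rightarrow>\<^sub>E {1..k}" for \<phi> \<psi>
  proof -
    have "(-1) ^ card (orbit (next_arc G w p) ` ?F) * ?T \<phi> \<psi> = ?t \<phi> \<psi>"
      unfolding coloring_term_def using that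
      by (intro oriented_term[OF h F w p th _ _ Es]) (auto simp: PiE_mem)
    then show ?thesis
      using num_circuits_split[OF F orbit_next_arc_subset[OF F w p]] by (simp add: power_add mult_ac)
  qed
  then have "oriented_weight k l h G F w p = (\<Sum>\<phi>\<in>F \<rightarrow>\<^sub>E {1..2 * l}. \<Sum>\<psi>\<in>(edges G - F) \<rightarrow>\<^sub>E {1..k}.
      (-1) ^ card (F \<inter> circles) * ?t \<phi> \<psi>)"
    unfolding oriented_weight_def sum_distrib_left by (intro sum.cong refl) auto
  also have "\<dots> = (-1) ^ card (F \<inter> circles) * (\<Sum>\<phi>\<in>F \<rightarrow>\<^sub>E {1..2 * l}. \<Sum>\<psi>\<in>(edges G - F) \<rightarrow>\<^sub>E {1..k}. ?t \<phi> \<psi>)"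
    by (simp add: sum_distrib_left)
  also have "(\<Sum>\<phi>\<in>F \<rightarrow>\<^sub>E {1..2 * l}. \<Sum>\<psi>\<in>(edges G - F) \<rightarrow>\<^sub>E {1..k}. ?t \<phi> \<psi>) =
     (\<Sum>\<phi>\<in>F \<rightarrow>\<^sub>E {1..2 * l}. of_nat k ^ card (circles - F) * (\<Sum>\<psi>\<in>proper - F \<rightarrow>\<^sub>E {1..k}. ?t \<phi> \<psi>))"
  proof (intro sum.cong refl)
    fix \<phi>
    have E: "edges G - F = (proper - F) \<union> (circles - F)" using edges_split by blast
    have disj: "(proper - F) \<inter> (circles - F) = {}" using edges_split by blast
    have cong: "?t \<phi> \<psi> = ?t \<phi> \<psi>'" if "\<And>e. e \<in> proper - F \<Longrightarrow> \<psi> e = \<psi>' e" for \<psi> \<psi>'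
      using that by (intro arg_cong[where f = "coloring_term l h Es"] dart_coloring_cong) auto
    have "(\<Sum>\<psi>\<in>(edges G - F) \<rightarrow>\<^sub>E {1..k}. ?t \<phi> \<psi>) =
       of_nat (card {1..k}) ^ card (circles - F) * (\<Sum>\<psi>\<in>proper - F \<rightarrow>\<^sub>E {1..k}. ?t \<phi> \<psi>)"
      unfolding E by (rule sum_PiE_irrelevant[OF disj _ _ _ cong]) (use fin_sets in simp_all)
    then show "(\<Sum>\<psi>\<in>(edges G - F) \<rightarrow>\<^sub>E {1..k}. ?t \<phi> \<psi>) =
       of_nat k ^ card (circles - F) * (\<Sum>\<psi>\<in>proper - F \<rightarrow>\<^sub>E {1..k}. ?t \<phi> \<psi>)"
      by simp
  qed
  also have "\<dots> = of_nat k ^ card (circles - F) *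
     (\<Sum>\<phi>\<in>F \<rightarrow>\<^sub>E {1..2 * l}. \<Sum>\<psi>\<in>proper - F \<rightarrow>\<^sub>E {1..k}. ?t \<phi> \<psi>)"
    by (simp add: sum_distrib_left)
  also have "(\<Sum>\<phi>\<in>F \<rightarrow>\<^sub>E {1..2 * l}. \<Sum>\<psi>\<in>proper - F \<rightarrow>\<^sub>E {1..k}. ?t \<phi> \<psi>) =
     of_nat (2 * l) ^ card (F \<inter> circles) * (\<Sum>\<phi>\<in>?F \<rightarrow>\<^sub>E {1..2 * l}. \<Sum>\<psi>\<in>proper - F \<rightarrow>\<^sub>E {1..k}. ?t \<phi> \<psi>)"
  proof -
    have E: "F = ?F \<union> (F \<inter> circles)" using F edges_split by blast
    have disj: "?F \<inter> (F \<inter> circles) = {}" using edges_split by blast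
    let ?s = "\<lambda>\<phi>. \<Sum>\<psi>\<in>proper - F \<rightarrow>\<^sub>E {1..k}. ?t \<phi> \<psi>"
    have cong: "(\<Sum>\<psi>\<in>proper - F \<rightarrow>\<^sub>E {1..k}. ?t \<phi> \<psi>) = (\<Sum>\<psi>\<in>proper - F \<rightarrow>\<^sub>E {1..k}. ?t \<phi>' \<psi>)"
      if "\<And>e. e \<in> ?F \<Longrightarrow> \<phi> e = \<phi>' e" for \<phi> \<phi>'
      using that by (intro sum.cong refl arg_cong[where f = "coloring_term l h Es"] dart_coloring_cong) auto
    have "(\<Sum>\<phi>\<in>?F \<union> (F \<inter> circles) \<rightarrow>\<^sub>E {1..2 * l}. ?s \<phi>) =
      of_nat (card {1..2 * l}) ^ card (F \<inter> circles) * (\<Sum>\<phi>\<in>?F \<rightarrow>\<^sub>E {1..2 * l}. ?s \<phi>)"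
      by (rule sum_PiE_irrelevant[OF disj _ _ _ cong]) (use fin_sets in simp_all)
    then show ?thesis unfolding E[symmetric] by simp
  qed
  finally show ?thesis
    unfolding sum_dart_colorings[OF F th Es] power_minus[of "of_nat (2 * l)"] by (simp only: mult_ac)
qed

text \<open>The right-hand side mentions neither orientation nor pairing, so the choice has a single
  candidate value.\<close>

lemma eulerian_weight_eq:
  assumes h: "edge_coloring_model k l h" and F: "eulerian G F"
    and Es: "realizes Es (darts ` proper)"
  shows "eulerian_weight k l h G F =
    (- of_nat (2 * l)) ^ card (F \<inter> circles) * of_nat k ^ card (circles - F) * sector k l h Es F"
proof -
  have sub: "F \<subseteq> edges G" using F by (simp add: eulerian_def)
  obtain w p where wp: "eulerian_orientation G F w" "compatible_pairing G F w p"
    using eulerian_orientation_exists[OF F] by blast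
  show ?thesis
    unfolding eulerian_weight_def
    by (rule some_equality) (use wp oriented_weight_eq[OF h sub _ _ Es] in \<open>auto intro!: exI\<close>)
qed

text \<open>A nonzero term forces the two darts of each edge to have equal parity, so the odd darts
  at a vertex are those of edges in \<open>F\<close>, and a vertex of odd degree in \<open>F\<close>
  has value 0. Hence the sum over Eulerian sets extends to all subsets.\<close>

lemma sector_not_eulerian:
  assumes F: "F \<subseteq> edges G" "\<not> eulerian G F"
    and Es: "realizes Es (darts ` proper)"
  shows "sector k l h Es F = 0"
  unfolding sector_def
proof (rule sum.neutral, rule ballI, rule ccontr)
  fix c assume c: "c \<in> {c. c \<in> D \<rightarrow>\<^sub>E colors k l \<and> odd_edges c = F \<inter> proper}"
    and nz: "coloring_term l h Es c \<noteq> 0"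
  obtain v where v: "v \<in> verts G" "odd (card {d \<in> D. pos d = v \<and> edge_of d \<in> F})"
    using F by (auto simp: eulerian_darts)
  have odd: "\<not> isl (c d) \<longleftrightarrow> edge_of d \<in> F" if d: "d \<in> D" for d
  proof -
    have e: "edge_of d \<in> proper" "d \<in> darts (edge_of d)" using edge_of_D[OF d] by auto
    obtain y z where yz: "darts (edge_of d) = {y, z}"
      using darts_card[of "edge_of d"] e by (auto simp: proper_def card_2_iff)
    have "edge_weight l c Es \<noteq> 0" using nz by (auto simp: coloring_term_def)
    then have "isl (c y) = isl (c z)"
      using edge_weight_nonzero[OF Es _ e(1) yz, of l c] edge_form_parity by metis
    moreover have "edge_of d \<in> F \<longleftrightarrow> edge_of d \<in> odd_edges c" using c e by blast
    ultimately show ?thesis using e yz by (auto simp: odd_edges_def)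
  qed
  have "vertex_value h (map c (L v)) \<noteq> 0"
    using nz v(1) vs(2) by (auto simp: coloring_term_def vertex_prod_def prod_list_zero_iff)
  then have "even (length (odd_colors (map c (L v))))"
    by (auto simp: vertex_value_def split: if_splits)
  moreover have "length (odd_colors (map c (L v))) = length (filter (\<lambda>d. \<not> isl (c d)) (L v))"
    by (simp add: odd_colors_def filter_map o_def)
  moreover have "length (filter (\<lambda>d. \<not> isl (c d)) (L v)) = card {d \<in> D. pos d = v \<and> edge_of d \<in> F}"
  proof -
    have "length (filter (\<lambda>d. \<not> isl (c d)) (L v)) = card (set (filter (\<lambda>d. \<not> isl (c d)) (L v)))"
      using L(1)[OF v(1)] by (intro distinct_card[symmetric]) simp
    also have "set (filter (\<lambda>d. \<not> isl (c d)) (L v)) = {d \<in> D. pos d = v \<and> edge_of d \<in> F}"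
      using L(2)[OF v(1)] odd by (auto simp: D_def[symmetric])
    finally show ?thesis .
  qed
  ultimately show False using v(2) by simp
qed

theorem partition_function_net_sum:
  assumes h: "edge_coloring_model k l h" and Es: "realizes Es (darts ` proper)"
  shows "mixed_partition_function k l h G =
    (of_nat k - 2 * of_nat l) ^ card circles * net_sum k l word [] Es (vertex_prod h)"
proof -
  let ?a = "\<lambda>F. (- of_nat (2 * l)) ^ card (F \<inter> circles) * of_nat k ^ card (circles - F) :: complex"
  have Feq: "F \<inter> proper \<union> F \<inter> circles = F" if "F \<subseteq> proper \<union> circles" for F
    using that by blast
  have "mixed_partition_function k l h G = (\<Sum>F | eulerian G F. ?a F * sector k l h Es F)"
    unfolding mixed_partition_function_def
    by (intro sum.cong refl) (simp add: eulerian_weight_eq[OF h _ Es])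
  also have "\<dots> = (\<Sum>F\<in>Pow (edges G). ?a F * sector k l h Es F)"
    using fin_edges sector_not_eulerian[OF _ _ Es]
    by (intro sum.mono_neutral_left) (auto simp: eulerian_def)
  also have "\<dots> = (\<Sum>(P, Q)\<in>Pow proper \<times> Pow circles. ?a (P \<union> Q) * sector k l h Es (P \<union> Q))"
    by (rule sum.reindex_bij_witness[where i = "\<lambda>(P, Q). P \<union> Q" and j = "\<lambda>F. (F \<inter> proper, F \<inter> circles)"])
       (use edges_split Feq in auto)
  also have "\<dots> = (\<Sum>(P, Q)\<in>Pow proper \<times> Pow circles. ?a Q * sector k l h Es P)"
  proof (intro sum.cong refl, clarify)
    fix P Q assume "P \<subseteq> proper" "Q \<subseteq> circles"
    then have "(P \<union> Q) \<inter> circles = Q \<inter> circles" "circles - (P \<union> Q) = circles - Q" "(P \<union> Q) \<inter> proper = P \<inter> proper"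
      using edges_split(2) by blast+
    then show "?a (P \<union> Q) * sector k l h Es (P \<union> Q) = ?a Q * sector k l h Es P"
      by (simp add: sector_def)
  qed
  also have "\<dots> = (\<Sum>Q\<in>Pow circles. ?a Q) * (\<Sum>P\<in>Pow proper. sector k l h Es P)"
    by (simp add: sum_product sum.cartesian_product[symmetric]) (rule sum.swap)
  \<comment> \<open>Each circle is independently in \<open>F\<close> or not, so the sum expands a
    power of the binomial k - 2l.\<close>
  also have "(\<Sum>Q\<in>Pow circles. ?a Q) = (of_nat k - 2 * of_nat l) ^ card circles"
  proof -
    have "(\<Prod>x\<in>circles. - of_nat (2 * l) + of_nat k :: complex) =
      (\<Sum>Q\<in>Pow circles. (\<Prod>x\<in>Q. - of_nat (2 * l)) * (\<Prod>x\<in>circles - Q. of_nat k))"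
      by (rule prod_add) (rule fin_sets)
    also have "\<dots> = (\<Sum>Q\<in>Pow circles. ?a Q)"
      by (intro sum.cong refl) (auto simp: Int_absorb2)
    finally show ?thesis by simp
  qed
  also have "(\<Sum>P\<in>Pow proper. sector k l h Es P) = (\<Sum>c\<in>D \<rightarrow>\<^sub>E colors k l. coloring_term l h Es c)"
  proof -
    have "(\<Sum>P\<in>Pow proper. sector k l h Es P) =
      (\<Sum>P\<in>Pow proper. \<Sum>c | c \<in> D \<rightarrow>\<^sub>E colors k l \<and> odd_edges c = P. coloring_term l h Es c)"
      unfolding sector_def by (intro sum.cong refl) (auto simp: Int_absorb2)
    also have "\<dots> = (\<Sum>c\<in>D \<rightarrow>\<^sub>E colors k l. coloring_term l h Es c)"
      using fin_D fin_sets by (intro sum.group) (auto simp: odd_edges_def intro: finite_PiE)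
    finally show ?thesis .
  qed
  also have "(\<Sum>c\<in>D \<rightarrow>\<^sub>E colors k l. coloring_term l h Es c) = net_sum k l word [] Es (vertex_prod h)"
    unfolding net_sum_def realizes_set[OF Es] coloring_term_def by simp
  finally show ?thesis .
qed

end

section \<open>Gluing labels one at a time\<close>

text \<open>On the whole type this is an equivalence; only the quotient in \<open>classes\<close>
  restricts to actual edges.\<close>

definition glue_rel :: "('e \<times> 'e) list \<Rightarrow> ('e \<times> 'e) set" where
  "glue_rel ps = (set ps \<union> (set ps)\<inverse>)\<^sup>*"

lemma equiv_glue_rel: "equiv UNIV (glue_rel ps)"
  unfolding glue_rel_def
  by (intro equivI) (auto simp: refl_on_def trans_rtrancl sym_rtrancl sym_Un_converse)

text \<open>One more pair merges two classes into \<open>T\<close> and leaves the others alone: the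
  relation \<open>Q\<close>, in which all elements of \<open>T\<close> are related in addition to
  the old relation, is closed under steps along the new pair.\<close>

lemma glue_rel_snoc_class:
  "glue_rel (ps @ [(a, b)]) `` {x} =
    (if (a, x) \<in> glue_rel ps \<or> (b, x) \<in> glue_rel ps
     then glue_rel ps `` {a} \<union> glue_rel ps `` {b} else glue_rel ps `` {x})"
proof -
  let ?R = "glue_rel ps" and ?R' = "glue_rel (ps @ [(a, b)])"
  have sym: "(v, u) \<in> ?R" if "(u, v) \<in> ?R" for u v
    using equiv_glue_rel[of ps] that by (meson equivE symD)
  have tr: "(u, w) \<in> ?R" if "(u, v) \<in> ?R" "(v, w) \<in> ?R" for u v w
    using that by (auto simp: glue_rel_def)
  have tr': "(u, w) \<in> ?R'" if "(u, v) \<in> ?R'" "(v, w) \<in> ?R'" for u v w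
    using that by (auto simp: glue_rel_def)
  have sub: "?R \<subseteq> ?R'" unfolding glue_rel_def by (intro rtrancl_mono) auto
  have ab: "(a, b) \<in> ?R'" "(b, a) \<in> ?R'" by (auto simp: glue_rel_def)
  have refl: "(u, u) \<in> ?R" for u by (simp add: glue_rel_def)
  define T where "T = ?R `` {a} \<union> ?R `` {b}"
  have T_step: "w \<in> T" if "v \<in> T" "(v, w) \<in> ?R" for v w
    using that tr unfolding T_def by blast
  have ab_T: "a \<in> T" "b \<in> T" using refl by (auto simp: T_def)
  define Q where "Q = ?R \<union> T \<times> T"
  have "?R' \<subseteq> Q"
  proof
    fix p assume "p \<in> ?R'"
    then obtain u v where p: "p = (u, v)" "(u, v) \<in> ?R'" by (cases p) auto
    then have "(u, v) \<in> (set (ps @ [(a, b)]) \<union> (set (ps @ [(a, b)]))\<inverse>)\<^sup>*" by (simp add: glue_rel_def)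
    then have "(u, v) \<in> Q"
    proof induction
      case base
      then show ?case by (simp add: Q_def refl)
    next
      case (step v w)
      consider "(v, w) \<in> ?R" | "v \<in> T" "w \<in> T"
        using step(2) ab_T by (auto simp: glue_rel_def)
      then show ?case
      proof cases
        case 1
        then show ?thesis using step(3) tr T_step unfolding Q_def by blast
      next
        case 2
        then show ?thesis using step(3) sym T_step unfolding Q_def by blast
      qed
    qed
    then show "p \<in> Q" using p by simp
  qed
  moreover have "Q \<subseteq> ?R'"
  proof -
    have from_ab: "(a, v) \<in> ?R' \<and> (v, a) \<in> ?R'" if "v \<in> T" for v
      using that sub sym ab tr' unfolding T_def by blast
    then have "T \<times> T \<subseteq> ?R'" using tr' by blast
    then show ?thesis using sub by (auto simp: Q_def)
  qed
  ultimately have "?R' = Q" by blast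
  moreover have "Q `` {x} = (if x \<in> T then T else ?R `` {x})"
    using T_step unfolding Q_def by auto
  moreover have "x \<in> T \<longleftrightarrow> (a, x) \<in> ?R \<or> (b, x) \<in> ?R" by (auto simp: T_def)
  ultimately show ?thesis by (simp add: T_def)
qed

text \<open>If \<open>a\<close> and \<open>b\<close> are already equivalent, their common class is
  removed and inserted again; in a gluing this is the case in which an edge closes to a
  circle.\<close>

lemma glue_rel_snoc_quotient:
  fixes ps :: "('e \<times> 'e) list"
  assumes "a \<in> E" "b \<in> E"
  defines "Ca \<equiv> glue_rel ps `` {a}" and "Cb \<equiv> glue_rel ps `` {b}"
  shows "E // glue_rel (ps @ [(a, b)]) = insert (Ca \<union> Cb) (E // glue_rel ps - {Ca, Cb})"
proof -
  let ?R = "glue_rel ps"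
  have eq: "?R `` {x} = Ca \<longleftrightarrow> (a, x) \<in> ?R" "?R `` {x} = Cb \<longleftrightarrow> (b, x) \<in> ?R" for x
  proof -
    have "?R `` {u} = ?R `` {x} \<longleftrightarrow> (u, x) \<in> ?R" for u
      by (rule eq_equiv_class_iff[OF equiv_glue_rel]) auto
    then show "?R `` {x} = Ca \<longleftrightarrow> (a, x) \<in> ?R" "?R `` {x} = Cb \<longleftrightarrow> (b, x) \<in> ?R"
      unfolding Ca_def Cb_def eq_commute[of "?R `` {x}"] by blast+
  qed
  have cls: "glue_rel (ps @ [(a, b)]) `` {x} =
    (if ?R `` {x} = Ca \<or> ?R `` {x} = Cb then Ca \<union> Cb else ?R `` {x})" for x
    unfolding glue_rel_snoc_class eq Ca_def[symmetric] Cb_def[symmetric] ..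
  have image: "E // S = (\<lambda>x. S `` {x}) ` E" for S by (auto simp: quotient_def)
  show ?thesis
    unfolding image cls
  proof (intro equalityI subsetI)
    fix C assume "C \<in> insert (Ca \<union> Cb) ((\<lambda>x. ?R `` {x}) ` E - {Ca, Cb})"
    then consider "C = Ca \<union> Cb" | x where "x \<in> E" "C = ?R `` {x}" "C \<noteq> Ca" "C \<noteq> Cb" by blast
    then show "C \<in> (\<lambda>x. if ?R `` {x} = Ca \<or> ?R `` {x} = Cb then Ca \<union> Cb else ?R `` {x}) ` E"
    proof cases
      case 1
      then show ?thesis using assms(1) by (intro image_eqI[of _ _ a]) (auto simp: Ca_def)
    next
      case 2
      then show ?thesis by (intro image_eqI[of _ _ x]) auto
    qed
  next
    fix C assume "C \<in> (\<lambda>x. if ?R `` {x} = Ca \<or> ?R `` {x} = Cb then Ca \<union> Cb else ?R `` {x}) ` E"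
    then obtain x where "x \<in> E" "C = (if ?R `` {x} = Ca \<or> ?R `` {x} = Cb then Ca \<union> Cb else ?R `` {x})"
      by blast
    then show "C \<in> insert (Ca \<union> Cb) ((\<lambda>x. ?R `` {x}) ` E - {Ca, Cb})"
      by (cases "?R `` {x} = Ca \<or> ?R `` {x} = Cb") simp_all
  qed
qed

text \<open>Contracting a label requires its edges at the front of the list and in a prescribed
  orientation.\<close>

lemma realizes_front:
  assumes "realizes Es P" "{u, v} \<in> P" "u \<noteq> v"
  shows "\<exists>Es'. realizes ((u, v) # Es') P \<and> realizes Es' (P - {{u, v}})"
proof -
  obtain p where p: "p \<in> set Es" "(\<lambda>(y, z). {y, z}) p = {u, v}"
    using assms by (auto simp: realizes_def)
  then obtain as bs where Es: "Es = as @ p # bs" by (meson split_list)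
  obtain y z where pyz: "p = (y, z)" by fastforce
  then have yz: "p = (y, z)" "{y, z} = {u, v}" using p(2) by simp_all
  have dist: "distinct (flat as @ y # z # flat bs)" using assms(1) by (simp add: realizes_def Es yz)
  have "distinct (u # v # flat (as @ bs))"
    using dist yz(2) assms(3) by (auto simp: doubleton_eq_iff)
  moreover have "(\<lambda>(y, z). {y, z}) ` set ((u, v) # as @ bs) = P"
    using assms(1) yz by (auto simp: realizes_def Es)
  moreover from this have "(\<lambda>(y, z). {y, z}) ` set (as @ bs) = P - {{u, v}}"
  proof -
    have "{u, v} \<notin> (\<lambda>(y, z). {y, z}) ` set (as @ bs)"
      using \<open>distinct (u # v # flat (as @ bs))\<close> by (auto simp: set_flat)
    moreover have "P = insert {u, v} ((\<lambda>(y, z). {y, z}) ` set (as @ bs))"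
      using \<open>(\<lambda>(y, z). {y, z}) ` set ((u, v) # as @ bs) = P\<close>
      by (simp only: list.set image_insert prod.case)
    ultimately show ?thesis by (simp only: Diff_insert_absorb if_False simp_thms)
  qed
  ultimately show ?thesis
    by (intro exI[of _ "as @ bs"]) (auto simp: realizes_def)
qed

lemma realizes_Cons:
  assumes "realizes Es P" "u \<noteq> v" "u \<notin> \<Union>P" "v \<notin> \<Union>P"
  shows "realizes ((u, v) # Es) (insert {u, v} P)"
  using assms by (auto simp: realizes_def set_flat)

text \<open>
  The labels \<open>X\<close> are glued one at a time. After gluing those in \<open>Y\<close>, an edge is a class \<open>C\<close> of the
  original edges, and \<open>class_darts Y C\<close> consists of its two ends, or is empty if \<open>C\<close> is a circle.
\<close>

locale gluing =
  fixes E :: "'e set" and darts :: "'e \<Rightarrow> 'd::linorder set" and edge_of :: "'d \<Rightarrow> 'e"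
    and X :: "('d \<times> 'd) list" and W :: "'d list" and \<Phi> :: "('d \<Rightarrow> color) \<Rightarrow> complex"
    and Es0 :: "('d \<times> 'd) list" and k l :: nat
  assumes fin_E: "finite E"
    and darts_card: "\<And>e. e \<in> E \<Longrightarrow> darts e = {} \<or> card (darts e) = 2"
    and edge_of: "\<And>e d. e \<in> E \<Longrightarrow> d \<in> darts e \<Longrightarrow> edge_of d = e"
    and WX: "distinct (W @ flat X)" "set (W @ flat X) = \<Union> (darts ` E)"
    and \<Phi>: "\<And>c d a. d \<in> set (flat X) \<Longrightarrow> \<Phi> (c(d := a)) = \<Phi> c"
    and Es0: "realizes Es0 (darts ` E - {{}})"
begin

definition edge_pairs where "edge_pairs Y = map (\<lambda>(d, d'). (edge_of d, edge_of d')) Y"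
definition class_darts where "class_darts Y C = \<Union> (darts ` C) - set (flat Y)"
definition classes where "classes Y = E // glue_rel (edge_pairs Y)"
definition circle_classes where "circle_classes Y = {C \<in> classes Y. class_darts Y C = {}}"

lemma edge_of_in: "d \<in> set (flat X) \<Longrightarrow> edge_of d \<in> E \<and> d \<in> darts (edge_of d)"
  using WX(2) edge_of by auto

lemma finite_classes: "finite (classes Y)"
  unfolding classes_def quotient_def using fin_E by simp

lemma class_subset: "set Y \<subseteq> set X \<Longrightarrow> C \<in> classes Y \<Longrightarrow> C \<subseteq> E"
proof
  fix x assume Y: "set Y \<subseteq> set X" and C: "C \<in> classes Y" "x \<in> C"
  then obtain a where a: "a \<in> E" "(a, x) \<in> glue_rel (edge_pairs Y)"
    by (auto simp: classes_def quotient_def)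
  from a(2) show "x \<in> E" unfolding glue_rel_def
  proof induction
    case (step u v)
    then obtain d d' where "(d, d') \<in> set Y" "v = edge_of d \<or> v = edge_of d'"
      by (auto simp: edge_pairs_def)
    then show ?case using Y edge_of_in flat_memD[of d d' X] by blast
  qed (rule a(1))
qed

lemma class_darts_disjoint:
  assumes "set Y \<subseteq> set X" "C \<in> classes Y" "C' \<in> classes Y" "C \<noteq> C'"
  shows "class_darts Y C \<inter> class_darts Y C' = {}"
proof -
  have "C \<inter> C' = {}"
  proof -
    have "C \<in> UNIV // glue_rel (edge_pairs Y)" "C' \<in> UNIV // glue_rel (edge_pairs Y)"
      using assms(2,3) by (auto simp: classes_def quotient_def)
    from quotient_disj[OF equiv_glue_rel this] show ?thesis using assms(4) by blast
  qed
  then show ?thesis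
    using edge_of class_subset[OF assms(1,2)] class_subset[OF assms(1,3)]
    unfolding class_darts_def by blast
qed

lemma Union_class_darts:
  assumes "set Y \<subseteq> set X"
  shows "\<Union> (class_darts Y ` classes Y) = \<Union> (darts ` E) - set (flat Y)"
proof -
  have "\<Union> (classes Y) = E"
  proof
    show "\<Union> (classes Y) \<subseteq> E" using class_subset[OF assms] by blast
    show "E \<subseteq> \<Union> (classes Y)" by (auto simp: classes_def quotient_def glue_rel_def)
  qed
  then show ?thesis unfolding class_darts_def by blast
qed

text \<open>Induction on the prefix \<open>Y\<close> that is already glued. That each class has two
  darts or none is carried along, since it supplies the partner of a label dart within its
  class.\<close>

lemma net_sum_gluing:
  assumes "X = Y @ Z"
  shows "(\<forall>C\<in>classes Y. class_darts Y C = {} \<or> card (class_darts Y C) = 2) \<and>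
    (\<exists>Es. realizes Es (class_darts Y ` classes Y - {{}}) \<and>
      (of_nat k - 2 * of_nat l) ^ card (circle_classes []) * net_sum k l W X Es0 \<Phi> =
      (of_nat k - 2 * of_nat l) ^ card (circle_classes Y) * net_sum k l W Z Es \<Phi>)"
  using assms
proof (induction Y arbitrary: Z rule: rev_induct)
  case Nil
  have cls: "classes [] = (\<lambda>e. {e}) ` E"
    by (auto simp: classes_def quotient_def edge_pairs_def glue_rel_def)
  have "class_darts [] {e} = darts e" for e by (simp add: class_darts_def)
  then have "class_darts [] ` classes [] = darts ` E" unfolding cls image_image by simp
  then show ?case using Nil Es0 darts_card cls by (auto simp: class_darts_def)
next
  case (snoc q Y)
  obtain d d' where q: "q = (d, d')" by fastforce
  define \<kappa> where "\<kappa> = (of_nat k - 2 * of_nat l :: complex)"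
  have X: "X = Y @ (d, d') # Z" using snoc.prems q by simp
  let ?cd' = "class_darts (Y @ [q])"
  let ?fam = "class_darts Y ` classes Y - {{}}" and ?fam' = "class_darts (Y @ [q]) ` classes (Y @ [q]) - {{}}"
  have Y: "set Y \<subseteq> set X" and Yq: "set (Y @ [q]) \<subseteq> set X" using X q by auto
  obtain Es where card: "\<And>C. C \<in> classes Y \<Longrightarrow> class_darts Y C = {} \<or> card (class_darts Y C) = 2"
    and Es: "realizes Es (?fam)"
    and sum: "\<kappa> ^ card (circle_classes []) * net_sum k l W X Es0 \<Phi> =
       \<kappa> ^ card (circle_classes Y) * net_sum k l W ((d, d') # Z) Es \<Phi>"
    using snoc.IH[OF X] unfolding \<kappa>_def by blast
  define Ca where "Ca = glue_rel (edge_pairs Y) `` {edge_of d}"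
  define Cb where "Cb = glue_rel (edge_pairs Y) `` {edge_of d'}"
  have ab: "edge_of d \<in> E" "edge_of d' \<in> E" "d \<in> darts (edge_of d)" "d' \<in> darts (edge_of d')"
    using edge_of_in X by auto
  have Cab: "Ca \<in> classes Y" "Cb \<in> classes Y"
    using ab by (auto simp: classes_def Ca_def Cb_def intro: quotientI)
  have cls: "classes (Y @ [q]) = insert (Ca \<union> Cb) (classes Y - {Ca, Cb})"
    using glue_rel_snoc_quotient[OF ab(1,2), of "edge_pairs Y"]
    by (simp add: classes_def edge_pairs_def q Ca_def Cb_def)
  have distX: "distinct (flat Y @ d # d' # flat Z)" using WX(1) X by simp
  have d_in: "d \<in> class_darts Y Ca" "d' \<in> class_darts Y Cb"
    using ab distX by (auto simp: class_darts_def Ca_def Cb_def glue_rel_def)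
  have darts': "?cd' C = class_darts Y C - {d, d'}" for C
    by (auto simp: class_darts_def q)
  have other: "?cd' C = class_darts Y C" if "C \<in> classes Y - {Ca, Cb}" for C
    using class_darts_disjoint[OF Y, of C Ca] class_darts_disjoint[OF Y, of C Cb] that Cab d_in
    unfolding darts' by blast
  have Un: "class_darts Y (Ca \<union> Cb) = class_darts Y Ca \<union> class_darts Y Cb"
    by (auto simp: class_darts_def)
  have circ: "circle_classes Y = {C \<in> classes Y - {Ca, Cb}. class_darts Y C = {}}"
    using d_in by (auto simp: circle_classes_def)
  have W_mset: "mset (W @ flat Z) = mset (flat Es')"
    if "distinct (flat Es')" "set (flat Es') = \<Union> (darts ` E) - set (flat (Y @ [q]))" for Es'
  proof -
    have "distinct (W @ flat Z)" using WX(1) X by auto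
    moreover have "set (W @ flat Z) = \<Union> (darts ` E) - set (flat (Y @ [q]))"
      using WX X q by auto
    ultimately show ?thesis using that set_eq_iff_mset_eq_distinct by metis
  qed
  have \<Phi>dd: "\<Phi> (c(d := a, d' := b)) = \<Phi> c" for c a b
    using \<Phi>[of d'] \<Phi>[of d] X by simp
  have flat_set: "set (flat Es') = \<Union> (darts ` E) - set (flat (Y @ [q]))"
    if "realizes Es' (?fam')" for Es'
  proof -
    have "set (flat Es') = \<Union> (?fam')"
      using that by (auto simp: realizes_def set_flat)
    also have "\<dots> = \<Union> (?cd' ` classes (Y @ [q]))" by blast
    finally show ?thesis using Union_class_darts[OF Yq] by simp
  qed
  show ?case
  proof (cases "Ca = Cb")
    case True
    \<comment> \<open>Both label darts belong to one class, so they are its two ends, and gluing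
      them leaves no end: a new circle.\<close>
    have Ca2: "class_darts Y Ca = {d', d}"
    proof -
      have "card (class_darts Y Ca) = 2" using card[OF Cab(1)] d_in by auto
      then show ?thesis using d_in True distX by (auto simp: card_2_iff)
    qed
    have ne: "class_darts Y C \<noteq> {d', d}" if "C \<in> classes Y - {Ca}" for C
      using class_darts_disjoint[OF Y, of C Ca] that Cab Ca2 by auto
    have fam: "?fam' = ?fam - {{d', d}}"
    proof -
      define N where "N = class_darts Y ` (classes Y - {Ca})"
      have c: "classes (Y @ [q]) = insert Ca (classes Y - {Ca})" using cls True by simp
      have "?cd' Ca = {}" using Ca2 by (auto simp: darts')
      moreover have "?cd' ` (classes Y - {Ca}) = N"
        unfolding N_def using other True by (intro image_cong) auto
      ultimately have 1: "?cd' ` classes (Y @ [q]) = insert {} N"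
        unfolding c image_insert by simp
      have 2: "class_darts Y ` classes Y = insert {d', d} N"
        using Ca2 Cab(1) unfolding N_def by (metis image_insert insert_Diff)
      have "{d', d} \<notin> N" using ne by (auto simp: N_def)
      then show ?thesis unfolding 1 2 by auto
    qed
    have "{d', d} \<in> ?fam" using Ca2 Cab(1) by auto
    moreover have "d' \<noteq> d" using distX by auto
    ultimately obtain Es' where Es': "realizes ((d', d) # Es') (?fam)"
      "realizes Es' (?fam')"
      using realizes_front[OF Es] unfolding fam by blast
    have "net_sum k l W ((d, d') # Z) Es \<Phi> = net_sum k l W ((d, d') # Z) ((d', d) # Es') \<Phi>"
      by (rule net_sum_realizes[OF Es Es'(1)])
    also have "\<dots> = \<kappa> * net_sum k l W Z Es' \<Phi>"
      unfolding \<kappa>_def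
    proof (rule net_sum_loop)
      show "distinct (d # d' # flat Es')" using Es'(1) by (auto simp: realizes_def)
      show "mset (W @ flat Z) = mset (flat Es')"
        using W_mset[OF _ flat_set[OF Es'(2)]] Es'(2) by (simp add: realizes_def)
    qed (rule \<Phi>dd)
    finally have step: "net_sum k l W ((d, d') # Z) Es \<Phi> = \<kappa> * net_sum k l W Z Es' \<Phi>" .
    have "circle_classes (Y @ [q]) = insert Ca (circle_classes Y)"
    proof -
      have "classes (Y @ [q]) = insert Ca (classes Y - {Ca})" using cls True by simp
      moreover have "?cd' Ca = {}" using Ca2 by (auto simp: darts')
      ultimately have "circle_classes (Y @ [q]) = insert Ca {C \<in> classes Y - {Ca}. ?cd' C = {}}"
        unfolding circle_classes_def by (simp only:) blast
      also have "{C \<in> classes Y - {Ca}. ?cd' C = {}} = circle_classes Y"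
        unfolding circ True[symmetric] using other True by auto
      finally show ?thesis .
    qed
    moreover have "Ca \<notin> circle_classes Y" using d_in by (auto simp: circle_classes_def)
    moreover have "finite (circle_classes Y)" using finite_classes by (simp add: circle_classes_def)
    ultimately have "card (circle_classes (Y @ [q])) = Suc (card (circle_classes Y))" by simp
    then have "\<kappa> ^ card (circle_classes []) * net_sum k l W X Es0 \<Phi> =
       \<kappa> ^ card (circle_classes (Y @ [q])) * net_sum k l W Z Es' \<Phi>"
      unfolding sum step by (simp add: mult_ac)
    moreover have "?cd' C = {} \<or> card (?cd' C) = 2"
      if C: "C \<in> classes (Y @ [q])" for C
    proof (cases "C = Ca")
      case True
      then show ?thesis using Ca2 by (simp add: darts')
    next
      case False
      then have "C \<in> classes Y - {Ca, Cb}" using C cls True by auto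
      then show ?thesis using other card by auto
    qed
    ultimately show ?thesis using Es'(2) unfolding \<kappa>_def by blast
  next
    case False
    have partner: "\<exists>y. A = {x, y} \<and> y \<noteq> x" if "card A = 2" "x \<in> A" for x :: 'd and A
      using that by (fastforce simp: card_2_iff)
    \<comment> \<open>Here y and z are the far ends of the two glued classes; they become the ends
      of the merged class.\<close>
    obtain y where "class_darts Y Ca = {d, y}" "y \<noteq> d"
      using card[OF Cab(1)] d_in(1) partner by blast
    then have y: "class_darts Y Ca = {y, d}" "y \<noteq> d" by auto
    obtain z where z: "class_darts Y Cb = {d', z}" "z \<noteq> d'"
      using card[OF Cab(2)] d_in(2) partner by blast
    have disj: "{y, d} \<inter> {d', z} = {}"
      using class_darts_disjoint[OF Y Cab False] y z by simp
    define N where "N = class_darts Y ` (classes Y - {Ca, Cb}) - {{}}"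
    have famY: "?fam = insert {y, d} (insert {d', z} N)"
    proof -
      have "classes Y = insert Ca (insert Cb (classes Y - {Ca, Cb}))" using Cab by blast
      from arg_cong[OF this, of "image (class_darts Y)"]
      have "class_darts Y ` classes Y = insert {y, d} (insert {d', z} (class_darts Y ` (classes Y - {Ca, Cb})))"
        by (simp only: image_insert y(1) z(1))
      then show ?thesis by (simp add: N_def insert_Diff_if)
    qed
    have notN: "Q \<inter> {y, d, d', z} = {}" if "Q \<in> N" for Q
      using that class_darts_disjoint[OF Y _ Cab(1)] class_darts_disjoint[OF Y _ Cab(2)] y z
      unfolding N_def by fastforce
    have merged: "?cd' (Ca \<union> Cb) = {y, z}"
      using y z disj unfolding darts' Un by auto
    have fam: "?fam' = insert {y, z} N"
    proof -
      have "?cd' ` (classes Y - {Ca, Cb}) = class_darts Y ` (classes Y - {Ca, Cb})"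
        using other by (intro image_cong) auto
      then show ?thesis unfolding cls N_def using merged by auto
    qed
    obtain Es1 where Es1: "realizes ((y, d) # Es1) (insert {y, d} (insert {d', z} N))"
      "realizes Es1 (insert {y, d} (insert {d', z} N) - {{y, d}})"
      using realizes_front[OF Es[unfolded famY], of y d] y by blast
    have "insert {y, d} (insert {d', z} N) - {{y, d}} = insert {d', z} N"
      using disj notN by fastforce
    then obtain Es' where Es2: "realizes ((d', z) # Es') (insert {d', z} N)"
      "realizes Es' (insert {d', z} N - {{d', z}})"
      using realizes_front[OF Es1(2), of d' z] z by auto
    have "insert {d', z} N - {{d', z}} = N" using notN by fastforce
    then have Es': "realizes Es' N" using Es2 by simp
    have r1: "realizes ((y, d) # (d', z) # Es') (?fam)"
      unfolding famY using y disj notN by (intro realizes_Cons Es2(1)) auto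
    have r2: "realizes ((y, z) # Es') (?fam')"
      unfolding fam using disj notN by (intro realizes_Cons Es') auto
    have "net_sum k l W ((d, d') # Z) Es \<Phi> = net_sum k l W ((d, d') # Z) ((y, d) # (d', z) # Es') \<Phi>"
      by (rule net_sum_realizes[OF Es r1])
    also have "\<dots> = net_sum k l W Z ((y, z) # Es') \<Phi>"
    proof (rule net_sum_join)
      show "distinct (y # d # d' # z # flat Es')" using r1 by (simp add: realizes_def)
      show "mset (W @ flat Z) = mset (y # z # flat Es')"
        using W_mset[OF _ flat_set[OF r2]] r2 by (simp add: realizes_def)
    qed (rule \<Phi>dd)
    finally have step: "net_sum k l W ((d, d') # Z) Es \<Phi> = net_sum k l W Z ((y, z) # Es') \<Phi>" .
    have "circle_classes (Y @ [q]) = circle_classes Y"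
    proof -
      have "circle_classes (Y @ [q]) = {C \<in> classes Y - {Ca, Cb}. ?cd' C = {}}"
      proof -
        have ne: "?cd' (Ca \<union> Cb) \<noteq> {}" unfolding merged by (rule insert_not_empty)
        have "{C \<in> insert U M. P C} = {C \<in> M. P C}" if "\<not> P U" for U M and P :: "'e set \<Rightarrow> bool"
          using that by blast
        from this[of "\<lambda>C. ?cd' C = {}", OF ne]
        show ?thesis unfolding circle_classes_def cls .
      qed
      also have "\<dots> = circle_classes Y"
        unfolding circ by (intro Collect_cong conj_cong refl) (simp add: other)
      finally show ?thesis .
    qed
    then have "\<kappa> ^ card (circle_classes []) * net_sum k l W X Es0 \<Phi> =
       \<kappa> ^ card (circle_classes (Y @ [q])) * net_sum k l W Z ((y, z) # Es') \<Phi>"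
      unfolding sum step by simp
    moreover have "?cd' C = {} \<or> card (?cd' C) = 2"
      if C: "C \<in> classes (Y @ [q])" for C
    proof (cases "C = Ca \<union> Cb")
      case True
      then show ?thesis using merged disj by auto
    next
      case False
      then have "C \<in> classes Y - {Ca, Cb}" using C cls by blast
      then show ?thesis using other card by auto
    qed
    ultimately show ?thesis using r2 unfolding \<kappa>_def by blast
  qed
qed

end

section \<open>Halves of a glued graph\<close>

text \<open>One choice orders the endpoints of all edges; the boolean names an end even where both
  endpoints coincide.\<close>

definition endpoint :: "(nat, nat) mgraph \<Rightarrow> nat \<Rightarrow> bool \<Rightarrow> nat" where
  "endpoint G = (SOME u. \<forall>e\<in>edges G. ends G e \<noteq> {#} \<longrightarrow> ends G e = {#u e False, u e True#})"

lemma ends_endpoint: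
  assumes G: "wf_mgraph G" and e: "e \<in> edges G" "ends G e \<noteq> {#}"
  shows "ends G e = {#endpoint G e False, endpoint G e True#}"
proof -
  have "\<exists>q. ends G e = {#fst q, snd q#}" if "e \<in> edges G" "ends G e \<noteq> {#}" for e
  proof -
    have "size (ends G e) = Suc (Suc 0)" using G that by (auto simp: wf_mgraph_def)
    then obtain x N where N: "ends G e = add_mset x N" "size N = 1"
      using size_eq_Suc_imp_eq_union by fastforce
    from size_1_singleton_mset[OF N(2)] obtain y where "N = {#y#}" by blast
    with N have "ends G e = {#x, y#}" by simp
    then show ?thesis by (intro exI[of _ "(x, y)"]) simp
  qed
  then have "\<forall>e\<in>{e \<in> edges G. ends G e \<noteq> {#}}. \<exists>q. ends G e = {#fst q, snd q#}" by simp
  from bchoice[OF this] obtain q where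
    q: "\<forall>e\<in>{e \<in> edges G. ends G e \<noteq> {#}}. ends G e = {#fst (q e), snd (q e)#}" by blast
  have "\<exists>u. \<forall>e\<in>edges G. ends G e \<noteq> {#} \<longrightarrow> ends G e = {#u e False, u e True#}"
    by (rule exI[of _ "\<lambda>e b. if b then snd (q e) else fst (q e)"]) (use q in auto)
  from someI_ex[OF this] show ?thesis using e unfolding endpoint_def by blast
qed

text \<open>With \<open>Inl\<close> or \<open>Inr\<close> for \<open>\<iota>\<close> the darts of
  the two fragments become disjoint sets of natural numbers inside one linear order, while the data
  of each fragment are defined without the other.\<close>

definition dart :: "(nat \<Rightarrow> nat + nat) \<Rightarrow> nat \<Rightarrow> bool \<Rightarrow> nat" where
  "dart \<iota> e b = to_nat (\<iota> e, b)"

definition proper_edges :: "(nat, nat) mgraph \<Rightarrow> nat list" where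
  "proper_edges G = sorted_list_of_set {e \<in> edges G. ends G e \<noteq> {#}}"

definition half_darts :: "(nat \<Rightarrow> nat + nat) \<Rightarrow> (nat, nat) mgraph \<Rightarrow> nat \<Rightarrow> nat list" where
  "half_darts \<iota> G v =
     concat (map (\<lambda>e. map (dart \<iota> e) (filter (\<lambda>b. endpoint G e b = v) [False, True])) (proper_edges G))"

definition free_verts :: "nat \<Rightarrow> fragment \<Rightarrow> nat list" where
  "free_verts t F = sorted_list_of_set (verts (graph_of F) - label F ` {1..t})"

definition half_word :: "(nat \<Rightarrow> nat + nat) \<Rightarrow> nat \<Rightarrow> fragment \<Rightarrow> nat list" where
  "half_word \<iota> t F = concat (map (half_darts \<iota> (graph_of F)) (free_verts t F))"

text \<open>A labeled vertex has degree one, so \<open>hd\<close> picks its only dart.\<close>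

definition half_labels :: "(nat \<Rightarrow> nat + nat) \<Rightarrow> nat \<Rightarrow> fragment \<Rightarrow> nat list" where
  "half_labels \<iota> t F = map (\<lambda>i. hd (half_darts \<iota> (graph_of F) (label F i))) [1..<Suc t]"

definition half_edges :: "(nat \<Rightarrow> nat + nat) \<Rightarrow> fragment \<Rightarrow> (nat \<times> nat) list" where
  "half_edges \<iota> F = map (\<lambda>e. (dart \<iota> e False, dart \<iota> e True)) (proper_edges (graph_of F))"

definition half_value ::
    "(mixed_alg \<Rightarrow> complex) \<Rightarrow> (nat \<Rightarrow> nat + nat) \<Rightarrow> nat \<Rightarrow> fragment \<Rightarrow> (nat \<Rightarrow> color) \<Rightarrow> complex" where
  "half_value h \<iota> t F c =
     (\<Prod>v\<leftarrow>free_verts t F. vertex_value h (map c (half_darts \<iota> (graph_of F) v)))"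

definition num_circles :: "('v, 'e) mgraph \<Rightarrow> nat" where
  "num_circles G = card {e \<in> edges G. ends G e = {#}}"

text \<open>The circles of a fragment survive every gluing. Their factor is put here, so that the
  two sides together account for the circles present before gluing.\<close>

definition amplitude :: "nat \<Rightarrow> nat \<Rightarrow> (mixed_alg \<Rightarrow> complex) \<Rightarrow> (nat \<Rightarrow> nat + nat) \<Rightarrow> nat \<Rightarrow> fragment \<Rightarrow>
    color list \<Rightarrow> complex" where
  "amplitude k l h \<iota> t F \<chi> = (of_nat k - 2 * of_nat l) ^ num_circles (graph_of F) *
     half_sum k l (half_word \<iota> t F) (half_labels \<iota> t F) (half_edges \<iota> F) (half_value h \<iota> t F) \<chi>"

definition edge_darts :: "(nat \<Rightarrow> nat + nat) \<Rightarrow> (nat, nat) mgraph \<Rightarrow> nat \<Rightarrow> nat set" where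
  "edge_darts \<iota> G e = (if ends G e = {#} then {} else {dart \<iota> e False, dart \<iota> e True})"

lemma sum_replicate_size: "size (\<Sum>e\<in>D. replicate_mset (f e) e) = (\<Sum>e\<in>D. f e)"
  by (simp add: size_multiset_sum)

locale half =
  fixes t :: nat and F :: fragment and \<iota> :: "nat \<Rightarrow> nat + nat"
  assumes F: "F \<in> fragments t" and \<iota>: "inj \<iota>"
begin

abbreviation G where "G \<equiv> graph_of F"

lemma wf: "wf_mgraph G" and label_inj: "inj_on (label F) {1..t}"
  and label_verts: "i \<in> {1..t} \<Longrightarrow> label F i \<in> verts G"
  and label_degree: "i \<in> {1..t} \<Longrightarrow> degree_in G (edges G) (label F i) = 1"
  using F by (auto simp: fragments_def)

lemma fin: "finite (verts G)" "finite (edges G)"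
  using wf by (auto simp: wf_mgraph_def)

lemma proper_edges: "set (proper_edges G) = {e \<in> edges G. ends G e \<noteq> {#}}" "distinct (proper_edges G)"
  using fin by (auto simp: proper_edges_def)

lemma free_verts: "set (free_verts t F) = verts G - label F ` {1..t}" "distinct (free_verts t F)"
  using fin by (auto simp: free_verts_def)

lemma dart_eq: "dart \<iota> e b = dart \<iota> e' b' \<longleftrightarrow> e = e' \<and> b = b'"
  using \<iota> by (auto simp: dart_def dest: injD)

lemma endpoint_verts: "e \<in> edges G \<Longrightarrow> ends G e \<noteq> {#} \<Longrightarrow> endpoint G e b \<in> verts G"
  using ends_endpoint[OF wf, of e] wf by (cases b) (auto simp: wf_mgraph_def)

lemma set_half_darts:
  "set (half_darts \<iota> G v) = {dart \<iota> e b | e b. e \<in> edges G \<and> ends G e \<noteq> {#} \<and> endpoint G e b = v}"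
proof -
  have "set (filter (\<lambda>b. endpoint G e b = v) [False, True]) = {b. endpoint G e b = v}" for e
    by (auto; metis (full_types))
  then have "set (half_darts \<iota> G v) =
    (\<Union>e\<in>{e \<in> edges G. ends G e \<noteq> {#}}. dart \<iota> e ` {b. endpoint G e b = v})"
    unfolding half_darts_def set_concat set_map image_image proper_edges(1) by simp
  then show ?thesis by blast
qed

lemma distinct_half_darts: "distinct vs \<Longrightarrow> distinct (concat (map (half_darts \<iota> G) vs))"
proof (induction vs)
  case (Cons v vs)
  have "distinct (concat (map (\<lambda>e. map (dart \<iota> e) (filter (\<lambda>b. endpoint G e b = v) [False, True])) es))"
    if "distinct es" for es
    using that by (induction es) (auto simp: dart_eq distinct_map inj_on_def)
  then have "distinct (half_darts \<iota> G v)" unfolding half_darts_def using proper_edges(2) by blast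
  moreover have "set (half_darts \<iota> G v) \<inter> set (concat (map (half_darts \<iota> G) vs)) = {}"
    using Cons.prems by (auto simp: set_half_darts dart_eq)
  ultimately show ?case using Cons by simp
qed simp

lemma length_half_darts: "length (half_darts \<iota> G v) = degree_in G (edges G) v"
proof -
  have "degree_in G (edges G) v = (\<Sum>e\<in>edges G. count (ends G e) v)"
    by (simp add: degree_in_def incident_edges_def sum_replicate_size)
  also have "\<dots> = (\<Sum>e\<in>set (proper_edges G). count (ends G e) v)"
    using fin by (intro sum.mono_neutral_right) (auto simp: proper_edges)
  also have "\<dots> = (\<Sum>e\<leftarrow>proper_edges G. count (ends G e) v)"
    using proper_edges(2) by (simp add: sum_list_distinct_conv_sum_set)
  also have "\<dots> = (\<Sum>e\<leftarrow>proper_edges G. length (filter (\<lambda>b. endpoint G e b = v) [False, True]))"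
  proof (intro arg_cong[where f = sum_list] map_cong refl)
    fix e assume "e \<in> set (proper_edges G)"
    then have "ends G e = {#endpoint G e False, endpoint G e True#}"
      using ends_endpoint[OF wf] by (simp add: proper_edges)
    then show "count (ends G e) v = length (filter (\<lambda>b. endpoint G e b = v) [False, True])"
      by simp
  qed
  also have "\<dots> = length (half_darts \<iota> G v)"
    by (simp add: half_darts_def length_concat o_def)
  finally show ?thesis ..
qed

lemma half_darts_label: "i \<in> {1..t} \<Longrightarrow> half_darts \<iota> G (label F i) = [hd (half_darts \<iota> G (label F i))]"
  using length_half_darts[of "label F i"] label_degree[of i]
  by (cases "half_darts \<iota> G (label F i)") auto

lemma half_word_labels:
  "half_word \<iota> t F @ half_labels \<iota> t F =
     concat (map (half_darts \<iota> G) (free_verts t F @ map (label F) [1..<Suc t]))"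
proof -
  have "concat (map (half_darts \<iota> G) (map (label F) is)) = map (\<lambda>i. hd (half_darts \<iota> G (label F i))) is"
    if "set is \<subseteq> {1..t}" for "is"
    using that half_darts_label by (induction "is") auto
  moreover have "set [1..<Suc t] \<subseteq> {1..t}" by auto
  ultimately show ?thesis
    by (simp only: half_word_def half_labels_def map_append concat_append)
qed

definition half_set where "half_set = {dart \<iota> e b | e b. e \<in> edges G \<and> ends G e \<noteq> {#}}"

lemma half_word_labels_set:
  "distinct (half_word \<iota> t F @ half_labels \<iota> t F)" "set (half_word \<iota> t F @ half_labels \<iota> t F) = half_set"
proof -
  have "distinct (free_verts t F @ map (label F) [1..<Suc t])"
    using free_verts label_inj by (auto simp: distinct_map atLeastLessThanSuc_atLeastAtMost simp del: upt_Suc)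
  then show "distinct (half_word \<iota> t F @ half_labels \<iota> t F)"
    unfolding half_word_labels by (rule distinct_half_darts)
  have "set (free_verts t F @ map (label F) [1..<Suc t]) = verts G"
    using free_verts(1) label_verts by (auto simp: atLeastLessThanSuc_atLeastAtMost simp del: upt_Suc)
  then have "set (half_word \<iota> t F @ half_labels \<iota> t F) = (\<Union>v\<in>verts G. set (half_darts \<iota> G v))"
    unfolding half_word_labels set_concat set_map image_image by simp
  then show "set (half_word \<iota> t F @ half_labels \<iota> t F) = half_set"
    using endpoint_verts unfolding set_half_darts half_set_def by blast
qed

lemma half_edges_set: "distinct (flat (half_edges \<iota> F))" "set (flat (half_edges \<iota> F)) = half_set"
  "(\<lambda>(y, z). {y, z}) ` set (half_edges \<iota> F) = edge_darts \<iota> G ` edges G - {{}}"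
proof -
  have "distinct (flat (map (\<lambda>e. (dart \<iota> e False, dart \<iota> e True)) es))" if "distinct es" for es
    using that by (induction es) (auto simp: set_flat dart_eq)
  then show "distinct (flat (half_edges \<iota> F))" using proper_edges(2) by (simp add: half_edges_def)
  show "set (flat (half_edges \<iota> F)) = half_set"
  proof -
    have "dart \<iota> e b = dart \<iota> e False \<or> dart \<iota> e b = dart \<iota> e True" for e b by (cases b) auto
    then show ?thesis
      by (auto simp: half_edges_def set_flat proper_edges half_set_def)
  qed
  show "(\<lambda>(y, z). {y, z}) ` set (half_edges \<iota> F) = edge_darts \<iota> G ` edges G - {{}}"
    by (auto simp: half_edges_def proper_edges edge_darts_def image_iff)
qed

lemma half_set_edge_darts: "half_set = \<Union> (edge_darts \<iota> G ` edges G)"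
proof -
  have "{dart \<iota> e False, dart \<iota> e True} = {dart \<iota> e b | b. True}" for e
    by (auto, metis (full_types))
  then show ?thesis by (auto simp: half_set_def edge_darts_def split: if_splits)
qed

lemma length_half_labels: "length (half_labels \<iota> t F) = t"
  by (simp add: half_labels_def)

lemma half_value_cong:
  assumes "\<And>d. d \<in> set (half_word \<iota> t F) \<Longrightarrow> c d = c' d"
  shows "half_value h \<iota> t F c = half_value h \<iota> t F c'"
proof -
  have "map c (half_darts \<iota> G v) = map c' (half_darts \<iota> G v)" if "v \<in> set (free_verts t F)" for v
    using that assms by (intro map_cong) (auto simp: half_word_def)
  then show ?thesis
    unfolding half_value_def by (intro arg_cong[where f = prod_list] map_cong refl) (simp only:)
qed

lemma half_value_even:
  assumes "half_value h \<iota> t F c \<noteq> 0"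
  shows "even (length (filter (\<lambda>d. \<not> isl (c d)) (half_word \<iota> t F)))"
proof -
  have "even (length (filter (\<lambda>d. \<not> isl (c d)) (half_darts \<iota> G v)))" if "v \<in> set (free_verts t F)" for v
  proof -
    have "vertex_value h (map c (half_darts \<iota> G v)) \<noteq> 0"
      using assms that by (auto simp: half_value_def prod_list_zero_iff)
    then show ?thesis by (auto simp: vertex_value_def odd_colors_def filter_map o_def split: if_splits)
  qed
  then have "even (length (filter (\<lambda>d. \<not> isl (c d)) (concat (map (half_darts \<iota> G) vs))))"
    if "set vs \<subseteq> set (free_verts t F)" for vs
    using that by (induction vs) auto
  then show ?thesis by (simp add: half_word_def)
qed

text \<open>Degree one means one dart and a single incident edge. This links the label darts to
  \<open>glued_pairs\<close>, which speaks of edges that contain a labeled vertex.\<close>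

lemma label_edge:
  assumes "i \<in> {1..t}"
  obtains e b where "e \<in> edges G" "ends G e \<noteq> {#}" "hd (half_darts \<iota> G (label F i)) = dart \<iota> e b"
    "\<And>e'. e' \<in> edges G \<Longrightarrow> label F i \<in># ends G e' \<longleftrightarrow> e' = e"
proof -
  let ?x = "hd (half_darts \<iota> G (label F i))"
  have set: "set (half_darts \<iota> G (label F i)) = {?x}"
    using half_darts_label[OF assms] by (metis empty_set list.simps(15))
  then obtain e b where e: "e \<in> edges G" "ends G e \<noteq> {#}" "?x = dart \<iota> e b" "endpoint G e b = label F i"
    using set_half_darts[of "label F i"] by blast
  have iff: "label F i \<in># ends G e' \<longleftrightarrow> e' = e" if e': "e' \<in> edges G" for e'
  proof
    assume l: "label F i \<in># ends G e'"
    then have ne: "ends G e' \<noteq> {#}" by auto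
    then obtain b' where "endpoint G e' b' = label F i"
      using ends_endpoint[OF wf e'] l by auto
    then have "dart \<iota> e' b' \<in> {?x}" using e' ne set set_half_darts[of "label F i"] by blast
    then show "e' = e" using e(3) by (simp add: dart_eq)
  next
    assume "e' = e"
    then show "label F i \<in># ends G e'"
      using ends_endpoint[OF wf e(1,2)] e(4) by (cases b) auto
  qed
  show thesis by (rule that[OF e(1-3) iff])
qed

end

section \<open>Rank of the connection matrix\<close>

lemma mset_flat_zip:
  "length us = length vs \<Longrightarrow> mset (flat (zip us vs)) = mset us + mset vs"
  by (induction us vs rule: list_induct2) auto

lemma dart_Inl_Inr [simp]: "dart Inl e b \<noteq> dart Inr e' b'" "dart Inr e' b' \<noteq> dart Inl e b"
  by (simp_all add: dart_def)

lemma sum_mset_set_Union: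
  assumes "finite C" "\<And>x. x \<in> C \<Longrightarrow> finite (dk x)"
    and "\<And>x y. x \<in> C \<Longrightarrow> y \<in> C \<Longrightarrow> x \<noteq> y \<Longrightarrow> dk x \<inter> dk y = {}"
  shows "(\<Sum>x\<in>C. image_mset f (mset_set (dk x))) = image_mset f (mset_set (\<Union> (dk ` C)))"
  using assms
proof (induction C rule: finite_induct)
  case (insert x C)
  have "dk x \<inter> \<Union> (dk ` C) = {}" using insert.prems(2)[of x] insert.hyps(2) by fastforce
  moreover have "finite (\<Union> (dk ` C))" using insert by auto
  ultimately show ?case using insert by (simp add: mset_set_Union)
qed simp

text \<open>The partition function of the glued graph is a network sum without labels. The gluing
  steps are undone to restore all labels, and the resulting sum is cut.\<close>

lemma connection_matrix_factorization:
  assumes h: "edge_coloring_model k l h" and F1: "F1 \<in> fragments t" and F2: "F2 \<in> fragments t"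
  shows "connection_matrix (mixed_partition_function k l h) t F1 F2 =
    (\<Sum>\<chi> | set \<chi> \<subseteq> colors k l \<and> length \<chi> = t. amplitude k l h Inl t F1 \<chi> *
       (\<Sum>\<chi>' | set \<chi>' \<subseteq> colors k l \<and> length \<chi>' = t.
          pairing_coeff l \<chi> \<chi>' * amplitude k l h Inr t F2 \<chi>'))"
proof -
  interpret H1: half t F1 Inl by unfold_locales (auto simp: F1)
  interpret H2: half t F2 Inr by unfold_locales (auto simp: F2)
  let ?U = "disjoint_union H1.G H2.G"
  let ?E = "edges ?U"
  define dk where "dk = case_sum (edge_darts Inl H1.G) (edge_darts Inr H2.G)"
  define edge_of where "edge_of d = fst (from_nat d :: (nat + nat) \<times> bool)" for d :: nat
  define pos where "pos d = (case from_nat d of (Inl e, b) \<Rightarrow> Inl (endpoint H1.G e b)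
     | (Inr e, b) \<Rightarrow> Inr (endpoint H2.G e b))" for d :: nat
  let ?X = "zip (half_labels Inl t F1) (half_labels Inr t F2)"
  let ?W = "half_word Inl t F1 @ half_word Inr t F2"
  let ?Es0 = "half_edges Inl F1 @ half_edges Inr F2"
  let ?\<Phi> = "\<lambda>c. half_value h Inl t F1 c * half_value h Inr t F2 c"
  define \<kappa> where "\<kappa> = (of_nat k - 2 * of_nat l :: complex)"
  have E: "?E = Inl ` edges H1.G \<union> Inr ` edges H2.G"
    by (auto simp: disjoint_union_def)
  have pos_simps: "pos (dart Inl e b) = Inl (endpoint H1.G e b)" "pos (dart Inr e b) = Inr (endpoint H2.G e b)"
    and edge_of_simps: "edge_of (dart Inl e b) = Inl e" "edge_of (dart Inr e b) = Inr e" for e b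
    by (simp_all add: pos_def edge_of_def dart_def)
  have len: "length (half_labels Inl t F1) = length (half_labels Inr t F2)"
    by (simp add: H1.length_half_labels H2.length_half_labels)
  have dkU: "\<Union> (dk ` ?E) = H1.half_set \<union> H2.half_set"
    by (simp add: E dk_def image_Un image_image H1.half_set_edge_darts H2.half_set_edge_darts)
  have halves: "H1.half_set \<inter> H2.half_set = {}"
    by (auto simp: H1.half_set_def H2.half_set_def)
  have mset_WX: "mset (?W @ flat ?X) =
    mset ((half_word Inl t F1 @ half_labels Inl t F1) @ (half_word Inr t F2 @ half_labels Inr t F2))"
    by (simp add: mset_flat_zip[OF len])
  have dist2: "distinct ((half_word Inl t F1 @ half_labels Inl t F1) @ (half_word Inr t F2 @ half_labels Inr t F2))"
    using H1.half_word_labels_set H2.half_word_labels_set halves by (subst distinct_append) blast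
  have dist_WX: "distinct (?W @ flat ?X)"
    using dist2 mset_eq_imp_distinct_iff[OF mset_WX] by blast
  have set_WX: "set (?W @ flat ?X) = \<Union> (dk ` ?E)"
    unfolding mset_eq_setD[OF mset_WX] set_append[of "_ @ _" "_ @ _"]
      H1.half_word_labels_set(2) H2.half_word_labels_set(2) dkU ..
  interpret gl: gluing ?E dk edge_of ?X ?W ?\<Phi> ?Es0 k l
  proof
    show "finite ?E" using H1.fin H2.fin by (simp add: E)
    show "dk e = {} \<or> card (dk e) = 2" for e
      by (cases e) (auto simp: dk_def edge_darts_def H1.dart_eq H2.dart_eq)
    show "edge_of d = e" if "d \<in> dk e" for e d
      using that by (cases e) (auto simp: dk_def edge_darts_def edge_of_simps split: if_splits)
    show "distinct (?W @ flat ?X)" by (rule dist_WX)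
    show "set (?W @ flat ?X) = \<Union> (dk ` ?E)" by (rule set_WX)
    show "?\<Phi> (c(d := a)) = ?\<Phi> c" if "d \<in> set (flat ?X)" for c d a
    proof -
      have "d \<notin> set ?W" using dist_WX that by auto
      then show ?thesis
        by (intro arg_cong2[where f = "(*)"] H1.half_value_cong H2.half_value_cong) auto
    qed
    have "distinct (flat ?Es0)"
      using H1.half_edges_set H2.half_edges_set halves by simp
    moreover have "(\<lambda>(y, z). {y, z}) ` set ?Es0 = dk ` ?E - {{}}"
      unfolding set_append image_Un H1.half_edges_set(3) H2.half_edges_set(3) E
      by (auto simp: dk_def image_image)
    ultimately show "realizes ?Es0 (dk ` ?E - {{}})" by (simp add: realizes_def)
  qed
  let ?G = "glue t F1 F2"
  let ?x1 = "\<lambda>i. hd (half_darts Inl H1.G (label F1 i))" and ?x2 = "\<lambda>i. hd (half_darts Inr H2.G (label F2 i))"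
  let ?p = "\<lambda>i. (edge_of (?x1 i), edge_of (?x2 i))"
  \<comment> \<open>With this equality the classes of the stepwise gluing are the edges of the glued
    graph.\<close>
  have pairs: "set (gl.edge_pairs ?X) = glued_pairs t F1 F2"
  proof -
    have "?X = map (\<lambda>i. (?x1 i, ?x2 i)) [1..<Suc t]"
      unfolding half_labels_def zip_map_map by (simp add: zip_same_conv_map del: upt_Suc)
    then have "set (gl.edge_pairs ?X) = ?p ` {1..t}"
      by (simp add: gl.edge_pairs_def atLeastLessThanSuc_atLeastAtMost image_image del: upt_Suc)
    also have "\<dots> = glued_pairs t F1 F2"
    proof (intro equalityI subsetI)
      fix p assume "p \<in> ?p ` {1..t}"
      then obtain i where i: "i \<in> {1..t}" and p: "p = ?p i" by blast
      obtain e1 b1 where e1: "e1 \<in> edges H1.G" "?x1 i = dart Inl e1 b1"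
        "label F1 i \<in># ends H1.G e1" by (rule H1.label_edge[OF i]) blast
      obtain e2 b2 where e2: "e2 \<in> edges H2.G" "?x2 i = dart Inr e2 b2"
        "label F2 i \<in># ends H2.G e2" by (rule H2.label_edge[OF i]) blast
      show "p \<in> glued_pairs t F1 F2"
        using e1 e2 i by (auto simp: p edge_of_simps glued_pairs_def)
    next
      fix p assume "p \<in> glued_pairs t F1 F2"
      then obtain e d i where p: "p = (Inl e, Inr d)" "e \<in> edges H1.G" "d \<in> edges H2.G" "i \<in> {1..t}"
        "label F1 i \<in># ends H1.G e" "label F2 i \<in># ends H2.G d"
        by (auto simp: glued_pairs_def)
      have "edge_of (?x1 i) = Inl e"
        by (rule H1.label_edge[OF p(4)]) (use p in \<open>auto simp: edge_of_simps\<close>)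
      moreover have "edge_of (?x2 i) = Inr d"
        by (rule H2.label_edge[OF p(4)]) (use p in \<open>auto simp: edge_of_simps\<close>)
      ultimately show "p \<in> ?p ` {1..t}"
        using p by force
    qed
    finally show ?thesis .
  qed
  have edges_G: "edges ?G = gl.classes ?X"
    by (simp add: glue_def Let_def gl.classes_def glue_rel_def pairs)
  let ?V = "Inl ` set (free_verts t F1) \<union> Inr ` set (free_verts t F2)"
  have verts_G: "verts ?G = ?V"
    by (auto simp: glue_def Let_def disjoint_union_def H1.free_verts H2.free_verts)
  have ends_G: "ends ?G C = filter_mset (\<lambda>v. v \<in> ?V) (\<Sum>e\<in>C. ends ?U e)" for C
    unfolding verts_G[symmetric] by (simp add: glue_def Let_def)
  have ends_U: "ends ?U x = image_mset pos (mset_set (dk x))" if x: "x \<in> ?E" for x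
  proof (cases x)
    case (Inl e)
    then have e: "e \<in> edges H1.G" using x E by auto
    show ?thesis
      using ends_endpoint[OF H1.wf e]
      by (auto simp: Inl dk_def edge_darts_def disjoint_union_def H1.dart_eq pos_simps)
  next
    case (Inr e)
    then have e: "e \<in> edges H2.G" using x E by auto
    show ?thesis
      using ends_endpoint[OF H2.wf e]
      by (auto simp: Inr dk_def edge_darts_def disjoint_union_def H2.dart_eq pos_simps)
  qed
  \<comment> \<open>The filter in \<open>glue\<close> that drops labeled endpoints thereby agrees
    with the removal of label darts from a class.\<close>
  have pos_W: "pos d \<in> ?V \<longleftrightarrow> d \<in> set ?W" if d: "d \<in> \<Union> (dk ` ?E)" for d
  proof -
    have "d \<in> H1.half_set \<or> d \<in> H2.half_set" using d dkU by blast
    then show ?thesis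
    proof
      assume "d \<in> H1.half_set"
      then obtain e b where "d = dart Inl e b" "e \<in> edges H1.G" "ends H1.G e \<noteq> {#}"
        by (auto simp: H1.half_set_def)
      then show ?thesis
        by (auto simp: pos_simps half_word_def H1.set_half_darts H2.set_half_darts H1.dart_eq)
    next
      assume "d \<in> H2.half_set"
      then obtain e b where "d = dart Inr e b" "e \<in> edges H2.G" "ends H2.G e \<noteq> {#}"
        by (auto simp: H2.half_set_def)
      then show ?thesis
        by (auto simp: pos_simps half_word_def H1.set_half_darts H2.set_half_darts H2.dart_eq)
    qed
  qed
  have W_flat: "d \<in> set ?W \<longleftrightarrow> d \<notin> set (flat ?X)" if "d \<in> \<Union> (dk ` ?E)" for d
    using that dist_WX set_WX by (auto simp only: distinct_append set_append)
  let ?dk = "gl.class_darts ?X"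
  have X_all: "set ?X \<subseteq> set ?X" ..
  have Un_dk: "\<Union> (?dk ` gl.classes ?X) = set ?W"
  proof -
    have "set ?W \<inter> set (flat ?X) = {}"
      using dist_WX distinct_append[of ?W "flat ?X"] by blast
    moreover have "\<Union> (dk ` ?E) = set ?W \<union> set (flat ?X)"
      using set_WX set_append[of ?W "flat ?X"] by (rule trans[OF sym])
    ultimately show ?thesis unfolding gl.Union_class_darts[OF X_all] by blast
  qed
  let ?vs = "map Inl (free_verts t F1) @ map Inr (free_verts t F2)"
  let ?L = "case_sum (half_darts Inl H1.G) (half_darts Inr H2.G)"
  from gl.net_sum_gluing[of ?X "[]"] obtain Es where
    dk_card: "\<forall>C\<in>gl.classes ?X. ?dk C = {} \<or> card (?dk C) = 2"
    and Es: "realizes Es (?dk ` gl.classes ?X - {{}})"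
    and glued: "\<kappa> ^ card (gl.circle_classes []) * net_sum k l ?W ?X ?Es0 ?\<Phi> =
      \<kappa> ^ card (gl.circle_classes ?X) * net_sum k l ?W [] Es ?\<Phi>"
    unfolding \<kappa>_def by auto
  interpret dg: dart_graph ?G ?dk pos ?vs ?L
  proof
    show "finite (edges ?G)" unfolding edges_G by (rule gl.finite_classes)
    show "?dk C = {} \<or> card (?dk C) = 2" if "C \<in> edges ?G" for C
      using that dk_card edges_G by blast
    show "?dk C \<inter> ?dk C' = {}" if "C \<in> edges ?G" "C' \<in> edges ?G" "C \<noteq> C'" for C C'
      using gl.class_darts_disjoint[OF X_all] that edges_G by blast
    show "ends ?G C = image_mset pos (mset_set (?dk C))" if C: "C \<in> edges ?G" for C
    proof -
      have sub: "C \<subseteq> ?E" using gl.class_subset[OF X_all] C edges_G by blast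
      have fin: "finite C" using sub gl.fin_E finite_subset by blast
      have find: "finite (dk x)" if "x \<in> ?E" for x
        using gl.darts_card[OF that] by (auto intro: card_ge_0_finite)
      have "(\<Sum>e\<in>C. ends ?U e) = (\<Sum>e\<in>C. image_mset pos (mset_set (dk e)))"
        using sub ends_U by (intro sum.cong) auto
      also have "\<dots> = image_mset pos (mset_set (\<Union> (dk ` C)))"
      proof (rule sum_mset_set_Union[OF fin])
        show "finite (dk x)" if "x \<in> C" for x using find sub that by blast
        show "dk x \<inter> dk y = {}" if "x \<in> C" "y \<in> C" "x \<noteq> y" for x y
          using gl.edge_of[of x] gl.edge_of[of y] sub that by blast
      qed
      finally have "ends ?G C = image_mset pos (filter_mset (\<lambda>d. pos d \<in> ?V) (mset_set (\<Union> (dk ` C))))"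
        unfolding ends_G by (simp add: filter_mset_image_mset del: Un_iff)
      also have "filter_mset (\<lambda>d. pos d \<in> ?V) (mset_set (\<Union> (dk ` C))) = mset_set {d \<in> \<Union> (dk ` C). pos d \<in> ?V}"
        using fin find sub by (intro filter_mset_mset_set) auto
      also have "{d \<in> \<Union> (dk ` C). pos d \<in> ?V} = ?dk C"
      proof -
        have "pos d \<in> ?V \<longleftrightarrow> d \<notin> set (flat ?X)" if "d \<in> \<Union> (dk ` C)" for d
        proof -
          have "d \<in> \<Union> (dk ` ?E)" using that sub by blast
          then show ?thesis using pos_W W_flat by blast
        qed
        then show ?thesis unfolding gl.class_darts_def by blast
      qed
      finally show ?thesis .
    qed
    show "pos d \<in> verts ?G" if "C \<in> edges ?G" "d \<in> ?dk C" for C d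
    proof -
      have "d \<in> set ?W" using that Un_dk edges_G by blast
      moreover from this have "d \<in> \<Union> (dk ` ?E)" using set_WX by auto
      ultimately show ?thesis using pos_W verts_G by blast
    qed
    show "distinct ?vs" using H1.free_verts H2.free_verts by (auto simp: distinct_map)
    show "set ?vs = verts ?G" by (simp add: verts_G)
    show "distinct (?L v)" if "v \<in> verts ?G" for v
      using H1.distinct_half_darts[of "[v']" for v'] H2.distinct_half_darts[of "[v']" for v']
      by (cases v) auto
    show "set (?L v) = {d \<in> \<Union> (?dk ` edges ?G). pos d = v}" if v: "v \<in> verts ?G" for v
      unfolding edges_G Un_dk
      using v unfolding verts_G
      by (cases v) (auto simp: half_word_def H1.set_half_darts H2.set_half_darts pos_simps
          H1.dart_eq H2.dart_eq)
  qed
  have word: "dg.word = ?W"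
    by (simp add: dg.word_def half_word_def o_def)
  have vp: "dg.vertex_prod h = ?\<Phi>"
    by (simp add: dg.vertex_prod_def half_value_def o_def fun_eq_iff)
  have "?dk ` dg.proper = ?dk ` gl.classes ?X - {{}}"
    by (auto simp: dg.proper_def edges_G)
  moreover have "dg.circles = gl.circle_classes ?X"
    by (simp add: dg.circles_def gl.circle_classes_def edges_G)
  ultimately have "mixed_partition_function k l h ?G = \<kappa> ^ card (gl.circle_classes ?X) * net_sum k l ?W [] Es ?\<Phi>"
    using dg.partition_function_net_sum[OF h, of Es] Es by (simp add: word vp \<kappa>_def)
  also have "\<dots> = \<kappa> ^ card (gl.circle_classes []) * net_sum k l ?W ?X ?Es0 ?\<Phi>"
    by (rule glued[symmetric])
  \<comment> \<open>Before any gluing the classes are single edges, and a class without darts is a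
    circle of one of the fragments.\<close>
  also have "card (gl.circle_classes []) = num_circles H1.G + num_circles H2.G"
  proof -
    have "gl.classes [] = (\<lambda>e. {e}) ` ?E"
      by (auto simp: gl.classes_def quotient_def gl.edge_pairs_def glue_rel_def)
    then have "gl.circle_classes [] = (\<lambda>e. {e}) ` {e \<in> ?E. dk e = {}}"
      by (auto simp: gl.circle_classes_def gl.class_darts_def)
    also have "{e \<in> ?E. dk e = {}} = {e \<in> edges H1.G. ends H1.G e = {#}} <+> {e \<in> edges H2.G. ends H2.G e = {#}}"
      by (auto simp: E dk_def edge_darts_def split: if_splits)
    finally have "card (gl.circle_classes []) =
        card ({e \<in> edges H1.G. ends H1.G e = {#}} <+> {e \<in> edges H2.G. ends H2.G e = {#}})"
      by (simp add: card_image)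
    then show ?thesis using H1.fin H2.fin by (simp add: card_Plus num_circles_def)
  qed
  also have "net_sum k l ?W ?X ?Es0 ?\<Phi> =
    (\<Sum>\<chi> | set \<chi> \<subseteq> colors k l \<and> length \<chi> = length (half_labels Inl t F1).
       half_sum k l (half_word Inl t F1) (half_labels Inl t F1) (half_edges Inl F1) (half_value h Inl t F1) \<chi> *
       (\<Sum>\<chi>' | set \<chi>' \<subseteq> colors k l \<and> length \<chi>' = length (half_labels Inl t F1).
          pairing_coeff l \<chi> \<chi>' *
          half_sum k l (half_word Inr t F2) (half_labels Inr t F2) (half_edges Inr F2) (half_value h Inr t F2) \<chi>'))"
  proof (rule net_sum_cut[OF len])
    show "mset (half_word Inl t F1 @ half_labels Inl t F1) = mset (flat (half_edges Inl F1))"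
      using H1.half_word_labels_set H1.half_edges_set by (metis set_eq_iff_mset_eq_distinct)
    show "mset (half_word Inr t F2 @ half_labels Inr t F2) = mset (flat (half_edges Inr F2))"
      using H2.half_word_labels_set H2.half_edges_set by (metis set_eq_iff_mset_eq_distinct)
    show "set (flat (half_edges Inl F1)) \<inter> set (flat (half_edges Inr F2)) = {}"
      using halves by (simp add: H1.half_edges_set H2.half_edges_set)
  qed (rule H1.half_value_cong H2.half_value_cong H2.half_value_even; blast)+
  finally show ?thesis
    unfolding connection_matrix_def amplitude_def H1.length_half_labels \<kappa>_def
    by (simp add: power_add sum_distrib_left mult_ac)
qed

section \<open>Rank of a factorized matrix\<close>

lemma sum_pointwise: "sum f X j = (\<Sum>x\<in>X. f x j :: complex)"
  by (induction X rule: infinite_finite_induct) auto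

text \<open>All rows lie in the span of \<open>B\<close>, and an independent set in a span has at
  most as many elements as a finite spanning set.\<close>

lemma matrix_rank_le:
  assumes "finite X" and M: "\<And>i j. i \<in> I \<Longrightarrow> j \<in> I \<Longrightarrow> M i j = (\<Sum>x\<in>X. a x i * b x j)"
  shows "matrix_rank I M \<le> enat (card X)"
proof -
  define B where "B = (\<lambda>x j. if j \<in> I then b x j else 0) ` X"
  have row: "matrix_row I M i \<in> fun_space.span B" if "i \<in> I" for i
  proof -
    have "matrix_row I M i = (\<Sum>x\<in>X. (\<lambda>j. a x i * (if j \<in> I then b x j else 0)))"
      using M[OF that] by (auto simp: matrix_row_def fun_eq_iff sum_pointwise)
    also have "\<dots> \<in> fun_space.span B"
      by (intro fun_space.span_sum fun_space.span_scale fun_space.span_base) (auto simp: B_def)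
    finally show ?thesis .
  qed
  show ?thesis
    unfolding matrix_rank_def
  proof (rule SUP_least, clarify)
    fix S assume "S \<subseteq> matrix_row I M ` I" "finite S" "fun_space.independent S"
    moreover from this row have "S \<subseteq> fun_space.span B" by blast
    ultimately have "card S \<le> card B"
      using fun_space.independent_span_bound[of B S] assms(1) by (simp add: B_def)
    also have "card B \<le> card X" unfolding B_def by (rule card_image_le[OF assms(1)])
    finally show "enat (card S) \<le> enat (card X)" by simp
  qed
qed

theorem theorem6:
  fixes k l :: nat and h :: "mixed_alg \<Rightarrow> complex"
  assumes "edge_coloring_model k l h"
  shows "\<forall>t. matrix_rank (fragments t) (connection_matrix (mixed_partition_function k l h) t)
               \<le> enat ((k + 2 * l) ^ t)"
proof
  fix t
  let ?X = "{\<chi>. set \<chi> \<subseteq> colors k l \<and> length \<chi> = t}"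
  have "matrix_rank (fragments t) (connection_matrix (mixed_partition_function k l h) t) \<le> enat (card ?X)"
    by (rule matrix_rank_le)
       (simp_all add: connection_matrix_factorization[OF assms] finite_lists_length_eq)
  also have "card ?X = (k + 2 * l) ^ t"
    by (simp add: card_lists_length_eq card_colors)
  finally show "matrix_rank (fragments t) (connection_matrix (mixed_partition_function k l h) t)
      \<le> enat ((k + 2 * l) ^ t)" .
qed

end
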